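(* Let $n\ge2$ be even and $l\ge3$ odd, and let $\mathbf c=(c_1,\dots,c_{n/2})$ be integers with $-n\le c_1<\dots<c_{n/2}\le-1$. Let $N=n/2$ and $b=(l-5)/2$. The sum, over all vertically symmetric $(n,l)$-alternating sign trapezoids with $1$-column vector $\mathbf c$, of the product of $P$-weight and $Q$-weight equals $$\prod_{r=1}^{N}\left(\mathrm{id}-(P-1)\Delta^Q_{c_r}\right)\left(-\Delta^Q_{c_r}\right)^{-c_r-1}F(c_1,\dots,c_N),$$ where $F(c_1,\dots,c_N)=\prod_{1\le s<t\le N}(\mathrm{E}_{c_s}+\mathrm{E}_{c_t}^{-1}-(2-Q)\mathrm{E}_{c_s}\mathrm{E}_{c_t}^{-1})(\mathrm{E}_{c_s}+\mathrm{E}_{c_t}-(2-Q)\mathrm{E}_{c_s}\mathrm{E}_{c_t})\big[\prod_{1\le i<j\le N}\frac{(c_j-c_i+j-i)(2b+n+1-c_i-c_j-i-j)}{(j-i)(i+j-1)}\big]$. This quantity is also equal to the constant term in $x_1,\dots,x_N$ of $$\prod_{r=1}^{N}x_r^{2-n}(1+x_r)^{c_r-\frac{l-5}{2}-\frac n2}\,\frac{Q-(P-Q)x_r}{Q-(1-Q)x_r}\Big(-\frac{x_r}{Q-(1-Q)x_r}\Big)^{-c_r-1}\prod_{1\le s<t\le N}(x_t-x_s)(x_s+x_t+x_sx_t)(Q+(Q-1)x_s+x_t+x_sx_t)(Q+(Q-1)x_s+(Q-1)x_t+(Q-2)x_sx_t).$$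
   Context: Operators: $\mathrm{E}_x f(x)=f(x+1)$, $\mathrm{E}_x^{-1}f(x)=f(x-1)$, $\mathrm{id}$ the identity, $\Delta_x=\mathrm{E}_x-\mathrm{id}$, $\Delta^Q_x=\Delta_x(\mathrm{id}-(1-Q)\mathrm{E}_x)^{-1}$ (on polynomials the finite sum $Q^{-1}\sum_{i\ge0}(Q^{-1}-1)^i\Delta_x^{i+1}$). Operators in different variables commute; they are applied to the polynomial in the variables $c_1,\dots,c_N$, the exponents $-c_r-1$ being fixed integers given by $\mathbf c$, and the result is evaluated at $\mathbf c$. The constant-term expression is regarded as a formal Laurent series in $x_1,\dots,x_N$ (non-monomial factors expanded as power series, coefficients rational in $P,Q$); the constant term is the coefficient of $x_1^0\cdots x_N^0$. An $(n,l)$-alternating sign trapezoid is an array $(a_{i,j})$ with entries in $\{-1,0,1\}$, indexed by $1\le i\le n$, $i\le j\le 2n+l-1-i$ (rows centred; column $j$, $1\le j\le 2n+l-2$, consists of the existing $a_{i,j}$), such that: nonzero entries alternate in sign along each row and each column; the topmost nonzero entry of each column (if any) is $1$; each row sums to $1$; the entries in the central $l-2$ columns (columns $n+1,\dots,n+l-2$) sum to $0$. It is vertically symmetric if $a_{i,j}=a_{i,2n+l-1-j}$. A $1$-column is a column with sum $1$; it is a $10$-column if its bottom entry (entry in the lowest row meeting the column) is $0$. Columns $1,\dots,n$ are numbered $-n,\dots,-1$ (column $j$ gets number $j-n-1$); the $1$-column vector is the increasing list of the numbers of the $1$-columns among these. The $Q$-weight is $Q$ raised to the number of entries $-1$ in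 the $n-1+(l-1)/2$ leftmost columns; the $P$-weight is $P$ raised to the number of $10$-columns among the $n-1$ leftmost columns. *)

theory Defs
  imports
    "HOL-Library.Poly_Mapping"
    "HOL-Computational_Algebra.Formal_Laurent_Series"
begin

section \<open>Alternating sign trapezoids\<close>

definition ast_index :: "nat \<Rightarrow> nat \<Rightarrow> (nat \<times> nat) set" where
  "ast_index n l = {(i, j). 1 \<le> i \<and> i \<le> n \<and> i \<le> j \<and> j \<le> 2 * n + l - 1 - i}"

definition row_sum :: "nat \<Rightarrow> nat \<Rightarrow> (nat \<Rightarrow> nat \<Rightarrow> int) \<Rightarrow> nat \<Rightarrow> int" where
  "row_sum n l a i = (\<Sum>j | (i, j) \<in> ast_index n l. a i j)"

definition col_sum :: "nat \<Rightarrow> nat \<Rightarrow> (nat \<Rightarrow> nat \<Rightarrow> int) \<Rightarrow> nat \<Rightarrow> int" where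
  "col_sum n l a j = (\<Sum>i | (i, j) \<in> ast_index n l. a i j)"

text \<open>
  The index sets of rows and columns are intervals, so alternation of the nonzero entries means
  that two nonzero entries with only zeros in between have opposite signs. Arrays are set to 0
  outside the index set, so that each trapezoid is represented by exactly one function.
\<close>

definition alternating_sign_trapezoid ::
    "nat \<Rightarrow> nat \<Rightarrow> (nat \<Rightarrow> nat \<Rightarrow> int) \<Rightarrow> bool" where
  "alternating_sign_trapezoid n l a \<longleftrightarrow>
     (\<forall>i j. (i, j) \<notin> ast_index n l \<longrightarrow> a i j = 0) \<and>
     (\<forall>(i, j) \<in> ast_index n l. a i j \<in> {-1, 0, 1}) \<and>
     (\<forall>i j j'. (i, j) \<in> ast_index n l \<and> (i, j') \<in> ast_index n l \<and> j < j' \<and>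
        a i j \<noteq> 0 \<and> a i j' \<noteq> 0 \<and> (\<forall>k. j < k \<and> k < j' \<longrightarrow> a i k = 0) \<longrightarrow> a i j' = - a i j) \<and>
     (\<forall>i i' j. (i, j) \<in> ast_index n l \<and> (i', j) \<in> ast_index n l \<and> i < i' \<and>
        a i j \<noteq> 0 \<and> a i' j \<noteq> 0 \<and> (\<forall>k. i < k \<and> k < i' \<longrightarrow> a k j = 0) \<longrightarrow> a i' j = - a i j) \<and>
     (\<forall>(i, j) \<in> ast_index n l. a i j \<noteq> 0 \<and>
        (\<forall>k. (k, j) \<in> ast_index n l \<and> k < i \<longrightarrow> a k j = 0) \<longrightarrow> a i j = 1) \<and>
     (\<forall>i \<in> {1..n}. row_sum n l a i = 1) \<and>
     (\<Sum>j = n + 1..n + l - 2. col_sum n l a j) = 0"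

definition vertically_symmetric :: "nat \<Rightarrow> nat \<Rightarrow> (nat \<Rightarrow> nat \<Rightarrow> int) \<Rightarrow> bool" where
  "vertically_symmetric n l a \<longleftrightarrow>
     (\<forall>(i, j) \<in> ast_index n l. a i j = a i (2 * n + l - 1 - j))"

definition one_column :: "nat \<Rightarrow> nat \<Rightarrow> (nat \<Rightarrow> nat \<Rightarrow> int) \<Rightarrow> nat \<Rightarrow> bool" where
  "one_column n l a j \<longleftrightarrow> col_sum n l a j = 1"

definition one_zero_column :: "nat \<Rightarrow> nat \<Rightarrow> (nat \<Rightarrow> nat \<Rightarrow> int) \<Rightarrow> nat \<Rightarrow> bool" where
  "one_zero_column n l a j \<longleftrightarrow>
     one_column n l a j \<and> a (Max {i. (i, j) \<in> ast_index n l}) j = 0"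

definition one_column_vector :: "nat \<Rightarrow> nat \<Rightarrow> (nat \<Rightarrow> nat \<Rightarrow> int) \<Rightarrow> int list" where
  "one_column_vector n l a =
     sorted_list_of_set ((\<lambda>j. int j - int n - 1) ` {j \<in> {1..n}. one_column n l a j})"

definition Q_weight ::
    "'a::comm_semiring_1 \<Rightarrow> nat \<Rightarrow> nat \<Rightarrow> (nat \<Rightarrow> nat \<Rightarrow> int) \<Rightarrow> 'a" where
  "Q_weight Q n l a =
     Q ^ card {(i, j). (i, j) \<in> ast_index n l \<and> j \<le> n - 1 + (l - 1) div 2 \<and> a i j = -1}"

definition P_weight ::
    "'a::comm_semiring_1 \<Rightarrow> nat \<Rightarrow> nat \<Rightarrow> (nat \<Rightarrow> nat \<Rightarrow> int) \<Rightarrow> 'a" where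
  "P_weight P n l a = P ^ card {j \<in> {1..n - 1}. one_zero_column n l a j}"


section \<open>Shift and difference operators\<close>

text \<open>
  Polynomials in \<open>c\<^sub>1, c\<^sub>2, \<dots>\<close> are represented by the functions they induce on integer points;
  over a field of characteristic 0 this loses no information.
\<close>

type_synonym 'a op = "((nat \<Rightarrow> int) \<Rightarrow> 'a) \<Rightarrow> ((nat \<Rightarrow> int) \<Rightarrow> 'a)"

definition shift_op :: "nat \<Rightarrow> 'a op" where
  "shift_op r f = (\<lambda>c. f (c(r := c r + 1)))"

definition shift_inv_op :: "nat \<Rightarrow> 'a op" where
  "shift_inv_op r f = (\<lambda>c. f (c(r := c r - 1)))"

definition diff_op :: "nat \<Rightarrow> 'a::ab_group_add op" where
  "diff_op r f = (\<lambda>c. shift_op r f c - f c)"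

text \<open>
  On polynomials the following is \<open>\<Delta> (id - (1 - Q) E)\<^sup>-\<^sup>1\<close>: there
  \<open>id - (1 - Q) E = Q (id - (Q\<^sup>-\<^sup>1 - 1) \<Delta>)\<close>, whose inverse is given by the geometric series,
  which has only finitely many nonzero terms.
\<close>

definition diff_op_Q :: "'a::field \<Rightarrow> nat \<Rightarrow> 'a op" where
  "diff_op_Q Q r f =
     (\<lambda>c. inverse Q * Sum_any (\<lambda>i. (inverse Q - 1) ^ i * (diff_op r ^^ (i + 1)) f c))"

definition neg_diff_op_Q :: "'a::field \<Rightarrow> nat \<Rightarrow> 'a op" where
  "neg_diff_op_Q Q r f = (\<lambda>c. - diff_op_Q Q r f c)"

definition P_op :: "'a::field \<Rightarrow> 'a \<Rightarrow> nat \<Rightarrow> 'a op" where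
  "P_op P Q r f = (\<lambda>c. f c - (P - 1) * diff_op_Q Q r f c)"

definition pair_op_minus :: "'a::comm_ring_1 \<Rightarrow> nat \<Rightarrow> nat \<Rightarrow> 'a op" where
  "pair_op_minus Q s t f =
     (\<lambda>c. shift_op s f c + shift_inv_op t f c - (2 - Q) * shift_op s (shift_inv_op t f) c)"

definition pair_op_plus :: "'a::comm_ring_1 \<Rightarrow> nat \<Rightarrow> nat \<Rightarrow> 'a op" where
  "pair_op_plus Q s t f =
     (\<lambda>c. shift_op s f c + shift_op t f c - (2 - Q) * shift_op s (shift_op t f) c)"

definition base_poly :: "nat \<Rightarrow> int \<Rightarrow> (nat \<Rightarrow> int) \<Rightarrow> 'a::field_char_0" where
  "base_poly n b c = (\<Prod>j = 1..n div 2. \<Prod>i = 1..<j.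
     of_int ((c j - c i + int j - int i) * (2 * b + int n + 1 - c i - c j - int i - int j))
       / of_int ((int j - int i) * (int i + int j - 1)))"

text \<open>
  Products of (commuting) operators are compositions along a list.
\<close>

definition F_poly :: "'a::field_char_0 \<Rightarrow> nat \<Rightarrow> int \<Rightarrow> (nat \<Rightarrow> int) \<Rightarrow> 'a" where
  "F_poly Q n b =
     foldr (\<lambda>(s, t). pair_op_minus Q s t \<circ> pair_op_plus Q s t)
       [(s, t). s \<leftarrow> [1..<n div 2 + 1], t \<leftarrow> [s + 1..<n div 2 + 1]]
       (base_poly n b)"

text \<open>
  The first occurrence of \<open>c\<close> supplies the fixed exponents, the last one the point of evaluation.
\<close>

definition operator_formula ::
    "'a::field_char_0 \<Rightarrow> 'a \<Rightarrow> nat \<Rightarrow> int \<Rightarrow> (nat \<Rightarrow> int) \<Rightarrow> 'a" where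
  "operator_formula P Q n b c =
     foldr (\<lambda>r. P_op P Q r \<circ> (neg_diff_op_Q Q r ^^ nat (- c r - 1)))
       [1..<n div 2 + 1] (F_poly Q n b) c"


section \<open>Formal Laurent series in several variables\<close>

text \<open>
  Families of coefficients indexed by exponent vectors, where only finitely many variables occur
  and the exponents are bounded below, so that the Cauchy product is a finite sum.
\<close>

definition ml_bounded :: "nat set \<Rightarrow> int \<Rightarrow> ((nat \<Rightarrow>\<^sub>0 int) \<Rightarrow> 'a::zero) \<Rightarrow> bool" where
  "ml_bounded V b f \<longleftrightarrow>
     (\<forall>m. f m \<noteq> 0 \<longrightarrow> Poly_Mapping.keys m \<subseteq> V \<and> (\<forall>i. b \<le> Poly_Mapping.lookup m i))"

lemma ml_bounded_mono:
  "ml_bounded V b f \<Longrightarrow> V \<subseteq> V' \<Longrightarrow> b' \<le> b \<Longrightarrow> ml_bounded V' b' f"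
  unfolding ml_bounded_def by (meson order_trans)

typedef (overloaded) 'a mlaurent =
  "{f :: (nat \<Rightarrow>\<^sub>0 int) \<Rightarrow> 'a::zero. \<exists>V b. finite V \<and> ml_bounded V b f}"
  morphisms ml_coeff Abs_mlaurent
proof
  show "(\<lambda>_. 0) \<in> {f :: (nat \<Rightarrow>\<^sub>0 int) \<Rightarrow> 'a. \<exists>V b. finite V \<and> ml_bounded V b f}"
    by (auto simp: ml_bounded_def)
qed

setup_lifting type_definition_mlaurent

lemma ml_bounded_common:
  assumes "\<exists>V b. finite V \<and> ml_bounded V b f" "\<exists>V b. finite V \<and> ml_bounded V b g"
  obtains V b where "finite V" "b \<le> 0" "ml_bounded V b f" "ml_bounded V b g"
proof -
  from assms obtain V b V' b' where *: "finite V" "ml_bounded V b f" "finite V'" "ml_bounded V' b' g"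
    by blast
  show thesis
  proof
    show "finite (V \<union> V')" using * by simp
    show "min 0 (min b b') \<le> 0" by simp
    show "ml_bounded (V \<union> V') (min 0 (min b b')) f"
      by (rule ml_bounded_mono[OF *(2)]) auto
    show "ml_bounded (V \<union> V') (min 0 (min b b')) g"
      by (rule ml_bounded_mono[OF *(4)]) auto
  qed
qed

definition ml_conv ::
    "((nat \<Rightarrow>\<^sub>0 int) \<Rightarrow> 'a::semiring_0) \<Rightarrow> ((nat \<Rightarrow>\<^sub>0 int) \<Rightarrow> 'a) \<Rightarrow> (nat \<Rightarrow>\<^sub>0 int) \<Rightarrow> 'a" where
  "ml_conv f g m = Sum_any (\<lambda>k. f k * g (m - k))"

lemma ml_conv_eq_sum:
  assumes "finite S" "\<And>k. f k * g (m - k) \<noteq> 0 \<Longrightarrow> k \<in> S"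
  shows "ml_conv f g m = (\<Sum>k\<in>S. f k * g (m - k))"
  unfolding ml_conv_def by (rule Sum_any.expand_superset) (use assms in auto)

definition ml_box :: "nat set \<Rightarrow> int \<Rightarrow> (nat \<Rightarrow>\<^sub>0 int) \<Rightarrow> (nat \<Rightarrow>\<^sub>0 int) set" where
  "ml_box V b u = {k. Poly_Mapping.keys k \<subseteq> V \<and>
     (\<forall>i. b \<le> Poly_Mapping.lookup k i \<and> Poly_Mapping.lookup k i \<le> Poly_Mapping.lookup u i - b)}"

lemma finite_ml_box:
  assumes "finite V"
  shows "finite (ml_box V b u)"
proof (rule inj_on_finite)
  let ?F = "\<lambda>k. restrict (Poly_Mapping.lookup k) V"
  show "inj_on ?F (ml_box V b u)"
  proof (rule inj_onI)
    fix k k' assume k: "k \<in> ml_box V b u" "k' \<in> ml_box V b u" and eq: "?F k = ?F k'"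
    show "k = k'"
    proof (rule poly_mapping_eqI)
      fix i
      show "Poly_Mapping.lookup k i = Poly_Mapping.lookup k' i"
      proof (cases "i \<in> V")
        case True
        with fun_cong[OF eq, of i] show ?thesis by simp
      next
        case False
        with k have "i \<notin> Poly_Mapping.keys k" "i \<notin> Poly_Mapping.keys k'"
          by (auto simp: ml_box_def)
        then show ?thesis by (simp add: in_keys_iff)
      qed
    qed
  qed
  show "?F ` ml_box V b u \<subseteq> (\<Pi>\<^sub>E i\<in>V. {b..Poly_Mapping.lookup u i - b})"
    by (auto simp: ml_box_def)
  show "finite (\<Pi>\<^sub>E i\<in>V. {b..Poly_Mapping.lookup u i - b})"
    using assms by (intro finite_PiE) auto
qed

lemma keys_diff_subset:
  "Poly_Mapping.keys (k :: nat \<Rightarrow>\<^sub>0 int) \<subseteq> Poly_Mapping.keys (k - a) \<union> Poly_Mapping.keys a"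
  by (auto simp: in_keys_iff lookup_minus)

lemma ml_box_I:
  assumes "ml_bounded V b f" "ml_bounded V b g" "f k \<noteq> 0" "g (m - k) \<noteq> 0"
  shows "k \<in> ml_box V b m"
proof -
  have "b \<le> Poly_Mapping.lookup k i" "b \<le> Poly_Mapping.lookup (m - k) i" for i
    using assms unfolding ml_bounded_def by blast+
  moreover have "Poly_Mapping.keys k \<subseteq> V"
    using assms unfolding ml_bounded_def by blast
  ultimately show ?thesis
    unfolding ml_box_def by (simp add: lookup_minus algebra_simps)
qed

lemma ml_conv_box:
  assumes "finite V" "ml_bounded V b f" "ml_bounded V b g"
  shows "ml_conv f g m = (\<Sum>k\<in>ml_box V b m. f k * g (m - k))"
proof (rule ml_conv_eq_sum)
  show "k \<in> ml_box V b m" if "f k * g (m - k) \<noteq> 0" for k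
    by (rule ml_box_I[OF assms(2,3)]) (use that in auto)
qed (rule finite_ml_box[OF assms(1)])

lemma ml_conv_nonzero:
  assumes "ml_conv f g m \<noteq> 0"
  obtains k where "f k \<noteq> 0" "g (m - k) \<noteq> 0"
proof -
  have "\<exists>k. f k * g (m - k) \<noteq> 0"
  proof (rule ccontr)
    assume "\<nexists>k. f k * g (m - k) \<noteq> 0"
    then have "ml_conv f g m = 0" unfolding ml_conv_def by simp
    with assms show False by simp
  qed
  then show thesis using that by (metis mult_zero_left mult_zero_right)
qed

lemma ml_bounded_conv:
  assumes "ml_bounded V b f" "ml_bounded V b' g"
  shows "ml_bounded V (b + b') (ml_conv f g)"
  unfolding ml_bounded_def
proof (intro allI impI)
  fix m assume "ml_conv f g m \<noteq> 0"
  then obtain k where k: "f k \<noteq> 0" "g (m - k) \<noteq> 0" by (rule ml_conv_nonzero)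
  have f: "Poly_Mapping.keys k \<subseteq> V" "\<And>i. b \<le> Poly_Mapping.lookup k i"
    using assms k unfolding ml_bounded_def by blast+
  have g: "Poly_Mapping.keys (m - k) \<subseteq> V" "\<And>i. b' \<le> Poly_Mapping.lookup (m - k) i"
    using assms k unfolding ml_bounded_def by blast+
  have "b + b' \<le> Poly_Mapping.lookup m i" for i
    using f(2)[of i] g(2)[of i] by (simp add: lookup_minus)
  moreover have "Poly_Mapping.keys m \<subseteq> V"
    using keys_diff_subset[of m k] f(1) g(1) by blast
  ultimately show "Poly_Mapping.keys m \<subseteq> V \<and> (\<forall>i. b + b' \<le> Poly_Mapping.lookup m i)" by blast
qed

lemma ml_conv_commute:
  fixes f g :: "(nat \<Rightarrow>\<^sub>0 int) \<Rightarrow> 'a::comm_semiring_0"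
  shows "ml_conv f g m = ml_conv g f m"
  unfolding ml_conv_def
proof (rule Sum_any.reindex_cong[of "\<lambda>k. m - k"])
  show "bij (\<lambda>k. m - k)" by (rule o_bij[of "\<lambda>k. m - k"]) auto
  show "(\<lambda>k. f k * g (m - k)) \<circ> (\<lambda>k. m - k) = (\<lambda>k. g k * f (m - k))"
    by (auto simp: mult.commute)
qed

lemma ml_conv_assoc:
  fixes f g h :: "(nat \<Rightarrow>\<^sub>0 int) \<Rightarrow> 'a::comm_semiring_0"
  assumes V: "finite V" and b: "b \<le> 0"
    and f: "ml_bounded V b f" and g: "ml_bounded V b g" and h: "ml_bounded V b h"
  shows "ml_conv (ml_conv f g) h m = ml_conv f (ml_conv g h) m"
proof -
  define B where "B = ml_box V (2 * b) m"
  have V': "finite B" unfolding B_def by (rule finite_ml_box[OF V])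
  have fg: "ml_bounded V (2 * b) (ml_conv f g)" and gh: "ml_bounded V (2 * b) (ml_conv g h)"
    using ml_bounded_conv[OF f g] ml_bounded_conv[OF g h] by (simp_all only: mult_2)
  have f2: "ml_bounded V (2 * b) f" and h2: "ml_bounded V (2 * b) h"
    using ml_bounded_mono[OF f subset_refl] ml_bounded_mono[OF h subset_refl] b by simp_all
  have inB: "k \<in> B \<and> a \<in> B" if "f a \<noteq> 0" "g (k - a) \<noteq> 0" "h (m - k) \<noteq> 0" for a k
  proof -
    have 1: "Poly_Mapping.keys a \<subseteq> V" "\<And>i. b \<le> Poly_Mapping.lookup a i"
      using f that unfolding ml_bounded_def by blast+
    have 2: "Poly_Mapping.keys (k - a) \<subseteq> V" "\<And>i. b \<le> Poly_Mapping.lookup (k - a) i"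
      using g that unfolding ml_bounded_def by blast+
    have 3: "\<And>i. b \<le> Poly_Mapping.lookup (m - k) i"
      using h that unfolding ml_bounded_def by blast
    have 4: "Poly_Mapping.keys k \<subseteq> V" using keys_diff_subset[of k a] 1 2 by blast
    have "2 * b \<le> Poly_Mapping.lookup k i \<and> Poly_Mapping.lookup k i \<le> Poly_Mapping.lookup m i - 2 * b \<and>
        2 * b \<le> Poly_Mapping.lookup a i \<and> Poly_Mapping.lookup a i \<le> Poly_Mapping.lookup m i - 2 * b" for i
      using 1(2)[of i] 2(2)[of i] 3[of i] b by (simp add: lookup_minus)
    with 1 4 show ?thesis unfolding B_def ml_box_def by blast
  qed
  have "ml_conv (ml_conv f g) h m = (\<Sum>k\<in>B. ml_conv f g k * h (m - k))"
    unfolding B_def by (rule ml_conv_box[OF V fg h2])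
  also have "\<dots> = (\<Sum>k\<in>B. \<Sum>a\<in>B. f a * g (k - a) * h (m - k))"
  proof (rule sum.cong[OF refl])
    fix k
    show "ml_conv f g k * h (m - k) = (\<Sum>a\<in>B. f a * g (k - a) * h (m - k))"
    proof (cases "h (m - k) = 0")
      case False
      have "ml_conv f g k = (\<Sum>a\<in>B. f a * g (k - a))"
      proof (rule ml_conv_eq_sum[OF V'])
        fix a assume "f a * g (k - a) \<noteq> 0"
        then have "f a \<noteq> 0" "g (k - a) \<noteq> 0" by auto
        with inB False show "a \<in> B" by blast
      qed
      then show ?thesis by (simp add: sum_distrib_right)
    qed simp
  qed
  also have "\<dots> = (\<Sum>a\<in>B. \<Sum>k\<in>B. f a * g (k - a) * h (m - k))"
    by (rule sum.swap)
  also have "\<dots> = (\<Sum>a\<in>B. f a * ml_conv g h (m - a))"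
  proof (rule sum.cong[OF refl])
    fix a
    show "(\<Sum>k\<in>B. f a * g (k - a) * h (m - k)) = f a * ml_conv g h (m - a)"
    proof (cases "f a = 0")
      case False
      have "ml_conv g h (m - a) = (\<Sum>c\<in>(\<lambda>k. k - a) ` B. g c * h (m - a - c))"
      proof (rule ml_conv_eq_sum)
        fix c assume "g c * h (m - a - c) \<noteq> 0"
        then have "g ((c + a) - a) \<noteq> 0" "h (m - (c + a)) \<noteq> 0"
          by (auto simp: algebra_simps)
        with inB False have "c + a \<in> B" by blast
        then show "c \<in> (\<lambda>k. k - a) ` B" by (metis add_diff_cancel_right' image_eqI)
      qed (use V' in simp)
      also have "\<dots> = (\<Sum>k\<in>B. g (k - a) * h (m - k))"
        by (subst sum.reindex) (auto simp: inj_on_def)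
      finally show ?thesis by (simp add: sum_distrib_left mult.assoc)
    qed simp
  qed
  also have "\<dots> = ml_conv f (ml_conv g h) m"
    unfolding B_def by (rule ml_conv_box[OF V f2 gh, symmetric])
  finally show ?thesis .
qed

lemma ml_conv_add_left:
  assumes "finite V" "ml_bounded V b f" "ml_bounded V b g" "ml_bounded V b h"
  shows "ml_conv (\<lambda>m. f m + g m) h m = ml_conv f h m + ml_conv g h m"
proof -
  have "ml_bounded V b (\<lambda>m. f m + g m)"
    using assms(2,3) unfolding ml_bounded_def by (metis add.right_neutral)
  then show ?thesis
    using assms by (simp add: ml_conv_box distrib_right sum.distrib)
qed

lift_definition ml_const :: "'a::zero \<Rightarrow> 'a mlaurent" is
  "\<lambda>a m. if m = 0 then a else 0"
  by (rule exI[of _ "{}"], rule exI[of _ 0]) (auto simp: ml_bounded_def)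

instantiation mlaurent :: (comm_ring_1) comm_ring_1
begin

lift_definition zero_mlaurent :: "'a mlaurent" is "\<lambda>_. 0"
  by (auto simp: ml_bounded_def)

lift_definition one_mlaurent :: "'a mlaurent" is "\<lambda>m. if m = 0 then 1 else 0"
  by (rule exI[of _ "{}"], rule exI[of _ 0]) (auto simp: ml_bounded_def)

lift_definition plus_mlaurent :: "'a mlaurent \<Rightarrow> 'a mlaurent \<Rightarrow> 'a mlaurent" is
  "\<lambda>f g m. f m + g m"
proof -
  fix f g :: "(nat \<Rightarrow>\<^sub>0 int) \<Rightarrow> 'a"
  assume "\<exists>V b. finite V \<and> ml_bounded V b f" "\<exists>V b. finite V \<and> ml_bounded V b g"
  then obtain V b where "finite V" "ml_bounded V b f" "ml_bounded V b g"
    by (rule ml_bounded_common)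
  then show "\<exists>V b. finite V \<and> ml_bounded V b (\<lambda>m. f m + g m)"
    unfolding ml_bounded_def by (metis add.right_neutral)
qed

lift_definition minus_mlaurent :: "'a mlaurent \<Rightarrow> 'a mlaurent \<Rightarrow> 'a mlaurent" is
  "\<lambda>f g m. f m - g m"
proof -
  fix f g :: "(nat \<Rightarrow>\<^sub>0 int) \<Rightarrow> 'a"
  assume "\<exists>V b. finite V \<and> ml_bounded V b f" "\<exists>V b. finite V \<and> ml_bounded V b g"
  then obtain V b where "finite V" "ml_bounded V b f" "ml_bounded V b g"
    by (rule ml_bounded_common)
  then show "\<exists>V b. finite V \<and> ml_bounded V b (\<lambda>m. f m - g m)"
    unfolding ml_bounded_def by (metis diff_self)
qed

lift_definition uminus_mlaurent :: "'a mlaurent \<Rightarrow> 'a mlaurent" is "\<lambda>f m. - f m"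
  by (simp add: ml_bounded_def)

lift_definition times_mlaurent :: "'a mlaurent \<Rightarrow> 'a mlaurent \<Rightarrow> 'a mlaurent" is ml_conv
proof -
  fix f g :: "(nat \<Rightarrow>\<^sub>0 int) \<Rightarrow> 'a"
  assume "\<exists>V b. finite V \<and> ml_bounded V b f" "\<exists>V b. finite V \<and> ml_bounded V b g"
  then obtain V b where "finite V" "ml_bounded V b f" "ml_bounded V b g"
    by (rule ml_bounded_common)
  then show "\<exists>V b. finite V \<and> ml_bounded V b (ml_conv f g)"
    using ml_bounded_conv by blast
qed

instance
proof
  fix x y z :: "'a mlaurent"
  show "x * y * z = x * (y * z)"
  proof transfer
    fix f g h :: "(nat \<Rightarrow>\<^sub>0 int) \<Rightarrow> 'a"
    assume a: "\<exists>V b. finite V \<and> ml_bounded V b f" "\<exists>V b. finite V \<and> ml_bounded V b g"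
      "\<exists>V b. finite V \<and> ml_bounded V b h"
    obtain V b where 1: "finite V" "b \<le> 0" "ml_bounded V b f" "ml_bounded V b g"
      by (rule ml_bounded_common[OF a(1,2)])
    obtain V' b' where 2: "finite V'" "b' \<le> 0" "ml_bounded V' b' f" "ml_bounded V' b' h"
      by (rule ml_bounded_common[OF a(1,3)])
    show "ml_conv (ml_conv f g) h = ml_conv f (ml_conv g h)"
      by (rule ext, rule ml_conv_assoc[of "V \<union> V'" "min b b'"])
        (use 1 2 in \<open>auto intro: ml_bounded_mono[OF 1(3)] ml_bounded_mono[OF 1(4)] ml_bounded_mono[OF 2(4)]\<close>)
  qed
  show "x * y = y * x"
    by transfer (rule ext, rule ml_conv_commute)
  show "1 * x = x"
  proof (transfer, rule ext)
    fix f :: "(nat \<Rightarrow>\<^sub>0 int) \<Rightarrow> 'a" and m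
    show "ml_conv (\<lambda>m. if m = 0 then 1 else 0) f m = f m"
      by (subst ml_conv_eq_sum[of "{0}"]) (auto split: if_splits)
  qed
  show "(x + y) * z = x * z + y * z"
  proof (transfer, rule ext)
    fix f g h :: "(nat \<Rightarrow>\<^sub>0 int) \<Rightarrow> 'a" and m
    assume a: "\<exists>V b. finite V \<and> ml_bounded V b f" "\<exists>V b. finite V \<and> ml_bounded V b g"
      "\<exists>V b. finite V \<and> ml_bounded V b h"
    obtain V b where 1: "finite V" "b \<le> 0" "ml_bounded V b f" "ml_bounded V b g"
      by (rule ml_bounded_common[OF a(1,2)])
    obtain V' b' where 2: "finite V'" "b' \<le> 0" "ml_bounded V' b' f" "ml_bounded V' b' h"
      by (rule ml_bounded_common[OF a(1,3)])
    show "ml_conv (\<lambda>m. f m + g m) h m = ml_conv f h m + ml_conv g h m"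
      by (rule ml_conv_add_left[of "V \<union> V'" "min b b'"])
        (use 1 2 in \<open>auto intro: ml_bounded_mono[OF 1(3)] ml_bounded_mono[OF 1(4)] ml_bounded_mono[OF 2(4)]\<close>)
  qed
  show "(0 :: 'a mlaurent) \<noteq> 1"
    by transfer (metis zero_neq_one)
qed (transfer; simp add: algebra_simps fun_eq_iff)+

end

text \<open>
  A series in one variable, read as a series in the variable \<open>x\<^sub>r\<close>.
\<close>

lift_definition ml_of_fls :: "nat \<Rightarrow> 'a::zero fls \<Rightarrow> 'a mlaurent" is
  "\<lambda>r g m. if Poly_Mapping.keys m \<subseteq> {r} then fls_nth g (Poly_Mapping.lookup m r) else 0"
proof -
  fix r :: nat and g :: "'a fls"
  have "min 0 (fls_subdegree g) \<le> Poly_Mapping.lookup m i"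
    if "Poly_Mapping.keys m \<subseteq> {r}" "fls_nth g (Poly_Mapping.lookup m r) \<noteq> 0" for m i
  proof (cases "i = r")
    case True
    then show ?thesis using fls_subdegree_leI[OF that(2)] by simp
  next
    case False
    then have "i \<notin> Poly_Mapping.keys m" using that(1) by blast
    then show ?thesis by (simp add: in_keys_iff)
  qed
  then have "ml_bounded {r} (min 0 (fls_subdegree g))
      (\<lambda>m. if Poly_Mapping.keys m \<subseteq> {r} then fls_nth g (Poly_Mapping.lookup m r) else 0)"
    unfolding ml_bounded_def by auto
  then show "\<exists>V b. finite V \<and> ml_bounded V b
      (\<lambda>m. if Poly_Mapping.keys m \<subseteq> {r} then fls_nth g (Poly_Mapping.lookup m r) else 0)"
    by blast
qed

definition ml_X :: "nat \<Rightarrow> 'a::comm_ring_1 mlaurent" where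
  "ml_X r = ml_of_fls r fls_X"

definition ml_constant_term :: "'a::zero mlaurent \<Rightarrow> 'a" where
  "ml_constant_term f = ml_coeff f 0"

text \<open>
  For \<open>Q \<noteq> 0\<close> division by \<open>Q - (1 - Q) x\<close> in the field of formal Laurent series is the expansion
  as a power series, and likewise for negative powers of \<open>1 + x\<close>.
\<close>

definition ct_single ::
    "'a::field_char_0 \<Rightarrow> 'a \<Rightarrow> nat \<Rightarrow> nat \<Rightarrow> (nat \<Rightarrow> int) \<Rightarrow> nat \<Rightarrow> 'a fls" where
  "ct_single P Q n l c r =
     fls_X powi (2 - int n)
     * (1 + fls_X) powi (c r - (int l - 5) div 2 - int (n div 2))
     * ((fls_const Q - fls_const (P - Q) * fls_X) / (fls_const Q - fls_const (1 - Q) * fls_X))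
     * (- (fls_X / (fls_const Q - fls_const (1 - Q) * fls_X))) powi (- c r - 1)"

definition ct_pair :: "'a::field_char_0 \<Rightarrow> nat \<Rightarrow> nat \<Rightarrow> 'a mlaurent" where
  "ct_pair Q s t =
     (ml_X t - ml_X s)
     * (ml_X s + ml_X t + ml_X s * ml_X t)
     * (ml_const Q + ml_const (Q - 1) * ml_X s + ml_X t + ml_X s * ml_X t)
     * (ml_const Q + ml_const (Q - 1) * ml_X s + ml_const (Q - 1) * ml_X t
        + ml_const (Q - 2) * ml_X s * ml_X t)"

definition ct_series ::
    "'a::field_char_0 \<Rightarrow> 'a \<Rightarrow> nat \<Rightarrow> nat \<Rightarrow> (nat \<Rightarrow> int) \<Rightarrow> 'a mlaurent" where
  "ct_series P Q n l c =
     (\<Prod>r = 1..n div 2. ml_of_fls r (ct_single P Q n l c r))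
     * (\<Prod>t = 1..n div 2. \<Prod>s = 1..<t. ct_pair Q s t)"

end

theory Submission
  imports Defs "Jordan_Normal_Form.Determinant"
begin

text \<open>
  Reading a symmetric trapezoid row by row, the left half is determined by the sets of columns whose
  partial sums are 1; consecutive sets interlace, and columns that have ended stay frozen. Weighted
  sums over interlacing sequences of functions of the form \<open>CT (K (1 + x\<^sub>1)\<^bsup>s\<^sub>1\<^esup> \<cdots>)\<close> telescope
  to boundary terms. Two neighbouring variables evaluated at the same point contribute the factor
  \<open>Q + (Q - 1) x\<^sub>t + x\<^sub>s + x\<^sub>s x\<^sub>t\<close>, and such a term vanishes because the kernel becomes antisymmetric after
  multiplication with it; terms at the axis of symmetry vanish because the kernel is a Laurent
  polynomial in \<open>(1 + x) / x\<^sup>2\<close>, which is invariant under \<open>1 + x \<mapsto> 1 / (1 + x)\<close>. In the surviving terms each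
  variable sits at its own point, and they are matched with the Laplace expansion of a Vandermonde
  determinant in \<open>(1 + x) / x\<^sup>2\<close>. Freezing a column amounts to multiplication by
  \<open>- x / (Q - (1 - Q) x)\<close>, the symbol of \<open>- \<Delta>\<^sup>Q\<close>. Hence all weighted sums are constant terms, and so is the
  operator formula, since each operator acts on \<open>(1 + x)\<^sup>c\<close> by multiplication with its symbol.
\<close>

section \<open>Laurent series in several variables\<close>

subsection \<open>One-variable series\<close>

text \<open>The invariant behind the telescoping: the total weight of the first i rows of left
  halves, ending with partial sums 1 exactly at the positions t_0 < ... < t_{k-1}, k = i div 2, is
  the constant term of \<open>row_kernel Q i\<close> times the product of z_r (1 + x_r)^{t_r}, where
  z_r is 1 for a column that has not ended. Summation over the state before a row needs an
  antidifference in every active variable, hence a division by x_r; the poles created in this way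
  are the main obstacle, and all vanishing arguments control them one variable at a time. The power
  1 - N of 1 + x in \<open>kernel\<close> has its origin here: it turns the factors that contain the
  last variable into Laurent polynomials in (1 + x) / x^2. The parameter P enters as 1 + (P - 1) in
  the row in which a column ends. The part P - 1 runs over the previous states that already contain
  this column, and they are the previous states of a row in which the column had ended one row
  earlier. Both parts together multiply the series by 1 - (P - 1) x / (Q - (1 - Q) x), the symbol of
  id - (P - 1) \<Delta>^Q.\<close>

lemma ml_coeff_0 [simp]: "ml_coeff 0 m = 0"
  by (simp add: zero_mlaurent.rep_eq)

lemma ml_coeff_add: "ml_coeff (f + g) m = ml_coeff f m + ml_coeff g m"
  by (simp add: plus_mlaurent.rep_eq)

lemma ml_coeff_minus: "ml_coeff (- f) m = - ml_coeff f m"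
  by (simp add: uminus_mlaurent.rep_eq)

lemma ml_coeff_mult: "ml_coeff (f * g) m = ml_conv (ml_coeff f) (ml_coeff g) m"
  by (simp add: times_mlaurent.rep_eq)

lemma ml_coeff_of_fls:
  "ml_coeff (ml_of_fls r g) m =
     (if Poly_Mapping.keys m \<subseteq> {r} then fls_nth g (Poly_Mapping.lookup m r) else 0)"
  by (simp add: ml_of_fls.rep_eq)

lemma mlaurent_eqI: "(\<And>m. ml_coeff f m = ml_coeff g m) \<Longrightarrow> f = g"
  by (simp add: ml_coeff_inject[symmetric] fun_eq_iff)

lemma keys_subset_singleton_iff:
  "Poly_Mapping.keys m \<subseteq> {r} \<longleftrightarrow> m = Poly_Mapping.single r (Poly_Mapping.lookup m r)"
proof
  assume "Poly_Mapping.keys m \<subseteq> {r}"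
  then show "m = Poly_Mapping.single r (Poly_Mapping.lookup m r)"
    by (intro poly_mapping_eqI) (auto simp: lookup_single when_def in_keys_iff)
next
  assume *: "m = Poly_Mapping.single r (Poly_Mapping.lookup m r)"
  show "Poly_Mapping.keys m \<subseteq> {r}"
    by (subst *) simp
qed

lemma ml_of_fls_0 [simp]: "ml_of_fls r 0 = 0"
  by (rule mlaurent_eqI) (simp add: ml_coeff_of_fls)

lemma ml_coeff_const: "ml_coeff (ml_const a) m = (if m = 0 then a else 0)"
  by (simp add: ml_const.rep_eq)

lemma ml_of_fls_const: "ml_of_fls r (fls_const a) = ml_const a"
proof (rule mlaurent_eqI)
  fix m :: "nat \<Rightarrow>\<^sub>0 int"
  have "m = 0" if "Poly_Mapping.keys m \<subseteq> {r}" "Poly_Mapping.lookup m r = 0"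
    using that keys_subset_singleton_iff[of m r] by simp
  then show "ml_coeff (ml_of_fls r (fls_const a)) m = ml_coeff (ml_const a) m"
    by (auto simp: ml_coeff_of_fls ml_coeff_const)
qed

lemma ml_of_fls_1 [simp]: "ml_of_fls r 1 = (1 :: 'a::comm_ring_1 mlaurent)"
proof -
  have "ml_of_fls r (fls_const 1) = ml_const (1::'a)" by (rule ml_of_fls_const)
  also have "\<dots> = 1" by (rule mlaurent_eqI) (simp add: ml_coeff_const one_mlaurent.rep_eq)
  finally show ?thesis by simp
qed

lemma ml_const_1 [simp]: "ml_const 1 = (1 :: 'a::comm_ring_1 mlaurent)"
  using ml_of_fls_const[of 0 "1::'a"] ml_of_fls_1[of 0, where 'a='a] by simp

lemma ml_const_0 [simp]: "ml_const 0 = (0 :: 'a::comm_ring_1 mlaurent)"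
  using ml_of_fls_const[of 0 "0::'a"] by simp

lemma ml_of_fls_add: "ml_of_fls r (f + g) = ml_of_fls r f + ml_of_fls r g"
  by (rule mlaurent_eqI) (simp add: ml_coeff_of_fls ml_coeff_add)

lemma ml_of_fls_uminus: "ml_of_fls r (- f) = - ml_of_fls r f"
  by (rule mlaurent_eqI) (simp add: ml_coeff_of_fls ml_coeff_minus)

lemma ml_of_fls_diff: "ml_of_fls r (f - g) = ml_of_fls r f - ml_of_fls r g"
  using ml_of_fls_add[of r f "- g"] by (simp add: ml_of_fls_uminus)

text \<open>Exponent vectors supported on \<open>{r}\<close> form a copy of the integers that is
  closed under addition. There the multivariate convolution is the one of \<open>fls\<close>, and
  elsewhere no summand survives.\<close>

lemma ml_of_fls_mult:
  fixes f g :: "'a::comm_ring_1 fls"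
  shows "ml_of_fls r (f * g) = ml_of_fls r f * ml_of_fls r g"
proof (rule mlaurent_eqI)
  fix m
  define S where "S = (Poly_Mapping.single r) ` {fls_subdegree f..Poly_Mapping.lookup m r - fls_subdegree g}"
  have inj: "inj_on (Poly_Mapping.single r) (X :: int set)" for X
    by (rule inj_onI) (drule arg_cong[where f = "\<lambda>p. Poly_Mapping.lookup p r"], simp)
  show "ml_coeff (ml_of_fls r (f * g)) m = ml_coeff (ml_of_fls r f * ml_of_fls r g) m"
  proof (cases "Poly_Mapping.keys m \<subseteq> {r}")
    case True
    then obtain i where m: "m = Poly_Mapping.single r i" by (metis keys_subset_singleton_iff)
    have "ml_coeff (ml_of_fls r f * ml_of_fls r g) m =
      (\<Sum>k\<in>S. ml_coeff (ml_of_fls r f) k * ml_coeff (ml_of_fls r g) (m - k))"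
      unfolding ml_coeff_mult
    proof (rule ml_conv_eq_sum)
      show "finite S" by (simp add: S_def)
      fix k assume nz: "ml_coeff (ml_of_fls r f) k * ml_coeff (ml_of_fls r g) (m - k) \<noteq> 0"
      then have k: "Poly_Mapping.keys k \<subseteq> {r}" "fls_nth f (Poly_Mapping.lookup k r) \<noteq> 0"
        "fls_nth g (Poly_Mapping.lookup (m - k) r) \<noteq> 0"
        by (auto simp: ml_coeff_of_fls split: if_splits)
      then have "fls_subdegree f \<le> Poly_Mapping.lookup k r"
        "fls_subdegree g \<le> Poly_Mapping.lookup (m - k) r"
        by (auto intro: fls_subdegree_leI)
      then have "Poly_Mapping.lookup k r \<in> {fls_subdegree f..Poly_Mapping.lookup m r - fls_subdegree g}"
        by (simp add: lookup_minus)
      moreover have "k = Poly_Mapping.single r (Poly_Mapping.lookup k r)"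
        by (rule iffD1[OF keys_subset_singleton_iff k(1)])
      ultimately show "k \<in> S" unfolding S_def by blast
    qed
    also have "\<dots> = (\<Sum>j = fls_subdegree f..i - fls_subdegree g. fls_nth f j * fls_nth g (i - j))"
    proof -
      have "ml_coeff (ml_of_fls r f) (Poly_Mapping.single r j) *
          ml_coeff (ml_of_fls r g) (m - Poly_Mapping.single r j) = fls_nth f j * fls_nth g (i - j)" for j
        unfolding m single_diff[symmetric] by (simp add: ml_coeff_of_fls)
      then show ?thesis
        unfolding S_def by (subst sum.reindex[OF inj]) (simp add: m)
    qed
    also have "\<dots> = ml_coeff (ml_of_fls r (f * g)) m"
      using m by (simp add: ml_coeff_of_fls fls_times_nth(2))
    finally show ?thesis by simp
  next
    case False
    have "ml_conv (ml_coeff (ml_of_fls r f)) (ml_coeff (ml_of_fls r g)) m = 0"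
    proof (rule ccontr)
      assume "ml_conv (ml_coeff (ml_of_fls r f)) (ml_coeff (ml_of_fls r g)) m \<noteq> 0"
      then obtain k where "ml_coeff (ml_of_fls r f) k \<noteq> 0" "ml_coeff (ml_of_fls r g) (m - k) \<noteq> 0"
        by (rule ml_conv_nonzero)
      then have "Poly_Mapping.keys k \<subseteq> {r}" "Poly_Mapping.keys (m - k) \<subseteq> {r}"
        by (auto simp: ml_coeff_of_fls split: if_splits)
      with keys_diff_subset[of m k] False show False by blast
    qed
    with False show ?thesis by (simp add: ml_coeff_mult ml_coeff_of_fls)
  qed
qed

lemma ml_of_fls_power: "ml_of_fls r (f ^ k) = ml_of_fls r (f :: 'a::comm_ring_1 fls) ^ k"
  by (induction k) (auto simp: ml_of_fls_mult)

lemma ml_const_add: "ml_const (a + b) = ml_const a + (ml_const b :: 'a::comm_ring_1 mlaurent)"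
  using ml_of_fls_add[of 0 "fls_const a" "fls_const b"]
  by (simp add: ml_of_fls_const fls_plus_const fls_minus_const)

lemma ml_const_diff: "ml_const (a - b) = ml_const a - (ml_const b :: 'a::comm_ring_1 mlaurent)"
  using ml_of_fls_diff[of 0 "fls_const a" "fls_const b"]
  by (simp add: ml_of_fls_const fls_plus_const fls_minus_const)


subsection \<open>Constant terms\<close>

text \<open>A series that does not involve x_r. The weaker \<open>ml_regular\<close> below only
  excludes poles in x_r; for such series the constant term may be computed at x_r = 0.\<close>

definition ml_free :: "nat \<Rightarrow> 'a::zero mlaurent \<Rightarrow> bool" where
  "ml_free r f \<longleftrightarrow> (\<forall>m. ml_coeff f m \<noteq> 0 \<longrightarrow> Poly_Mapping.lookup m r = 0)"

definition ml_regular :: "nat \<Rightarrow> 'a::zero mlaurent \<Rightarrow> bool" where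
  "ml_regular r f \<longleftrightarrow> (\<forall>m. ml_coeff f m \<noteq> 0 \<longrightarrow> Poly_Mapping.lookup m r \<ge> 0)"

lemma constant_term_0 [simp]: "ml_constant_term 0 = 0"
  by (simp add: ml_constant_term_def)

lemma constant_term_1 [simp]: "ml_constant_term 1 = 1"
  by (simp add: ml_constant_term_def one_mlaurent.rep_eq)

lemma constant_term_add: "ml_constant_term (f + g) = ml_constant_term f + ml_constant_term g"
  by (simp add: ml_constant_term_def ml_coeff_add)

lemma constant_term_uminus: "ml_constant_term (- f) = - ml_constant_term f"
  by (simp add: ml_constant_term_def ml_coeff_minus)

lemma constant_term_diff: "ml_constant_term (f - g) = ml_constant_term f - ml_constant_term g"
  using constant_term_add[of f "- g"] by (simp add: constant_term_uminus)

lemma constant_term_sum: "ml_constant_term (\<Sum>i\<in>I. f i) = (\<Sum>i\<in>I. ml_constant_term (f i))"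
  by (induction I rule: infinite_finite_induct) (auto simp: constant_term_add)

lemma constant_term_sign:
  "ml_constant_term ((-1) ^ k * f) = (-1) ^ k * ml_constant_term (f :: 'a::comm_ring_1 mlaurent)"
  by (cases "even k") (auto simp: constant_term_uminus)

lemma ml_free_regular: "ml_free r f \<Longrightarrow> ml_regular r f"
  by (force simp: ml_free_def ml_regular_def)

lemma ml_free_mult:
  fixes f g :: "'a::comm_ring_1 mlaurent"
  assumes "ml_free r f" "ml_free r g"
  shows "ml_free r (f * g)"
  unfolding ml_free_def ml_coeff_mult
proof (intro allI impI)
  fix m assume "ml_conv (ml_coeff f) (ml_coeff g) m \<noteq> 0"
  then obtain k where "ml_coeff f k \<noteq> 0" "ml_coeff g (m - k) \<noteq> 0" by (rule ml_conv_nonzero)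
  with assms have "Poly_Mapping.lookup k r = 0" "Poly_Mapping.lookup (m - k) r = 0"
    unfolding ml_free_def by blast+
  then show "Poly_Mapping.lookup m r = 0" by (simp add: lookup_minus)
qed

lemma ml_regular_mult:
  fixes f g :: "'a::comm_ring_1 mlaurent"
  assumes "ml_regular r f" "ml_regular r g"
  shows "ml_regular r (f * g)"
  unfolding ml_regular_def ml_coeff_mult
proof (intro allI impI)
  fix m assume "ml_conv (ml_coeff f) (ml_coeff g) m \<noteq> 0"
  then obtain k where "ml_coeff f k \<noteq> 0" "ml_coeff g (m - k) \<noteq> 0" by (rule ml_conv_nonzero)
  with assms have "Poly_Mapping.lookup k r \<ge> 0" "Poly_Mapping.lookup (m - k) r \<ge> 0"
    unfolding ml_regular_def by blast+
  then show "Poly_Mapping.lookup m r \<ge> 0" by (simp add: lookup_minus)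
qed

lemma ml_free_add: "ml_free r f \<Longrightarrow> ml_free r g \<Longrightarrow> ml_free r (f + g)"
  unfolding ml_free_def ml_coeff_add by (metis add.right_neutral)

lemma ml_regular_add: "ml_regular r f \<Longrightarrow> ml_regular r g \<Longrightarrow> ml_regular r (f + g)"
  unfolding ml_regular_def ml_coeff_add by (metis add.right_neutral)

lemma ml_free_uminus: "ml_free r f \<Longrightarrow> ml_free r (- f)"
  unfolding ml_free_def ml_coeff_minus by simp

lemma ml_regular_uminus: "ml_regular r f \<Longrightarrow> ml_regular r (- f)"
  unfolding ml_regular_def ml_coeff_minus by simp

lemma ml_free_diff: "ml_free r f \<Longrightarrow> ml_free r g \<Longrightarrow> ml_free r (f - g)"
  using ml_free_add[of r f "- g"] ml_free_uminus[of r g] by simp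

lemma ml_regular_diff: "ml_regular r f \<Longrightarrow> ml_regular r g \<Longrightarrow> ml_regular r (f - g)"
  using ml_regular_add[of r f "- g"] ml_regular_uminus[of r g] by simp

lemma ml_free_of_fls: "r \<noteq> s \<Longrightarrow> ml_free r (ml_of_fls s g)"
  by (auto simp: ml_free_def ml_coeff_of_fls in_keys_iff split: if_splits)

lemma ml_regular_of_fls: "fls_subdegree g \<ge> 0 \<Longrightarrow> ml_regular r (ml_of_fls s g)"
  unfolding ml_regular_def
proof (intro allI impI)
  fix m assume g: "fls_subdegree g \<ge> 0" and "ml_coeff (ml_of_fls s g) m \<noteq> 0"
  then have m: "Poly_Mapping.keys m \<subseteq> {s}" "fls_nth g (Poly_Mapping.lookup m s) \<noteq> 0"
    by (auto simp: ml_coeff_of_fls split: if_splits)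
  show "Poly_Mapping.lookup m r \<ge> 0"
  proof (cases "r = s")
    case True
    then show ?thesis using fls_subdegree_leI[OF m(2)] g by simp
  next
    case False
    then have "r \<notin> Poly_Mapping.keys m" using m(1) by blast
    then show ?thesis by (simp add: in_keys_iff)
  qed
qed

lemma ml_free_const: "ml_free r (ml_const a)"
  using ml_free_of_fls[of r "Suc r" "fls_const a"] by (simp add: ml_of_fls_const)

lemma ml_regular_const: "ml_regular r (ml_const a)"
  by (rule ml_free_regular[OF ml_free_const])

lemma ml_free_1: "ml_free r (1 :: 'a::comm_ring_1 mlaurent)"
  using ml_free_const[of r "1::'a"] by simp

lemma ml_free_prod:
  "(\<And>i. i \<in> I \<Longrightarrow> ml_free r (f i)) \<Longrightarrow> ml_free r (\<Prod>i\<in>I. f i :: 'a::comm_ring_1 mlaurent)"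
  by (induction I rule: infinite_finite_induct) (auto intro: ml_free_mult ml_free_1)

lemma ml_regular_prod:
  "(\<And>i. i \<in> I \<Longrightarrow> ml_regular r (f i)) \<Longrightarrow> ml_regular r (\<Prod>i\<in>I. f i :: 'a::comm_ring_1 mlaurent)"
  by (induction I rule: infinite_finite_induct)
    (auto intro: ml_regular_mult ml_free_1 ml_free_regular)

text \<open>Since \<open>C\<close> offers only the exponent 0 in x_r, so must the other factor.
  Multivariate constant terms are reduced to coefficients of \<open>fls\<close> in this way.\<close>

lemma constant_term_free_mult:
  fixes C :: "'a::comm_ring_1 mlaurent"
  assumes "ml_free r C"
  shows "ml_constant_term (C * ml_of_fls r g) = ml_constant_term C * fls_nth g 0"
proof -
  have "ml_conv (ml_coeff C) (ml_coeff (ml_of_fls r g)) 0 =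
    (\<Sum>k\<in>{0}. ml_coeff C k * ml_coeff (ml_of_fls r g) (0 - k))"
  proof (rule ml_conv_eq_sum)
    fix k assume "ml_coeff C k * ml_coeff (ml_of_fls r g) (0 - k) \<noteq> 0"
    then have k: "ml_coeff C k \<noteq> 0" "Poly_Mapping.keys k \<subseteq> {r}"
      by (auto simp: ml_coeff_of_fls split: if_splits)
    have "k = Poly_Mapping.single r (Poly_Mapping.lookup k r)"
      by (rule iffD1[OF keys_subset_singleton_iff k(2)])
    also have "Poly_Mapping.lookup k r = 0"
      using assms k(1) unfolding ml_free_def by blast
    finally have "k = Poly_Mapping.single r 0" .
    then show "k \<in> {0}" by simp
  qed simp
  then show ?thesis by (simp add: ml_constant_term_def ml_coeff_mult ml_coeff_of_fls)
qed

lemma constant_term_X_mult_regular: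
  fixes R :: "'a::comm_ring_1 mlaurent"
  assumes "ml_regular r R"
  shows "ml_constant_term (ml_X r * R) = 0"
proof (rule ccontr)
  assume "ml_constant_term (ml_X r * R) \<noteq> 0"
  then have "ml_conv (ml_coeff (ml_X r)) (ml_coeff R) 0 \<noteq> 0"
    by (simp add: ml_constant_term_def ml_coeff_mult)
  then obtain k where k: "ml_coeff (ml_X r) k \<noteq> (0::'a)" "ml_coeff R (0 - k) \<noteq> 0"
    by (rule ml_conv_nonzero)
  from k(1) have "Poly_Mapping.lookup k r = 1"
    by (auto simp: ml_X_def ml_coeff_of_fls split: if_splits)
  moreover from k(2) assms have "Poly_Mapping.lookup (0 - k) r \<ge> 0"
    unfolding ml_regular_def by blast
  ultimately show False by (simp add: lookup_minus)
qed

lemma constant_term_prod_of_fls: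
  "finite I \<Longrightarrow> ml_constant_term (\<Prod>r\<in>I. ml_of_fls r (g r)) = (\<Prod>r\<in>I. fls_nth (g r :: 'a::comm_ring_1 fls) 0)"
proof (induction I rule: finite_induct)
  case (insert r I)
  have "ml_free r (\<Prod>r\<in>I. ml_of_fls r (g r))"
    using insert by (intro ml_free_prod ml_free_of_fls) auto
  from constant_term_free_mult[OF this] insert show ?case
    by (simp add: mult.commute)
qed simp


subsection \<open>Renaming variables\<close>

text \<open>A renaming that is not injective would identify variables, and coefficients would have
  to be added; that case is sent to 0. The renamings in use are transpositions of neighbours,
  \<open>skip p\<close> and \<open>Suc\<close>.\<close>

lift_definition ml_rename :: "(nat \<Rightarrow> nat) \<Rightarrow> 'a::zero mlaurent \<Rightarrow> 'a mlaurent" is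
  "\<lambda>\<rho> f m. if inj \<rho> \<and> Poly_Mapping.keys m \<subseteq> range \<rho> then f (Poly_Mapping.map_key \<rho> m) else 0"
proof -
  fix \<rho> :: "nat \<Rightarrow> nat" and f :: "(nat \<Rightarrow>\<^sub>0 int) \<Rightarrow> 'a"
  assume "\<exists>V b. finite V \<and> ml_bounded V b f"
  then obtain V b where V: "finite V" "ml_bounded V b f" by blast
  have "ml_bounded (\<rho> ` V) (min b 0)
    (\<lambda>m. if inj \<rho> \<and> Poly_Mapping.keys m \<subseteq> range \<rho> then f (Poly_Mapping.map_key \<rho> m) else 0)"
    unfolding ml_bounded_def
  proof (intro allI impI)
    fix m assume "(if inj \<rho> \<and> Poly_Mapping.keys m \<subseteq> range \<rho> then f (Poly_Mapping.map_key \<rho> m) else 0) \<noteq> 0"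
    then have inj: "inj \<rho>" and sub: "Poly_Mapping.keys m \<subseteq> range \<rho>"
      and nz: "f (Poly_Mapping.map_key \<rho> m) \<noteq> 0"
      by (auto split: if_splits)
    from V(2) nz have 1: "Poly_Mapping.keys (Poly_Mapping.map_key \<rho> m) \<subseteq> V"
      "\<And>i. b \<le> Poly_Mapping.lookup (Poly_Mapping.map_key \<rho> m) i"
      unfolding ml_bounded_def by blast+
    have "Poly_Mapping.keys m \<subseteq> \<rho> ` V"
      using 1(1) sub unfolding keys_map_key[OF inj] by blast
    moreover have "min b 0 \<le> Poly_Mapping.lookup m i" for i
    proof (cases "i \<in> range \<rho>")
      case True
      then show ?thesis using 1(2) by (auto simp: map_key.rep_eq[OF inj] min.coboundedI1)
    next
      case False
      then have "i \<notin> Poly_Mapping.keys m" using sub by blast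
      then show ?thesis by (simp add: in_keys_iff)
    qed
    ultimately show "Poly_Mapping.keys m \<subseteq> \<rho> ` V \<and> (\<forall>i. min b 0 \<le> Poly_Mapping.lookup m i)" by blast
  qed
  then show "\<exists>V b. finite V \<and> ml_bounded V b
    (\<lambda>m. if inj \<rho> \<and> Poly_Mapping.keys m \<subseteq> range \<rho> then f (Poly_Mapping.map_key \<rho> m) else 0)"
    using V(1) by blast
qed

lemma map_key_surj:
  assumes "inj \<rho>"
  obtains m where "Poly_Mapping.keys m \<subseteq> range \<rho>" "Poly_Mapping.map_key \<rho> m = (k :: nat \<Rightarrow>\<^sub>0 int)"
proof
  define m where "m = (\<Sum>i\<in>Poly_Mapping.keys k. Poly_Mapping.single (\<rho> i) (Poly_Mapping.lookup k i))"
  show "Poly_Mapping.keys m \<subseteq> range \<rho>"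
    unfolding m_def by (rule subset_trans[OF keys_sum]) (auto split: if_splits)
  show "Poly_Mapping.map_key \<rho> m = k"
  proof (rule poly_mapping_eqI)
    fix i
    have "Poly_Mapping.lookup (Poly_Mapping.map_key \<rho> m) i =
       (\<Sum>j\<in>Poly_Mapping.keys k. if j = i then Poly_Mapping.lookup k j else 0)"
      using assms
      by (auto simp: map_key.rep_eq m_def lookup_sum lookup_single when_def inj_eq intro!: sum.cong)
    also have "\<dots> = Poly_Mapping.lookup k i"
      by (simp add: in_keys_iff)
    finally show "Poly_Mapping.lookup (Poly_Mapping.map_key \<rho> m) i = Poly_Mapping.lookup k i" .
  qed
qed

lemma map_key_inj_on:
  assumes "inj \<rho>"
  shows "inj_on (Poly_Mapping.map_key \<rho>) {m :: nat \<Rightarrow>\<^sub>0 int. Poly_Mapping.keys m \<subseteq> range \<rho>}"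
proof (rule inj_onI, rule poly_mapping_eqI)
  fix m m' :: "nat \<Rightarrow>\<^sub>0 int" and i
  assume *: "m \<in> {m. Poly_Mapping.keys m \<subseteq> range \<rho>}" "m' \<in> {m. Poly_Mapping.keys m \<subseteq> range \<rho>}"
    "Poly_Mapping.map_key \<rho> m = Poly_Mapping.map_key \<rho> m'"
  show "Poly_Mapping.lookup m i = Poly_Mapping.lookup m' i"
  proof (cases "i \<in> range \<rho>")
    case True
    then obtain j where "i = \<rho> j" by auto
    with arg_cong[OF *(3), of "\<lambda>p. Poly_Mapping.lookup p j"] show ?thesis
      by (simp add: map_key.rep_eq[OF assms])
  next
    case False
    then have "i \<notin> Poly_Mapping.keys m" "i \<notin> Poly_Mapping.keys m'" using * by auto
    then show ?thesis by (simp add: in_keys_iff)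
  qed
qed

lemma ml_coeff_rename:
  assumes "inj \<rho>"
  shows "ml_coeff (ml_rename \<rho> f) m =
    (if Poly_Mapping.keys m \<subseteq> range \<rho> then ml_coeff f (Poly_Mapping.map_key \<rho> m) else 0)"
  using assms by (simp add: ml_rename.rep_eq)

lemma map_key_diff:
  assumes "inj \<rho>"
  shows "Poly_Mapping.map_key \<rho> (m - k) = Poly_Mapping.map_key \<rho> m - Poly_Mapping.map_key \<rho> (k :: nat \<Rightarrow>\<^sub>0 int)"
  by (rule poly_mapping_eqI) (simp add: map_key.rep_eq[OF assms] lookup_minus)

text \<open>\<open>map_key\<close> identifies the exponent vectors supported on the range of \<rho>
  with all exponent vectors and respects differences, so the convolution sum can be reindexed along
  it.\<close>

lemma ml_rename_mult:
  fixes f g :: "'a::comm_ring_1 mlaurent"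
  assumes \<rho>: "inj \<rho>"
  shows "ml_rename \<rho> (f * g) = ml_rename \<rho> f * ml_rename \<rho> g"
proof (rule mlaurent_eqI)
  fix m
  let ?f = "ml_coeff (ml_rename \<rho> f)" and ?g = "ml_coeff (ml_rename \<rho> g)"
  show "ml_coeff (ml_rename \<rho> (f * g)) m = ml_coeff (ml_rename \<rho> f * ml_rename \<rho> g) m"
  proof (cases "Poly_Mapping.keys m \<subseteq> range \<rho>")
    case True
    let ?m = "Poly_Mapping.map_key \<rho> m"
    obtain V b where V: "finite V" "ml_bounded V b (ml_coeff f)" "ml_bounded V b (ml_coeff g)"
      using ml_bounded_common[of "ml_coeff f" "ml_coeff g"] ml_coeff[of f] ml_coeff[of g] by blast
    define S where "S = ml_box V b ?m"
    define T where "T = {k. Poly_Mapping.keys k \<subseteq> range \<rho> \<and> Poly_Mapping.map_key \<rho> k \<in> S}"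
    have bij: "bij_betw (Poly_Mapping.map_key \<rho>) T S"
      unfolding bij_betw_def
    proof
      show "inj_on (Poly_Mapping.map_key \<rho>) T"
        by (rule inj_on_subset[OF map_key_inj_on[OF \<rho>]]) (auto simp: T_def)
      show "Poly_Mapping.map_key \<rho> ` T = S"
      proof
        show "S \<subseteq> Poly_Mapping.map_key \<rho> ` T"
        proof
          fix k assume "k \<in> S"
          moreover obtain k' where "Poly_Mapping.keys k' \<subseteq> range \<rho>" "Poly_Mapping.map_key \<rho> k' = k"
            by (rule map_key_surj[OF \<rho>])
          ultimately show "k \<in> Poly_Mapping.map_key \<rho> ` T" unfolding T_def by blast
        qed
      qed (auto simp: T_def)
    qed
    have fin: "finite S" unfolding S_def by (rule finite_ml_box[OF V(1)])
    have sub: "Poly_Mapping.keys (m - k) \<subseteq> range \<rho>" if "Poly_Mapping.keys k \<subseteq> range \<rho>" for k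
    proof
      fix i assume "i \<in> Poly_Mapping.keys (m - k)"
      then have "i \<in> Poly_Mapping.keys m \<or> i \<in> Poly_Mapping.keys k"
        by (auto simp: in_keys_iff lookup_minus)
      with True that show "i \<in> range \<rho>" by blast
    qed
    have "ml_coeff (ml_rename \<rho> f * ml_rename \<rho> g) m = (\<Sum>k\<in>T. ?f k * ?g (m - k))"
      unfolding ml_coeff_mult
    proof (rule ml_conv_eq_sum)
      show "finite T" using bij fin bij_betw_finite by blast
      fix k assume nz: "?f k * ?g (m - k) \<noteq> 0"
      then have k: "Poly_Mapping.keys k \<subseteq> range \<rho>" "ml_coeff f (Poly_Mapping.map_key \<rho> k) \<noteq> 0"
        "ml_coeff g (?m - Poly_Mapping.map_key \<rho> k) \<noteq> 0"
        by (auto simp: ml_coeff_rename[OF \<rho>] map_key_diff[OF \<rho>] split: if_splits)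
      from ml_box_I[OF V(2,3) k(2,3)] k(1) show "k \<in> T" unfolding T_def S_def by blast
    qed
    also have "\<dots> = (\<Sum>k\<in>T. ml_coeff f (Poly_Mapping.map_key \<rho> k) * ml_coeff g (?m - Poly_Mapping.map_key \<rho> k))"
      by (rule sum.cong) (auto simp: ml_coeff_rename[OF \<rho>] map_key_diff[OF \<rho>] T_def sub)
    also have "\<dots> = (\<Sum>k\<in>S. ml_coeff f k * ml_coeff g (?m - k))"
      by (rule sum.reindex_bij_betw[OF bij])
    also have "\<dots> = ml_coeff (ml_rename \<rho> (f * g)) m"
      using True by (simp add: ml_coeff_rename[OF \<rho>] ml_coeff_mult ml_conv_box[OF V] S_def)
    finally show ?thesis by simp
  next
    case False
    have "ml_conv ?f ?g m = 0"
    proof (rule ccontr)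
      assume "ml_conv ?f ?g m \<noteq> 0"
      then obtain k where "?f k \<noteq> 0" "?g (m - k) \<noteq> 0" by (rule ml_conv_nonzero)
      then have "Poly_Mapping.keys k \<subseteq> range \<rho>" "Poly_Mapping.keys (m - k) \<subseteq> range \<rho>"
        by (auto simp: ml_coeff_rename[OF \<rho>] split: if_splits)
      with keys_diff_subset[of m k] False show False by blast
    qed
    with False show ?thesis by (simp add: ml_coeff_mult ml_coeff_rename[OF \<rho>])
  qed
qed

lemma ml_rename_add: "inj \<rho> \<Longrightarrow> ml_rename \<rho> (f + g) = ml_rename \<rho> f + ml_rename \<rho> g"
  by (rule mlaurent_eqI) (simp add: ml_coeff_rename ml_coeff_add)

lemma ml_rename_uminus: "inj \<rho> \<Longrightarrow> ml_rename \<rho> (- f) = - ml_rename \<rho> f"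
  by (rule mlaurent_eqI) (simp add: ml_coeff_rename ml_coeff_minus)

lemma ml_rename_diff: "inj \<rho> \<Longrightarrow> ml_rename \<rho> (f - g) = ml_rename \<rho> f - ml_rename \<rho> g"
  using ml_rename_add[of \<rho> f "- g"] ml_rename_uminus[of \<rho> g] by simp

lemma ml_rename_of_fls:
  assumes "inj \<rho>"
  shows "ml_rename \<rho> (ml_of_fls r g) = ml_of_fls (\<rho> r) g"
proof (rule mlaurent_eqI)
  fix m :: "nat \<Rightarrow>\<^sub>0 int"
  have "Poly_Mapping.keys m \<subseteq> range \<rho> \<and> \<rho> -` Poly_Mapping.keys m \<subseteq> {r} \<longleftrightarrow> Poly_Mapping.keys m \<subseteq> {\<rho> r}"
    using assms by (auto simp: inj_eq)
  then show "ml_coeff (ml_rename \<rho> (ml_of_fls r g)) m = ml_coeff (ml_of_fls (\<rho> r) g) m"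
    using assms by (auto simp: ml_coeff_rename ml_coeff_of_fls keys_map_key map_key.rep_eq)
qed

lemma ml_rename_const: "inj \<rho> \<Longrightarrow> ml_rename \<rho> (ml_const a) = ml_const a"
  using ml_rename_of_fls[of \<rho> 0 "fls_const a"] by (simp add: ml_of_fls_const)

lemma ml_rename_1: "inj \<rho> \<Longrightarrow> ml_rename \<rho> 1 = (1 :: 'a::comm_ring_1 mlaurent)"
  using ml_rename_const[of \<rho> "1::'a"] by simp

lemma ml_rename_prod:
  "inj \<rho> \<Longrightarrow> ml_rename \<rho> (\<Prod>i\<in>I. f i) = (\<Prod>i\<in>I. ml_rename \<rho> (f i :: 'a::comm_ring_1 mlaurent))"
  by (induction I rule: infinite_finite_induct) (auto simp: ml_rename_mult ml_rename_1)

lemma ml_rename_X: "inj \<rho> \<Longrightarrow> ml_rename \<rho> (ml_X r) = ml_X (\<rho> r)"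
  by (simp add: ml_X_def ml_rename_of_fls)

lemmas ml_rename_simps = ml_rename_mult ml_rename_add ml_rename_uminus ml_rename_diff
  ml_rename_of_fls ml_rename_const ml_rename_1 ml_rename_prod ml_rename_X

lemma constant_term_rename: "inj \<rho> \<Longrightarrow> ml_constant_term (ml_rename \<rho> f) = ml_constant_term f"
  by (simp add: ml_constant_term_def ml_coeff_rename)

section \<open>Vandermonde determinants\<close>

text \<open>The matrix is the Vandermonde matrix times the matrix of coefficients. With the degrees
  in descending order the latter is lower triangular, with the leading coefficients on its
  diagonal.\<close>

lemma det_polys:
  fixes p :: "nat \<Rightarrow> 'a::comm_ring_1 poly" and z :: "nat \<Rightarrow> 'a"
  assumes "\<And>j. j < N \<Longrightarrow> degree (p j) \<le> j"
  shows "det (mat N N (\<lambda>(i, j). poly (p (N - 1 - j)) (z i))) =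
    (\<Prod>j<N. coeff (p j) j) * det (mat N N (\<lambda>(i, j). z i ^ (N - 1 - j)))"
proof -
  define C where "C = mat N N (\<lambda>(k, j). coeff (p (N - 1 - j)) (N - 1 - k))"
  define W where "W = mat N N (\<lambda>(i, j). z i ^ (N - 1 - j))"
  have C: "C \<in> carrier_mat N N" and W: "W \<in> carrier_mat N N" by (simp_all add: C_def W_def)
  have poly_eq: "poly (p (N - 1 - j)) x = (\<Sum>k<N. x ^ (N - 1 - k) * coeff (p (N - 1 - j)) (N - 1 - k))"
    if "j < N" for x j
  proof -
    have le: "degree (p (N - 1 - j)) < N" using that assms[of "N - 1 - j"] by linarith
    have "poly (p (N - 1 - j)) x = (\<Sum>k\<le>degree (p (N - 1 - j)). coeff (p (N - 1 - j)) k * x ^ k)"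
      by (simp add: poly_altdef)
    also have "\<dots> = (\<Sum>k<N. coeff (p (N - 1 - j)) k * x ^ k)"
      using le by (intro sum.mono_neutral_left) (auto simp: not_le coeff_eq_0)
    also have "\<dots> = (\<Sum>k<N. coeff (p (N - 1 - j)) (N - Suc k) * x ^ (N - Suc k))"
      by (rule sum.nat_diff_reindex[symmetric])
    finally show ?thesis by (simp add: mult.commute)
  qed
  have "mat N N (\<lambda>(i, j). poly (p (N - 1 - j)) (z i)) = W * C"
    by (rule eq_matI) (auto simp: W_def C_def scalar_prod_def atLeast0LessThan poly_eq[simplified])
  moreover have "det C = (\<Prod>j<N. coeff (p j) j)"
  proof -
    have "C $$ (i, j) = 0" if "i < j" "j < N" for i j
      using that assms[of "N - 1 - j"] by (auto simp: C_def intro!: coeff_eq_0)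
    then have "det C = prod_list (diag_mat C)" using C by (intro det_lower_triangular) auto
    also have "\<dots> = (\<Prod>j<N. coeff (p (N - Suc j)) (N - Suc j))"
      unfolding prod_list_diag_prod by (auto simp: C_def atLeast0LessThan)
    also have "\<dots> = (\<Prod>j<N. coeff (p j) j)" by (rule prod.nat_diff_reindex)
    finally show ?thesis .
  qed
  ultimately show ?thesis using det_mult[OF W C] by (simp add: W_def mult.commute)
qed

definition index_pairs :: "nat \<Rightarrow> (nat \<times> nat) set" where
  "index_pairs N = {(s, t). s < t \<and> t < N}"

lemma finite_index_pairs [simp]: "finite (index_pairs N)"
  by (rule finite_subset[of _ "{..<N} \<times> {..<N}"]) (auto simp: index_pairs_def)

lemma prod_index_pairs: "(\<Prod>(s, t)\<in>index_pairs N. f s t) = (\<Prod>t<N. \<Prod>s<t. f s t)"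
proof -
  have "(\<Prod>t<N. \<Prod>s<t. f s t) = (\<Prod>(t, s)\<in>(SIGMA t:{..<N}. {..<t}). f s t)"
    by (rule prod.Sigma) auto
  also have "\<dots> = (\<Prod>(s, t)\<in>index_pairs N. f s t)"
    by (rule prod.reindex_bij_witness[of _ prod.swap prod.swap]) (auto simp: index_pairs_def)
  finally show ?thesis by simp
qed

lemma prod_index_pairs_Suc:
  "(\<Prod>(s, t)\<in>index_pairs (Suc N). f s t) = (\<Prod>(s, t)\<in>index_pairs N. f s t) * (\<Prod>s<N. f s N)"
  by (simp add: prod_index_pairs)

lemma prod_index_pairs_rows: "(\<Prod>(s, t)\<in>index_pairs N. f s t) = (\<Prod>s<N. \<Prod>t\<in>{Suc s..<N}. f s t)"
proof -
  have "(\<Prod>s<N. \<Prod>t\<in>{Suc s..<N}. f s t) = (\<Prod>(s, t)\<in>(SIGMA s:{..<N}. {Suc s..<N}). f s t)"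
    by (rule prod.Sigma) auto
  also have "(SIGMA s:{..<N}. {Suc s..<N}) = index_pairs N" by (auto simp: index_pairs_def)
  finally show ?thesis by simp
qed

text \<open>The monic polynomial of degree k that vanishes at the last k points may replace the k-th
  power by \<open>det_polys\<close>, and it makes the matrix upper triangular.\<close>

lemma det_vandermonde:
  fixes z :: "nat \<Rightarrow> 'a::comm_ring_1"
  shows "det (mat N N (\<lambda>(i, j). z i ^ (N - 1 - j))) = (\<Prod>(s, t)\<in>index_pairs N. z s - z t)"
proof -
  define p where "p k = (\<Prod>i\<in>{N - k..<N}. [:- z i, 1:])" for k
  have aux: "degree (\<Prod>i\<in>I. [:- z i, 1:]) \<le> card I \<and> coeff (\<Prod>i\<in>I. [:- z i, 1:]) (card I) = 1"
    if "finite I" for I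
    using that
  proof (induction I rule: finite_induct)
    case (insert i I)
    let ?q = "\<Prod>i\<in>I. [:- z i, 1:]"
    have e: "(\<Prod>i\<in>insert i I. [:- z i, 1:]) = pCons 0 ?q + Polynomial.smult (- z i) ?q"
      using insert by (simp add: mult_pCons_left)
    have "degree (pCons 0 ?q + Polynomial.smult (- z i) ?q) \<le> Suc (card I)"
      using insert.IH
      by (intro degree_add_le) (auto simp: degree_pCons_eq_if intro: le_trans[OF degree_smult_le])
    moreover have "coeff ?q (Suc (card I)) = 0" using insert.IH by (intro coeff_eq_0) auto
    ultimately show ?case unfolding e using insert by auto
  qed simp
  have card: "card {N - k..<N} = k" if "k < N" for k using that by simp
  have "det (mat N N (\<lambda>(i, j). z i ^ (N - 1 - j))) = det (mat N N (\<lambda>(i, j). poly (p (N - 1 - j)) (z i)))"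
  proof -
    have p: "degree (p k) \<le> k" "coeff (p k) k = 1" if "k < N" for k
      using aux[of "{N - k..<N}"] card[OF that] by (auto simp: p_def)
    show ?thesis using det_polys[of N p z] p by simp
  qed
  also have "\<dots> = prod_list (diag_mat (mat N N (\<lambda>(i, j). poly (p (N - 1 - j)) (z i))))"
  proof (rule det_upper_triangular)
    show "upper_triangular (mat N N (\<lambda>(i, j). poly (p (N - 1 - j)) (z i)))"
    proof
      fix i j assume "j < i" "i < dim_row (mat N N (\<lambda>(i, j). poly (p (N - 1 - j)) (z i)))"
      then have ij: "j < i" "i < N" by auto
      then have "i \<in> {N - (N - 1 - j)..<N}" by auto
      with ij show "mat N N (\<lambda>(i, j). poly (p (N - 1 - j)) (z i)) $$ (i, j) = 0"
        by (auto simp: p_def poly_prod intro!: prod_zero)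
    qed
  qed (rule mat_carrier)
  also have "\<dots> = (\<Prod>s<N. \<Prod>t\<in>{Suc s..<N}. z s - z t)"
    unfolding prod_list_diag_prod
    by (auto simp: p_def poly_prod atLeast0LessThan intro!: prod.cong)
  also have "\<dots> = (\<Prod>(s, t)\<in>index_pairs N. z s - z t)"
    by (rule prod_index_pairs_rows[symmetric])
  finally show ?thesis .
qed

section \<open>Omitting one index; Laplace expansion of the Vandermonde determinant\<close>

abbreviation skip :: "nat \<Rightarrow> nat \<Rightarrow> nat" where
  "skip \<equiv> insert_index"

lemma skip_def: "skip p i = (if i < p then i else Suc i)"
  by (simp add: insert_index_def)

lemma inj_skip [simp]: "inj (skip p)"
  by (auto simp: inj_def skip_def split: if_splits)

lemma skip_neq [simp]: "skip p i \<noteq> p"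
  by (auto simp: skip_def)

lemma skip_image: "p \<le> N \<Longrightarrow> skip p ` {..<N} = {..<Suc N} - {p}"
proof (intro equalityI subsetI)
  fix i assume p: "p \<le> N" and i: "i \<in> {..<Suc N} - {p}"
  show "i \<in> skip p ` {..<N}"
  proof (cases "i < p")
    case True
    then have "i = skip p i" "i < N" using p by (auto simp: skip_def)
    then show ?thesis by blast
  next
    case False
    then have "i = skip p (i - 1)" "i - 1 < N" using p i by (auto simp: skip_def)
    then show ?thesis by blast
  qed
qed (auto simp: skip_def)

text \<open>Expansion along the last column, all of whose entries are 1. After deletion of row p
  every remaining row is a row of a smaller Vandermonde matrix times its own point, which yields the
  product of the z in front.\<close>

lemma vandermonde_laplace:
  fixes z :: "nat \<Rightarrow> 'a::comm_ring_1"
  shows "(\<Prod>(s, t)\<in>index_pairs (Suc N). z s - z t) =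
    (\<Sum>p\<le>N. (-1) ^ (p + N) * ((\<Prod>i<N. z (skip p i)) * (\<Prod>(s, t)\<in>index_pairs N. z (skip p s) - z (skip p t))))"
proof -
  define A where "A = mat (Suc N) (Suc N) (\<lambda>(i, j). z i ^ (N - j))"
  have A: "A \<in> carrier_mat (Suc N) (Suc N)" by (simp add: A_def)
  have "(\<Prod>(s, t)\<in>index_pairs (Suc N). z s - z t) = det A"
    using det_vandermonde[of "Suc N" z] by (simp add: A_def)
  also have "\<dots> = (\<Sum>p<Suc N. A $$ (p, N) * cofactor A p N)"
    by (rule laplace_expansion_column[OF A]) simp
  also have "\<dots> = (\<Sum>p\<le>N. (-1) ^ (p + N) * ((\<Prod>i<N. z (skip p i)) * (\<Prod>(s, t)\<in>index_pairs N. z (skip p s) - z (skip p t))))"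
    unfolding lessThan_Suc_atMost
  proof (rule sum.cong[OF refl])
    fix p assume "p \<in> {..N}"
    then have p: "p < Suc N" by simp
    define W where "W = mat N N (\<lambda>(i, j). z (skip p i) ^ (N - 1 - j))"
    define E where "E = mat N N (\<lambda>(i, j). if i = j then z (skip p i) else 0)"
    have WE: "W \<in> carrier_mat N N" "E \<in> carrier_mat N N" by (simp_all add: W_def E_def)
    have "mat_delete A p N = E * W"
    proof (rule eq_matI)
      fix i j assume ij: "i < dim_row (E * W)" "j < dim_col (E * W)"
      then have ij: "i < N" "j < N" by (simp_all add: E_def W_def)
      have "mat_delete A p N $$ (i, j) = A $$ (skip p i, skip N j)"
        by (rule mat_delete_index[OF A p _ ij, symmetric]) simp
      also have "\<dots> = z (skip p i) ^ (N - j)"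
        using ij by (auto simp: A_def skip_def)
      also have "\<dots> = z (skip p i) * z (skip p i) ^ (N - 1 - j)"
        using ij by (metis Suc_diff_Suc diff_Suc_eq_diff_pred power_Suc)
      also have "\<dots> = (\<Sum>k<N. (if i = k then z (skip p i) else 0) * z (skip p k) ^ (N - 1 - j))"
        using ij by (simp add: if_distrib[of "\<lambda>x. x * _"] sum.delta cong: if_cong)
      also have "\<dots> = (E * W) $$ (i, j)"
        using ij by (simp add: E_def W_def scalar_prod_def atLeast0LessThan)
      finally show "mat_delete A p N $$ (i, j) = (E * W) $$ (i, j)" .
    qed (use A in \<open>auto simp: E_def W_def mat_delete_def\<close>)
    moreover have "det E = (\<Prod>i<N. z (skip p i))"
    proof -
      have "det E = prod_list (diag_mat E)"
        by (rule det_upper_triangular[OF _ WE(2)]) (auto simp: E_def)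
      also have "\<dots> = (\<Prod>i<N. z (skip p i))"
        unfolding prod_list_diag_prod by (auto simp: E_def atLeast0LessThan)
      finally show ?thesis .
    qed
    moreover have "det W = (\<Prod>(s, t)\<in>index_pairs N. z (skip p s) - z (skip p t))"
      unfolding W_def by (rule det_vandermonde)
    ultimately have "det (mat_delete A p N) =
      (\<Prod>i<N. z (skip p i)) * (\<Prod>(s, t)\<in>index_pairs N. z (skip p s) - z (skip p t))"
      using det_mult[OF WE(2,1)] by simp
    then show "A $$ (p, N) * cofactor A p N =
      (-1) ^ (p + N) * ((\<Prod>i<N. z (skip p i)) * (\<Prod>(s, t)\<in>index_pairs N. z (skip p s) - z (skip p t)))"
      using p by (simp add: cofactor_def A_def)
  qed
  finally show ?thesis .
qed

section \<open>The kernels\<close>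

definition fls_Y :: "'a::field_char_0 fls" where "fls_Y = 1 + fls_X"

definition fls_V :: "'a::field_char_0 fls" where "fls_V = fls_Y / fls_X\<^sup>2"

text \<open>Up to sign, \<open>fls_lower\<close> is the factor that a variable acquires at the lower
  end of its interval of summation, and \<open>fls_upper\<close> the one at the upper end; see
  \<open>interval_sum_kernel_fun\<close>.\<close>

definition fls_lower :: "'a::field_char_0 \<Rightarrow> 'a fls" where
  "fls_lower Q = fls_const Q - fls_const (1 - Q) * fls_X"

definition fls_upper :: "'a::field_char_0 \<Rightarrow> 'a fls" where
  "fls_upper Q = fls_X + fls_const Q"

abbreviation "ml_Y r \<equiv> ml_of_fls r fls_Y"
abbreviation "ml_V r \<equiv> ml_of_fls r fls_V"
abbreviation "ml_lower Q r \<equiv> ml_of_fls r (fls_lower Q)"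
abbreviation "ml_upper Q r \<equiv> ml_of_fls r (fls_upper Q)"

text \<open>In terms of x this is Q + (Q - 1) x_s + x_t + x_s x_t. Divided by 1 + x_t it is the
  symbol of \<open>pair_op_minus Q s t\<close>, and \<open>pair_B\<close> is the symbol of
  \<open>pair_op_plus Q s t\<close>.\<close>

definition pair_A :: "'a::field_char_0 \<Rightarrow> nat \<Rightarrow> nat \<Rightarrow> 'a mlaurent" where
  "pair_A Q s t = ml_Y s * ml_Y t + 1 - (2 - ml_const Q) * ml_Y s"

definition pair_B :: "'a::field_char_0 \<Rightarrow> nat \<Rightarrow> nat \<Rightarrow> 'a mlaurent" where
  "pair_B Q s t = ml_Y s + ml_Y t - (2 - ml_const Q) * ml_Y s * ml_Y t"

text \<open>This is the pair product of the constant-term expression: V_s - V_t is (x_t - x_s)(x_s +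
  x_t + x_s x_t) / (x_s x_t)^2, so every variable absorbs x^(2 - n) for n = 2N.\<close>

definition kernel :: "'a::field_char_0 \<Rightarrow> nat \<Rightarrow> 'a mlaurent" where
  "kernel Q N = (\<Prod>r<N. ml_of_fls r (fls_Y powi (1 - int N))) *
     (\<Prod>(s, t)\<in>index_pairs N. (ml_V s - ml_V t) * (pair_A Q s t * pair_B Q s t))"

definition ml_monom :: "nat \<Rightarrow> (nat \<Rightarrow> int) \<Rightarrow> 'a::field_char_0 mlaurent" where
  "ml_monom N u = (\<Prod>r<N. ml_of_fls r (fls_Y powi (u r)))"

lemma fls_Y_neq_0 [simp]: "fls_Y \<noteq> (0 :: 'a::field_char_0 fls)"
proof
  assume "fls_Y = (0 :: 'a fls)"
  then have "fls_nth fls_Y 0 = (0::'a)" by simp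
  then show False by (simp add: fls_Y_def)
qed

lemma fls_V_neq_0 [simp]: "fls_V \<noteq> (0 :: 'a::field_char_0 fls)"
  unfolding fls_V_def divide_eq_0_iff by auto

lemma fls_Y_powi: "fls_Y powi k = fps_to_fls (fps_binomial (of_int k :: 'a::field_char_0))"
proof -
  have nat: "fls_Y ^ j = fps_to_fls (fps_binomial (of_nat j :: 'a))" for j
    by (simp add: fps_binomial_of_nat fps_to_fls_power fls_Y_def)
  show ?thesis
  proof (cases "k \<ge> 0")
    case True
    then show ?thesis using nat[of "nat k"] by (simp add: power_int_def)
  next
    case False
    have "fps_binomial (of_int k :: 'a) * fps_binomial (of_nat (nat (- k))) = 1"
      using False by (simp add: fps_binomial_add_mult[symmetric] of_nat_nat)
    then have "fps_to_fls (fps_binomial (of_int k :: 'a)) * fls_Y ^ nat (- k) = 1"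
      unfolding nat by (metis fls_times_fps_to_fls fps_one_to_fls)
    then show ?thesis using False
      by (simp add: power_int_def field_simps power_inverse inverse_eq_divide)
  qed
qed

lemma fls_nth_Y_powi:
  "fls_nth (fls_Y powi k) i = (if i < 0 then 0 else of_int k gchoose nat i :: 'a::field_char_0)"
  by (simp add: fls_Y_powi fps_binomial_nth)

lemma subdegree_Y_powi: "fls_subdegree (fls_Y powi k :: 'a::field_char_0 fls) = 0"
  by (rule fls_subdegree_eqI) (auto simp: fls_nth_Y_powi)

lemma ml_Y_conv: "ml_Y r = 1 + ml_X r"
  by (simp add: fls_Y_def ml_of_fls_add ml_X_def)

lemma ml_lower_conv: "ml_lower Q r = 1 - (1 - ml_const Q) * ml_Y r"
  by (simp add: fls_lower_def ml_Y_conv ml_of_fls_diff ml_of_fls_mult ml_of_fls_const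
      ml_const_diff ml_X_def algebra_simps)

lemma ml_upper_conv: "ml_upper Q r = ml_Y r - 1 + ml_const Q"
  by (simp add: fls_upper_def ml_Y_conv ml_of_fls_add ml_of_fls_const ml_X_def)

lemma ml_monom_cong: "(\<And>r. r < N \<Longrightarrow> u r = v r) \<Longrightarrow> ml_monom N u = ml_monom N v"
  by (simp add: ml_monom_def)

lemma ml_rename_monom:
  assumes "inj \<rho>" "bij_betw \<rho> {..<N} {..<N}"
  shows "ml_rename \<rho> (ml_monom N (u \<circ> \<rho>)) = ml_monom N u"
proof -
  have "ml_rename \<rho> (ml_monom N (u \<circ> \<rho>)) = (\<Prod>r<N. ml_of_fls (\<rho> r) (fls_Y powi (u (\<rho> r))))"
    using assms(1) by (simp add: ml_monom_def ml_rename_simps)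
  also have "\<dots> = ml_monom N u"
    unfolding ml_monom_def by (rule prod.reindex_bij_betw[OF assms(2)])
  finally show ?thesis .
qed


subsection \<open>Antisymmetry\<close>

lemma pair_A_rename: "inj \<rho> \<Longrightarrow> ml_rename \<rho> (pair_A Q s t) = pair_A Q (\<rho> s) (\<rho> t)"
  and pair_B_rename: "inj \<rho> \<Longrightarrow> ml_rename \<rho> (pair_B Q s t) = pair_B Q (\<rho> s) (\<rho> t)"
proof -
  have 2: "2 = (1 + 1 :: 'a mlaurent)" by simp
  show "inj \<rho> \<Longrightarrow> ml_rename \<rho> (pair_A Q s t) = pair_A Q (\<rho> s) (\<rho> t)"
    "inj \<rho> \<Longrightarrow> ml_rename \<rho> (pair_B Q s t) = pair_B Q (\<rho> s) (\<rho> t)"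
    unfolding pair_A_def pair_B_def 2 by (simp_all only: ml_rename_simps)
qed

lemma pair_B_commute: "pair_B Q s t = pair_B Q t s"
  by (simp add: pair_B_def algebra_simps)

lemma inj_transpose [simp]: "inj (Transposition.transpose a b)"
  by (rule bij_is_inj) simp

lemma bij_betw_transpose: "a \<in> S \<Longrightarrow> b \<in> S \<Longrightarrow> bij_betw (Transposition.transpose a b) S S"
  by (rule bij_betw_byWitness[where f' = "Transposition.transpose a b"])
    (auto simp: Transposition.transpose_def)

text \<open>The additional factor completes \<open>pair_A Q j (Suc j)\<close> to a symmetric
  product, so only V_j - V_{j+1} changes its sign. Since j and j + 1 are neighbours, the swap
  permutes the other pairs without reversing any of them.\<close>

lemma kernel_antisymmetric:
  assumes j: "Suc j < N"
  shows "ml_rename (Transposition.transpose j (Suc j)) (pair_A Q (Suc j) j * kernel Q N) =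
    - (pair_A Q (Suc j) j * kernel Q N)"
proof -
  let ?\<tau> = "Transposition.transpose j (Suc j)"
  let ?k = "\<lambda>s t. (ml_V s - ml_V t) * (pair_A Q s t * pair_B Q s t)"
  let ?Y = "\<Prod>r<N. ml_of_fls r (fls_Y powi (1 - int N)) :: 'a mlaurent"
  define R where "R = (\<Prod>(s, t)\<in>index_pairs N - {(j, Suc j)}. ?k s t)"
  have split: "kernel Q N = ?Y * (?k j (Suc j) * R)"
    unfolding kernel_def R_def using j
    by (subst prod.remove[OF finite_index_pairs, of "(j, Suc j)"]) (auto simp: index_pairs_def)
  have \<tau>: "inj ?\<tau>" by simp
  have ren: "ml_rename ?\<tau> (?k s t) = ?k (?\<tau> s) (?\<tau> t)" for s t
    by (simp add: ml_rename_simps[OF \<tau>] pair_A_rename[OF \<tau>] pair_B_rename[OF \<tau>])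
  have Y: "ml_rename ?\<tau> ?Y = ?Y"
    using ml_rename_monom[OF \<tau>, of N "\<lambda>_. 1 - int N"] bij_betw_transpose[of j "{..<N}" "Suc j"] j
    by (simp add: ml_monom_def o_def)
  have "ml_rename ?\<tau> R = (\<Prod>(s, t)\<in>index_pairs N - {(j, Suc j)}. ?k (?\<tau> s) (?\<tau> t))"
    by (simp add: R_def ml_rename_prod[OF \<tau>] case_prod_unfold ren)
  also have "\<dots> = R"
    unfolding R_def
    by (rule prod.reindex_bij_witness[of _ "\<lambda>(s, t). (?\<tau> s, ?\<tau> t)" "\<lambda>(s, t). (?\<tau> s, ?\<tau> t)"])
      (use j in \<open>auto simp: index_pairs_def Transposition.transpose_def split: if_splits\<close>)
  finally have R: "ml_rename ?\<tau> R = R" .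
  have "ml_rename ?\<tau> (pair_A Q (Suc j) j * kernel Q N) = pair_A Q j (Suc j) * (?Y * (?k (Suc j) j * R))"
    unfolding split
    by (simp only: ml_rename_mult[OF \<tau>] ml_rename_diff[OF \<tau>] ml_rename_of_fls[OF \<tau>]
        Y R pair_A_rename[OF \<tau>] pair_B_rename[OF \<tau>]) simp
  also have "\<dots> = - (pair_A Q (Suc j) j * (?Y * (?k j (Suc j) * R)))"
    by (simp add: pair_B_commute[of Q "Suc j" j] algebra_simps)
  finally show ?thesis by (simp only: split)
qed


subsection \<open>Reflection at the boundary\<close>

lemma V_powi_times_inverse:
  fixes x y :: "'b::field"
  assumes "x \<noteq> 0"
  shows "(y / x\<^sup>2) powi a * inverse x = y powi a * x powi (- 2 * a - 1)"
proof -
  have "x powi (- 2 * a - 1) = inverse (x powi (2 * a)) * inverse x"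
    using assms by (simp add: power_int_diff power_int_minus divide_inverse)
  also have "x powi (2 * a) = (x\<^sup>2) powi a"
    by (simp add: power_int_mult)
  finally show ?thesis
    unfolding power_int_divide_distrib by (simp add: divide_inverse mult_ac)
qed

lemma V_inverse:
  fixes x y :: "'b::field"
  assumes "x \<noteq> 0" "y \<noteq> 0" "y = 1 + x"
  shows "(y / x\<^sup>2) powi (-1) = y + y powi (-1) - 2"
proof -
  have x: "x = y - 1" using assms(3) by simp
  have "(y / x\<^sup>2) powi (-1) = x\<^sup>2 / y" by (simp add: power_int_minus)
  also have "\<dots> = y + y powi (-1) - 2"
    unfolding x using assms(2) by (simp add: power_int_minus power2_eq_square field_simps)
  finally show ?thesis .
qed

text \<open>The product (a y + g)(a + g y) is palindromic in y; divided by y it is a polynomial in y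
  + 1/y - 2.\<close>

lemma palindromic_product:
  fixes a g i y :: "'b::comm_ring_1"
  assumes "i * y = 1"
  shows "i * ((a * y + g) * (a + g * y)) = (a + g)\<^sup>2 + a * g * (y + i - 2)"
proof -
  have "i * ((a * y + g) * (a + g * y)) = (i * y) * (a * a + g * g + a * g * y) + a * g * i"
    by (simp add: algebra_simps)
  then show ?thesis by (simp add: assms algebra_simps power2_eq_square)
qed

text \<open>The Laurent polynomials in V_r with coefficients free of x_r; closure under products is
  \<open>V_span_mult\<close>.\<close>

inductive_set V_span :: "nat \<Rightarrow> 'a::field_char_0 mlaurent set" for r where
  V_span_base: "ml_free r C \<Longrightarrow> C * ml_of_fls r (fls_V powi a) \<in> V_span r"
| V_span_add: "f \<in> V_span r \<Longrightarrow> g \<in> V_span r \<Longrightarrow> f + g \<in> V_span r"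

lemma V_span_free: "ml_free r C \<Longrightarrow> C \<in> V_span r"
  using V_span_base[of r C 0] by simp

lemma V_span_mult:
  assumes "f \<in> V_span r" "g \<in> V_span r"
  shows "f * g \<in> V_span r"
  using assms(1)
proof (induction f)
  case (V_span_base C a)
  from assms(2) show ?case
  proof (induction g)
    case (V_span_base D b)
    have "C * ml_of_fls r (fls_V powi a) * (D * ml_of_fls r (fls_V powi b)) =
        (C * D) * ml_of_fls r (fls_V powi (a + b))"
      by (simp add: power_int_add ml_of_fls_mult mult_ac)
    then show ?case
      using V_span.V_span_base[OF ml_free_mult[OF \<open>ml_free r C\<close> V_span_base]] by simp
  qed (simp add: distrib_left V_span.V_span_add)
qed (simp add: distrib_right V_span.V_span_add)

lemma V_span_prod: "(\<And>i. i \<in> I \<Longrightarrow> f i \<in> V_span r) \<Longrightarrow> (\<Prod>i\<in>I. f i) \<in> V_span r"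
  by (induction I rule: infinite_finite_induct) (auto intro: V_span_mult V_span_free ml_free_1)

text \<open>V^a / x is (1 + x)^a x^(-2a - 1), and the coefficient of x^(2a + 1) in (1 + x)^a is 0
  for every integer a: the exponent exceeds the degree if a \<ge> 0 and is negative
  otherwise.\<close>

lemma constant_term_V_span:
  fixes f :: "'a::field_char_0 mlaurent"
  assumes "f \<in> V_span r"
  shows "ml_constant_term (f * ml_of_fls r (inverse fls_X)) = 0"
  using assms
proof (induction f)
  case (V_span_base C a)
  have "fls_V powi a * inverse fls_X = (fls_Y powi a * fls_X powi (- 2 * a - 1) :: 'a fls)"
    unfolding fls_V_def by (rule V_powi_times_inverse) simp
  also have "fls_nth \<dots> 0 = 0"
  proof (cases "a \<ge> 0")
    case True
    then obtain k where k: "a = int k" using nonneg_int_cases by blast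
    have "(of_nat k gchoose (2 * k + 1)) = (0 :: 'a)"
      by (simp flip: binomial_gbinomial)
    moreover have "nat (2 * int k + 1) = 2 * k + 1" by simp
    ultimately show ?thesis
      unfolding fls_X_power_int fls_X_intpow_times_conv_shift k
      by (simp add: fls_nth_Y_powi add.commute del: power_int_of_nat)
  next
    case False
    then show ?thesis
      unfolding fls_X_power_int fls_X_intpow_times_conv_shift by (simp add: fls_nth_Y_powi)
  qed
  finally show ?case
    using constant_term_free_mult[OF V_span_base, of "fls_V powi a * inverse fls_X"]
    by (simp add: ml_of_fls_mult mult_ac)
qed (simp add: distrib_right constant_term_add)

text \<open>The power -N of Y_N is distributed over the N pairs that contain the last variable. Each
  copy of Y_N^(-1) makes \<open>pair_A Q s N * pair_B Q s N\<close> a polynomial in Y_N + Y_N^(-1) -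
  2 = V_N^(-1), by \<open>palindromic_product\<close> with g = \<gamma>.\<close>

lemma kernel_V_span: "kernel Q (Suc N) \<in> V_span N"
proof -
  let ?k = "\<lambda>s t. (ml_V s - ml_V t) * (pair_A Q s t * pair_B Q s t)"
  have factor: "ml_of_fls N (fls_Y powi (- 1)) * ?k s N \<in> V_span N" if "s < N" for s
  proof -
    define \<gamma> where "\<gamma> = 1 - (2 - ml_const Q) * ml_Y s"
    have free: "ml_free N (ml_Y s)" "ml_free N \<gamma>" "ml_free N (ml_V s)"
    proof -
      show Y: "ml_free N (ml_Y s)" "ml_free N (ml_V s)" using that by (auto intro: ml_free_of_fls)
      have "ml_free N (2 - ml_const Q)"
        using ml_free_const[of N "2 - Q"] ml_const_add[of 1 "1::'a"] by (simp add: ml_const_diff)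
      from ml_free_diff[OF ml_free_1 ml_free_mult[OF this Y(1)]] show "ml_free N \<gamma>"
        unfolding \<gamma>_def .
    qed
    have Yi: "ml_of_fls N (fls_Y powi (- 1)) * ml_Y N = (1 :: 'a mlaurent)"
      by (simp add: ml_of_fls_mult[symmetric] power_int_minus)
    have "fls_V powi (-1) = (fls_Y + fls_Y powi (-1) - 2 :: 'a fls)"
      unfolding fls_V_def by (rule V_inverse) (auto simp: fls_Y_def[symmetric])
    then have Vi: "ml_of_fls N (fls_V powi (-1)) = ml_Y N + ml_of_fls N (fls_Y powi (-1)) - (2 :: 'a mlaurent)"
      using ml_const_add[of 1 "1::'a"] ml_of_fls_const[of N "2::'a"]
      by (simp add: ml_of_fls_add ml_of_fls_diff)
    have "ml_of_fls N (fls_Y powi (- 1)) * (pair_A Q s N * pair_B Q s N) =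
       (ml_Y s + \<gamma>)\<^sup>2 + (ml_Y s * \<gamma>) * ml_of_fls N (fls_V powi (-1))"
    proof -
      have "pair_A Q s N * pair_B Q s N = (ml_Y s * ml_Y N + \<gamma>) * (ml_Y s + \<gamma> * ml_Y N)"
        by (simp add: pair_A_def pair_B_def \<gamma>_def algebra_simps)
      then show ?thesis unfolding Vi by (simp only: palindromic_product[OF Yi])
    qed
    moreover have "(ml_Y s + \<gamma>)\<^sup>2 + (ml_Y s * \<gamma>) * ml_of_fls N (fls_V powi (-1)) \<in> V_span N"
      unfolding power2_eq_square using free
      by (intro V_span_add V_span_base V_span_free ml_free_mult ml_free_add)
    moreover have "ml_V s - ml_V N \<in> V_span N"
    proof -
      have "ml_V s + (- 1) * ml_of_fls N (fls_V powi 1) \<in> V_span N"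
        using free by (intro V_span_add V_span_base V_span_free ml_free_uminus ml_free_1)
      then show ?thesis by simp
    qed
    ultimately have "(ml_V s - ml_V N) * (ml_of_fls N (fls_Y powi (- 1)) * (pair_A Q s N * pair_B Q s N)) \<in> V_span N"
      by (simp only:) (rule V_span_mult)
    then show ?thesis by (simp only: mult.left_commute)
  qed
  have free: "ml_free N ((\<Prod>r<N. ml_of_fls r (fls_Y powi (1 - int (Suc N)))) *
     (\<Prod>(s, t)\<in>index_pairs N. ?k s t))"
  proof -
    have "ml_free N (2 - ml_const Q)"
      using ml_free_const[of N "2 - Q"] ml_const_add[of 1 "1::'a"] by (simp add: ml_const_diff)
    then show ?thesis
      unfolding pair_A_def pair_B_def
      by (intro ml_free_mult ml_free_prod)
        (auto simp: index_pairs_def intro!: ml_free_mult ml_free_diff ml_free_add ml_free_of_fls ml_free_1)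
  qed
  have "kernel Q (Suc N) = ((\<Prod>r<N. ml_of_fls r (fls_Y powi (1 - int (Suc N)))) *
     (\<Prod>(s, t)\<in>index_pairs N. ?k s t)) * (\<Prod>s<N. ml_of_fls N (fls_Y powi (- 1)) * ?k s N)"
    unfolding kernel_def
    by (simp add: prod_index_pairs_Suc prod.distrib power_int_minus ml_of_fls_power power_inverse mult_ac
        flip: ml_of_fls_power)
  then show ?thesis
    using V_span_mult[OF V_span_free[OF free] V_span_prod[of "{..<N}"]] factor by simp
qed

subsection \<open>Removing a variable\<close>

text \<open>Congruence modulo x_p among series without a pole in x_p. It allows factors to be
  replaced by their values at x_p = 0 as long as the cofactor is regular in x_p.\<close>

definition cong_X :: "nat \<Rightarrow> 'a::comm_ring_1 mlaurent \<Rightarrow> 'a mlaurent \<Rightarrow> bool" where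
  "cong_X p f g \<longleftrightarrow> ml_regular p f \<and> ml_regular p g \<and> (\<exists>R. ml_regular p R \<and> f = g + ml_X p * R)"

lemma ml_regular_X: "ml_regular p (ml_X r :: 'a::comm_ring_1 mlaurent)"
  unfolding ml_X_def by (rule ml_regular_of_fls) simp

lemma ml_regular_1: "ml_regular p (1 :: 'a::comm_ring_1 mlaurent)"
  by (rule ml_free_regular[OF ml_free_1])

lemma cong_XI: "ml_regular p g \<Longrightarrow> ml_regular p R \<Longrightarrow> f = g + ml_X p * R \<Longrightarrow> cong_X p f g"
  by (auto simp: cong_X_def intro!: ml_regular_add ml_regular_mult ml_regular_X)

lemma cong_X_refl: "ml_regular p f \<Longrightarrow> cong_X p f f"
  by (rule cong_XI[of _ _ 0]) (auto simp: ml_regular_def)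

lemma cong_X_mult:
  assumes "cong_X p f g" "cong_X p f' g'"
  shows "cong_X p (f * f') (g * g')"
proof -
  from assms obtain R R' where R: "ml_regular p R" "f = g + ml_X p * R" "ml_regular p g"
    and R': "ml_regular p R'" "f' = g' + ml_X p * R'" "ml_regular p g'"
    unfolding cong_X_def by blast
  show ?thesis
  proof (rule cong_XI)
    show "ml_regular p (g * g')" using R R' by (intro ml_regular_mult)
    show "ml_regular p (R * g' + g * R' + ml_X p * R * R')"
      using R R' by (intro ml_regular_mult ml_regular_add ml_regular_X)
    show "f * f' = g * g' + ml_X p * (R * g' + g * R' + ml_X p * R * R')"
      unfolding R R' by (simp add: algebra_simps)
  qed
qed

lemma cong_X_prod:
  "(\<And>i. i \<in> I \<Longrightarrow> cong_X p (f i) (g i)) \<Longrightarrow> cong_X p (\<Prod>i\<in>I. f i) (\<Prod>i\<in>I. g i)"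
  by (induction I rule: infinite_finite_induct) (auto intro: cong_X_mult cong_X_refl ml_regular_1)

lemma constant_term_cong_X:
  assumes "cong_X p f g" "ml_regular p C"
  shows "ml_constant_term (C * f) = ml_constant_term (C * g)"
proof -
  from assms(1) obtain R where R: "ml_regular p R" "f = g + ml_X p * R" unfolding cong_X_def by blast
  have "C * f = C * g + ml_X p * (C * R)" unfolding R by (simp add: algebra_simps)
  then show ?thesis
    using constant_term_X_mult_regular[OF ml_regular_mult[OF assms(2) R(1)]] by (simp add: constant_term_add)
qed

lemma ml_free_rename: "inj \<rho> \<Longrightarrow> p \<notin> range \<rho> \<Longrightarrow> ml_free p (ml_rename \<rho> f)"
  by (auto simp: ml_free_def ml_coeff_rename in_keys_iff subset_iff split: if_splits)

lemma notin_range_skip: "p \<notin> range (skip p)"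
  by (metis rangeE skip_neq)

lemma ml_regular_Y: "ml_regular p (ml_Y r :: 'a::field_char_0 mlaurent)"
  unfolding ml_Y_conv by (intro ml_regular_add ml_regular_1 ml_regular_X)

lemma ml_regular_two_minus: "ml_regular p (2 - ml_const Q :: 'a::field_char_0 mlaurent)"
  using ml_regular_diff[OF ml_regular_add[OF ml_regular_1 ml_regular_1] ml_regular_const, of p Q] by simp

lemma ml_regular_lower: "ml_regular p (ml_lower Q r)"
  unfolding ml_lower_conv by (intro ml_regular_mult ml_regular_diff ml_regular_1 ml_regular_Y ml_regular_const)

lemma ml_regular_upper: "ml_regular p (ml_upper Q r)"
  unfolding ml_upper_conv by (intro ml_regular_add ml_regular_diff ml_regular_1 ml_regular_Y ml_regular_const)

lemma ml_regular_pair_AB: "ml_regular p (pair_A Q s t * pair_B Q s t)"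
  unfolding pair_A_def pair_B_def
  by (intro ml_regular_mult)
    (rule ml_regular_diff ml_regular_add ml_regular_mult ml_regular_1 ml_regular_Y ml_regular_two_minus)+

lemma cong_X_pair_A_right: "cong_X p (pair_A Q s p) (ml_lower Q s)"
proof (rule cong_XI[OF ml_regular_lower ml_regular_Y])
  show "pair_A Q s p = ml_lower Q s + ml_X p * ml_Y s"
    by (simp add: pair_A_def ml_lower_conv ml_Y_conv[of p] algebra_simps)
qed

lemma cong_X_pair_A_left: "cong_X p (pair_A Q p t) (ml_upper Q t)"
proof (rule cong_XI[OF ml_regular_upper ml_regular_diff[OF ml_regular_Y ml_regular_two_minus]])
  show "pair_A Q p t = ml_upper Q t + ml_X p * (ml_Y t - (2 - ml_const Q))"
    by (simp add: pair_A_def ml_upper_conv ml_Y_conv[of p] algebra_simps)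
qed

lemma cong_X_pair_B_right: "cong_X p (pair_B Q s p) (ml_lower Q s)"
proof (rule cong_XI[OF ml_regular_lower
      ml_regular_diff[OF ml_regular_1 ml_regular_mult[OF ml_regular_two_minus ml_regular_Y]]])
  show "pair_B Q s p = ml_lower Q s + ml_X p * (1 - (2 - ml_const Q) * ml_Y s)"
    by (simp add: pair_B_def ml_lower_conv ml_Y_conv[of p] algebra_simps)
qed

lemma cong_X_pair_B_left: "cong_X p (pair_B Q p t) (ml_lower Q t)"
  using cong_X_pair_B_right[of p Q t] by (simp add: pair_B_commute)

lemma cong_X_Y_powi: "cong_X p (ml_of_fls p (fls_Y powi k)) (1 :: 'a::field_char_0 mlaurent)"
proof (rule cong_XI[OF ml_regular_1])
  let ?R = "(fls_Y powi k - 1) / fls_X :: 'a fls"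
  show "ml_of_fls p (fls_Y powi k) = 1 + ml_X p * ml_of_fls p ?R"
    by (simp add: ml_X_def ml_of_fls_mult[symmetric] ml_of_fls_diff del: fls_divide_X)
  have "fls_nth ?R i = 0" if "i < 0" for i
  proof -
    have "?R = fls_shift 1 (fls_Y powi k - 1)" by (simp add: fls_divide_X)
    then show ?thesis using that by (auto simp: fls_nth_Y_powi)
  qed
  then have "fls_subdegree ?R \<ge> 0" by (cases "?R = 0") (auto intro: fls_subdegree_geI)
  then show "ml_regular p (ml_of_fls p ?R)" by (rule ml_regular_of_fls)
qed

lemma prod_index_pairs_skip:
  assumes p: "p \<le> N"
  shows "(\<Prod>(s, t)\<in>index_pairs (Suc N). f s t) =
    (\<Prod>(s, t)\<in>index_pairs N. f (skip p s) (skip p t)) * ((\<Prod>s<p. f (skip p s) p) * (\<Prod>t\<in>{p..<N}. f p (skip p t)))"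
proof -
  let ?A = "(\<lambda>(s, t). (skip p s, skip p t)) ` index_pairs N"
  let ?B = "(\<lambda>s. (skip p s, p)) ` {..<p}" and ?C = "(\<lambda>t. (p, skip p t)) ` {p..<N}"
  have eq: "index_pairs (Suc N) = ?A \<union> (?B \<union> ?C)"
  proof (intro equalityI subsetI)
    fix x assume x: "x \<in> index_pairs (Suc N)"
    obtain s t where st: "x = (s, t)" "s < t" "t < Suc N" using x by (auto simp: index_pairs_def)
    consider "t = p" | "s = p" | "s \<noteq> p" "t \<noteq> p" by blast
    then show "x \<in> ?A \<union> (?B \<union> ?C)"
    proof cases
      case 1
      then have "x = (\<lambda>s. (skip p s, p)) s" "s < p" using st by (auto simp: skip_def)
      then show ?thesis by blast
    next
      case 2
      then have "x = (\<lambda>t. (p, skip p t)) (t - 1)" "t - 1 \<in> {p..<N}" using st by (auto simp: skip_def)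
      then show ?thesis by blast
    next
      case 3
      define d where "d i = (if i < p then i else i - 1)" for i
      have "x = (\<lambda>(s, t). (skip p s, skip p t)) (d s, d t)" "(d s, d t) \<in> index_pairs N"
        using st 3 p by (auto simp: skip_def d_def index_pairs_def)
      then show ?thesis by blast
    qed
  qed (use p in \<open>auto simp: index_pairs_def skip_def\<close>)
  have inj: "skip p a = skip p b \<longleftrightarrow> a = b" for a b by (simp add: inj_eq)
  have "(\<Prod>(s, t)\<in>index_pairs (Suc N). f s t) = (\<Prod>(s, t)\<in>?A. f s t) * ((\<Prod>(s, t)\<in>?B. f s t) * (\<Prod>(s, t)\<in>?C. f s t))"
    unfolding eq
    by (subst prod.union_disjoint; (subst prod.union_disjoint)?)
      (auto simp: skip_neq skip_neq[symmetric])
  also have "(\<Prod>(s, t)\<in>?A. f s t) = (\<Prod>(s, t)\<in>index_pairs N. f (skip p s) (skip p t))"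
    by (subst prod.reindex) (auto simp: inj_on_def inj case_prod_unfold)
  also have "(\<Prod>(s, t)\<in>?B. f s t) = (\<Prod>s<p. f (skip p s) p)"
    by (subst prod.reindex) (auto simp: inj_on_def inj)
  also have "(\<Prod>(s, t)\<in>?C. f s t) = (\<Prod>t\<in>{p..<N}. f p (skip p t))"
    by (subst prod.reindex) (auto simp: inj_on_def inj)
  finally show ?thesis .
qed

text \<open>At x_p = 0 every pair that contains p leaves linear factors in its other variable:
  \<open>pair_B\<close> always gives \<open>ml_lower\<close>, and \<open>pair_A\<close> gives
  \<open>ml_lower\<close> or \<open>ml_upper\<close> according to whether that variable precedes or
  follows p.\<close>

lemma cong_X_pairs:
  assumes p: "p \<le> N"
  shows "cong_X p (\<Prod>(s, t)\<in>index_pairs (Suc N). pair_A Q s t * pair_B Q s t)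
    (ml_rename (skip p) ((\<Prod>(s, t)\<in>index_pairs N. pair_A Q s t * pair_B Q s t) *
      ((\<Prod>i<N. ml_lower Q i) * ((\<Prod>i<p. ml_lower Q i) * (\<Prod>i\<in>{p..<N}. ml_upper Q i)))))"
proof -
  have inj: "inj (skip p)" by simp
  have split: "(\<Prod>i<N. ml_lower Q i) = (\<Prod>i<p. ml_lower Q i) * (\<Prod>i\<in>{p..<N}. ml_lower Q i)"
    using p by (subst prod.union_disjoint[symmetric]) (auto simp: ivl_disj_un)
  have "ml_rename (skip p) ((\<Prod>(s, t)\<in>index_pairs N. pair_A Q s t * pair_B Q s t) *
      ((\<Prod>i<N. ml_lower Q i) * ((\<Prod>i<p. ml_lower Q i) * (\<Prod>i\<in>{p..<N}. ml_upper Q i)))) =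
    (\<Prod>(s, t)\<in>index_pairs N. pair_A Q (skip p s) (skip p t) * pair_B Q (skip p s) (skip p t)) *
    ((\<Prod>s<p. ml_lower Q (skip p s) * ml_lower Q (skip p s)) *
     (\<Prod>t\<in>{p..<N}. ml_upper Q (skip p t) * ml_lower Q (skip p t)))"
    unfolding split
    by (simp add: ml_rename_mult[OF inj] ml_rename_prod[OF inj] ml_rename_of_fls[OF inj]
        pair_A_rename[OF inj] pair_B_rename[OF inj] case_prod_unfold prod.distrib mult_ac)
  then show ?thesis
    unfolding prod_index_pairs_skip[OF p, of "\<lambda>s t. pair_A Q s t * pair_B Q s t"]
    by (auto intro!: cong_X_mult cong_X_prod cong_X_refl ml_regular_prod ml_regular_pair_AB
        cong_X_pair_A_right cong_X_pair_A_left cong_X_pair_B_left cong_X_pair_B_right)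
qed

lemma ml_monom_skip:
  assumes "p \<le> N"
  shows "ml_monom (Suc N) u = ml_of_fls p (fls_Y powi (u p)) * ml_rename (skip p) (ml_monom N (u \<circ> skip p))"
proof -
  have "ml_monom (Suc N) u = ml_of_fls p (fls_Y powi (u p)) * (\<Prod>r\<in>{..<Suc N} - {p}. ml_of_fls r (fls_Y powi (u r)))"
    unfolding ml_monom_def using assms by (subst prod.remove[of _ p]) auto
  also have "(\<Prod>r\<in>{..<Suc N} - {p}. ml_of_fls r (fls_Y powi (u r))) = (\<Prod>r<N. ml_of_fls (skip p r) (fls_Y powi (u (skip p r))))"
    unfolding skip_image[OF assms, symmetric]
    by (subst prod.reindex) (auto intro: inj_on_subset[OF inj_skip])
  finally show ?thesis by (simp add: ml_monom_def ml_rename_simps)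
qed

lemma ml_monom_add: "ml_monom N u * ml_monom N v = ml_monom N (\<lambda>r. u r + v r)"
  unfolding ml_monom_def prod.distrib[symmetric] by (simp add: power_int_add ml_of_fls_mult)

lemma kernel_monom:
  "kernel Q N = ml_monom N (\<lambda>_. 1 - int N) * ((\<Prod>(s, t)\<in>index_pairs N. ml_V s - ml_V t) *
     (\<Prod>(s, t)\<in>index_pairs N. pair_A Q s t * pair_B Q s t))"
  unfolding kernel_def ml_monom_def by (simp add: prod.distrib case_prod_unfold)

text \<open>In term p of the Laplace expansion V_p is absent. If p \<ge> m, nothing else has a pole
  in x_p, so the constant term is taken at x_p = 0 and a kernel in N variables remains. If p < m,
  the zero of \<open>z p\<close> makes the whole term divisible by x_p, which is why the sum begins
  at m.\<close>

lemma constant_term_kernel_Suc: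
  fixes z :: "nat \<Rightarrow> 'a::field_char_0 fls"
  assumes m: "m \<le> Suc N" and z: "\<And>r. r < m \<Longrightarrow> fls_subdegree (z r) \<ge> 1"
  defines "Z \<equiv> \<Prod>r<m. ml_of_fls r (z r)"
  shows "ml_constant_term (kernel Q (Suc N) * Z * ml_monom (Suc N) u) =
    (\<Sum>p\<in>{m..N}. (-1) ^ (p + N) * ml_constant_term (kernel Q N * Z *
       ((\<Prod>i<N. ml_of_fls i (fls_lower Q / fls_X\<^sup>2)) *
        ((\<Prod>i<p. ml_lower Q i) * (\<Prod>i\<in>{p..<N}. ml_upper Q i))) * ml_monom N (u \<circ> skip p)))"
proof -
  define W where "W N = (\<Prod>(s, t)\<in>index_pairs N. ml_V s - ml_V t :: 'a mlaurent)" for N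
  define AB where "AB N = (\<Prod>(s, t)\<in>index_pairs N. pair_A Q s t * pair_B Q s t)" for N
  define VN where "VN = (\<Prod>i<N. ml_V i :: 'a mlaurent)"
  define w where "w r = u r - int N" for r
  define T where "T p = ml_rename (skip p) (VN * W N) * AB (Suc N) * Z * ml_monom (Suc N) w" for p
  define L where "L p = (\<Prod>i<N. ml_lower Q i) * ((\<Prod>i<p. ml_lower Q i) * (\<Prod>i\<in>{p..<N}. ml_upper Q i))" for p
  have W_Suc: "W (Suc N) = (\<Sum>p\<le>N. (-1) ^ (p + N) * ml_rename (skip p) (VN * W N))"
    unfolding W_def VN_def vandermonde_laplace
    by (simp add: ml_rename_mult ml_rename_prod ml_rename_of_fls ml_rename_diff case_prod_unfold)
  have "kernel Q (Suc N) * Z * ml_monom (Suc N) u = W (Suc N) * AB (Suc N) * Z * ml_monom (Suc N) w"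
  proof -
    have "ml_monom (Suc N) w = (ml_monom (Suc N) (\<lambda>_. 1 - int (Suc N)) * ml_monom (Suc N) u :: 'a mlaurent)"
      unfolding ml_monom_add w_def by simp
    then show ?thesis unfolding kernel_monom W_def AB_def by (simp only: mult_ac)
  qed
  also have "\<dots> = (\<Sum>p\<le>N. (-1) ^ (p + N) * T p)"
    unfolding W_Suc T_def by (simp only: sum_distrib_right mult.assoc)
  also have "ml_constant_term \<dots> = (\<Sum>p\<le>N. (-1) ^ (p + N) * ml_constant_term (T p))"
    by (simp add: constant_term_sum constant_term_sign)
  also have "\<dots> = (\<Sum>p\<in>{m..N}. (-1) ^ (p + N) * ml_constant_term (T p))"
  proof (rule sum.mono_neutral_right)
    show "\<forall>p\<in>{..N} - {m..N}. (-1) ^ (p + N) * ml_constant_term (T p) = 0"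
    proof
      fix p assume "p \<in> {..N} - {m..N}"
      then have p: "p \<le> N" "p < m" by auto
      define y where "y = z p / fls_X"
      have zp: "z p = fls_X * y" by (simp add: y_def del: fls_divide_X)
      have "fls_nth y i = 0" if "i < 0" for i
      proof -
        have "y = fls_shift 1 (z p)" by (simp add: y_def fls_divide_X)
        then show ?thesis using that z[OF p(2)] by auto
      qed
      then have "fls_subdegree y \<ge> 0" by (cases "y = 0") (auto intro: fls_subdegree_geI)
      then have y: "ml_regular p (ml_of_fls p y)" by (rule ml_regular_of_fls)
      define Z' where "Z' = (\<Prod>r\<in>{..<m} - {p}. ml_of_fls r (z r))"
      have Z: "Z = ml_X p * (ml_of_fls p y * Z')"
        unfolding Z_def Z'_def using p
        by (subst prod.remove[of _ p]) (auto simp: zp ml_of_fls_mult ml_X_def)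
      have Z': "ml_regular p Z'"
        unfolding Z'_def by (intro ml_free_regular ml_free_prod ml_free_of_fls) auto
      have "T p = ml_X p * (ml_rename (skip p) (VN * W N) * AB (Suc N) * (ml_of_fls p y * Z') * ml_monom (Suc N) w)"
        unfolding T_def Z by (simp add: mult_ac)
      moreover have "ml_regular p (AB (Suc N))"
        unfolding AB_def by (intro ml_regular_prod) (auto intro: ml_regular_pair_AB)
      moreover have "ml_regular p (ml_monom (Suc N) w :: 'a mlaurent)"
        unfolding ml_monom_def by (intro ml_regular_prod ml_regular_of_fls) (simp only: subdegree_Y_powi order.refl)
      moreover have "ml_regular p (ml_rename (skip p) (VN * W N))"
        by (rule ml_free_regular[OF ml_free_rename[OF inj_skip notin_range_skip]])
      ultimately have "ml_constant_term (T p) = 0"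
        using y Z' by (simp only:) (intro constant_term_X_mult_regular ml_regular_mult)
      then show "(-1) ^ (p + N) * ml_constant_term (T p) = 0" by simp
    qed
  qed auto
  also have "\<dots> = (\<Sum>p\<in>{m..N}. (-1) ^ (p + N) * ml_constant_term (kernel Q N * Z *
       ((\<Prod>i<N. ml_of_fls i (fls_lower Q / fls_X\<^sup>2)) *
        ((\<Prod>i<p. ml_lower Q i) * (\<Prod>i\<in>{p..<N}. ml_upper Q i))) * ml_monom N (u \<circ> skip p)))"
  proof (intro sum.cong refl arg_cong[of _ _ "\<lambda>x. _ * x"])
    fix p assume "p \<in> {m..N}"
    then have p: "m \<le> p" "p \<le> N" by auto
    have Z: "Z = ml_rename (skip p) Z"
      unfolding Z_def using p by (auto simp: ml_rename_prod ml_rename_of_fls skip_def intro!: prod.cong)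
    define C where "C = ml_rename (skip p) (VN * W N * Z * ml_monom N (w \<circ> skip p))"
    have C: "ml_regular p C"
      unfolding C_def by (rule ml_free_regular[OF ml_free_rename[OF inj_skip notin_range_skip]])
    have "T p = C * (ml_of_fls p (fls_Y powi (w p)) * AB (Suc N))"
      unfolding T_def C_def by (subst Z, subst ml_monom_skip[OF p(2)]) (simp add: ml_rename_mult mult_ac)
    also have "ml_constant_term \<dots> = ml_constant_term (C * (1 * ml_rename (skip p) (AB N * L p)))"
      unfolding AB_def L_def using p
      by (intro constant_term_cong_X[OF _ C] cong_X_mult cong_X_Y_powi cong_X_pairs) auto
    also have "\<dots> = ml_constant_term (ml_rename (skip p) (VN * W N * Z * ml_monom N (w \<circ> skip p) * (AB N * L p)))"
      unfolding C_def by (simp add: ml_rename_mult)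
    also have "\<dots> = ml_constant_term (VN * W N * Z * ml_monom N (w \<circ> skip p) * (AB N * L p))"
      by (rule constant_term_rename) simp
    also have "VN * W N * Z * ml_monom N (w \<circ> skip p) * (AB N * L p) = kernel Q N * Z *
       ((\<Prod>i<N. ml_of_fls i (fls_lower Q / fls_X\<^sup>2)) *
        ((\<Prod>i<p. ml_lower Q i) * (\<Prod>i\<in>{p..<N}. ml_upper Q i))) * ml_monom N (u \<circ> skip p)"
    proof -
      \<comment> \<open>The kernels in N + 1 and in N variables differ by a power Y^(-1) in each
        variable; it cancels the numerator of the V that the Laplace expansion leaves.\<close>
      have "fls_V * fls_Y powi (- 1) = (1 / fls_X\<^sup>2 :: 'a fls)"
        unfolding fls_V_def by (simp only: power_int_minus) (simp add: divide_inverse)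
      then have "VN * ml_monom N (\<lambda>_. - 1) = (\<Prod>i<N. ml_of_fls i (1 / fls_X\<^sup>2))"
        unfolding VN_def ml_monom_def by (simp only: prod.distrib[symmetric] ml_of_fls_mult[symmetric])
      then have 1: "VN * ml_monom N (\<lambda>_. - 1) * (\<Prod>i<N. ml_lower Q i) = (\<Prod>i<N. ml_of_fls i (fls_lower Q / fls_X\<^sup>2))"
        by (simp only: prod.distrib[symmetric] ml_of_fls_mult[symmetric] times_divide_eq_left mult_1)
      have 2: "ml_monom N (w \<circ> skip p) = ml_monom N (\<lambda>_. - 1) * (ml_monom N (\<lambda>_. 1 - int N) * ml_monom N (u \<circ> skip p) :: 'a mlaurent)"
        by (simp add: ml_monom_add w_def o_def)
      show ?thesis
        unfolding 1[symmetric] 2 L_def kernel_monom W_def AB_def by (simp only: mult_ac)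
    qed
    finally show "ml_constant_term (T p) = ml_constant_term (kernel Q N * Z *
       ((\<Prod>i<N. ml_of_fls i (fls_lower Q / fls_X\<^sup>2)) *
        ((\<Prod>i<p. ml_lower Q i) * (\<Prod>i\<in>{p..<N}. ml_upper Q i))) * ml_monom N (u \<circ> skip p))" .
  qed
  finally show ?thesis .
qed

section \<open>Summation over interlacing sequences\<close>

text \<open>The coordinates outside \<open>{m..<j}\<close> are copied from \<open>r\<close>. In this
  way the ended columns are carried along, and an induction on j can prescribe later coordinates by
  updating \<open>r\<close>.\<close>

definition interlaced :: "nat \<Rightarrow> nat \<Rightarrow> (nat \<Rightarrow> int) \<Rightarrow> (nat \<Rightarrow> int) \<Rightarrow> (nat \<Rightarrow> int) set" where
  "interlaced m j t r = {s. (\<forall>i. i \<notin> {m..<j} \<longrightarrow> s i = r i) \<and>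
     (\<forall>i\<in>{m..<j}. t i \<le> s i \<and> s i \<le> t (Suc i)) \<and> (\<forall>i. m \<le> i \<and> Suc i < j \<longrightarrow> s i < s (Suc i))}"

text \<open>A coordinate strictly between its bounds will be a column of the old state that is
  missing in the new one, hence an entry -1.\<close>

definition interlaced_weight :: "'a::comm_ring_1 \<Rightarrow> nat \<Rightarrow> nat \<Rightarrow> (nat \<Rightarrow> int) \<Rightarrow> (nat \<Rightarrow> int) \<Rightarrow> 'a" where
  "interlaced_weight Q m j t s = (\<Prod>i\<in>{m..<j}. if s i = t i \<or> s i = t (Suc i) then 1 else Q)"

definition interlaced_sum ::
    "'a::comm_ring_1 \<Rightarrow> nat \<Rightarrow> nat \<Rightarrow> (nat \<Rightarrow> int) \<Rightarrow> (nat \<Rightarrow> int) \<Rightarrow> ((nat \<Rightarrow> int) \<Rightarrow> 'a) \<Rightarrow> 'a" where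
  "interlaced_sum Q m j t r f = (\<Sum>s\<in>interlaced m j t r. interlaced_weight Q m j t s * f s)"

lemma interlaced_same: "interlaced m m t r = {r}"
  by (auto simp: interlaced_def)

lemma interlaced_Suc:
  assumes "m \<le> j"
  shows "interlaced m (Suc j) t r =
    (\<Union>v\<in>{t j..t (Suc j)}. {s \<in> interlaced m j t (r(j := v)). m < j \<longrightarrow> s (j - 1) < v})"
    (is "?L = ?R")
proof (intro equalityI subsetI)
  fix s assume "s \<in> ?L"
  then have out: "\<And>i. i \<notin> {m..<Suc j} \<Longrightarrow> s i = r i"
    and inn: "\<And>i. i \<in> {m..<Suc j} \<Longrightarrow> t i \<le> s i \<and> s i \<le> t (Suc i)"
    and inc: "\<And>i. m \<le> i \<Longrightarrow> Suc i < Suc j \<Longrightarrow> s i < s (Suc i)"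
    by (auto simp: interlaced_def)
  have "s \<in> interlaced m j t (r(j := s j))"
    unfolding interlaced_def using out inn inc by auto
  moreover have "m < j \<longrightarrow> s (j - 1) < s j"
    using inc[of "j - 1"] by auto
  moreover have "s j \<in> {t j..t (Suc j)}" using inn[of j] assms by auto
  ultimately show "s \<in> ?R" by blast
next
  fix s assume "s \<in> ?R"
  then obtain v where v: "v \<in> {t j..t (Suc j)}" "s \<in> interlaced m j t (r(j := v))" "m < j \<longrightarrow> s (j - 1) < v"
    by blast
  then have sj: "s j = v" by (simp add: interlaced_def)
  have "s i < s (Suc i)" if i: "m \<le> i" "Suc i < Suc j" for i
  proof (cases "Suc i = j")
    case True
    then show ?thesis using v(3) sj i by auto
  next
    case False
    then show ?thesis using v(2) i unfolding interlaced_def by auto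
  qed
  then show "s \<in> ?L"
    using v sj assms unfolding interlaced_def by (auto simp: less_Suc_eq)
qed

lemma finite_interlaced: "m \<le> j \<Longrightarrow> finite (interlaced m j t r)"
proof (induction j arbitrary: r)
  case 0
  then show ?case by (simp add: interlaced_same)
next
  case (Suc j)
  show ?case
  proof (cases "m = Suc j")
    case True
    then show ?thesis by (simp add: interlaced_same)
  next
    case False
    then have "m \<le> j" using Suc.prems by simp
    then show ?thesis unfolding interlaced_Suc[OF \<open>m \<le> j\<close>]
      by (intro finite_UN_I finite_subset[OF _ Suc.IH]) auto
  qed
qed

lemma interlaced_sum_same: "interlaced_sum Q m m t r f = f r"
  by (simp add: interlaced_sum_def interlaced_same interlaced_weight_def)

lemma interlaced_sum_split:
  assumes "m \<le> j"
  shows "interlaced_sum Q m (Suc j) t r f = (\<Sum>v\<in>{t j..t (Suc j)}. (if v = t j \<or> v = t (Suc j) then 1 else Q) *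
    (\<Sum>s\<in>{s \<in> interlaced m j t (r(j := v)). m < j \<longrightarrow> s (j - 1) < v}. interlaced_weight Q m j t s * f s))"
proof -
  have val: "s j = v" if "s \<in> interlaced m j t (r(j := v))" for s v
    using that by (simp add: interlaced_def)
  have "interlaced_sum Q m (Suc j) t r f = (\<Sum>v\<in>{t j..t (Suc j)}.
    (\<Sum>s\<in>{s \<in> interlaced m j t (r(j := v)). m < j \<longrightarrow> s (j - 1) < v}. interlaced_weight Q m (Suc j) t s * f s))"
    unfolding interlaced_sum_def interlaced_Suc[OF assms]
  proof (rule sum.UNION_disjoint)
    show "\<forall>v\<in>{t j..t (Suc j)}. \<forall>v'\<in>{t j..t (Suc j)}. v \<noteq> v' \<longrightarrow>
      {s \<in> interlaced m j t (r(j := v)). m < j \<longrightarrow> s (j - 1) < v} \<inter>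
      {s \<in> interlaced m j t (r(j := v')). m < j \<longrightarrow> s (j - 1) < v'} = {}"
      using val by blast
  qed (use finite_interlaced[OF assms] in auto)
  also have "\<dots> = (\<Sum>v\<in>{t j..t (Suc j)}. (if v = t j \<or> v = t (Suc j) then 1 else Q) *
    (\<Sum>s\<in>{s \<in> interlaced m j t (r(j := v)). m < j \<longrightarrow> s (j - 1) < v}. interlaced_weight Q m j t s * f s))"
    unfolding sum_distrib_left
  proof (intro sum.cong refl)
    fix v s assume "s \<in> {s \<in> interlaced m j t (r(j := v)). m < j \<longrightarrow> s (j - 1) < v}"
    then have "s j = v" using val by blast
    then show "interlaced_weight Q m (Suc j) t s * f s =
      (if v = t j \<or> v = t (Suc j) then 1 else Q) * (interlaced_weight Q m j t s * f s)"
      using assms by (simp add: interlaced_weight_def mult_ac)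
  qed
  finally show ?thesis .
qed

lemma interlaced_sum_first:
  "interlaced_sum Q m (Suc m) t r f =
    (\<Sum>v\<in>{t m..t (Suc m)}. (if v = t m \<or> v = t (Suc m) then 1 else Q) * f (r(m := v)))"
  by (subst interlaced_sum_split) (simp_all add: interlaced_same interlaced_weight_def)

text \<open>Strict increase of the last two coordinates can fail only if both equal t_{i+1}. So the
  last coordinate is summed freely and this coincidence is subtracted; it does not restrict the
  earlier coordinates, which are at most t_i < t_{i+1}.\<close>

lemma interlaced_sum_Suc_Suc:
  assumes m: "m \<le> i" and t: "t i < t (Suc i)" "t (Suc i) < t (Suc (Suc i))"
  shows "interlaced_sum Q m (Suc (Suc i)) t r f =
    (\<Sum>v\<in>{t (Suc i)..t (Suc (Suc i))}. (if v = t (Suc i) \<or> v = t (Suc (Suc i)) then 1 else Q) *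
       interlaced_sum Q m (Suc i) t (r(Suc i := v)) f)
    - interlaced_sum Q m i t (r(i := t (Suc i), Suc i := t (Suc i))) f"
proof -
  let ?J = "Suc i"
  let ?w = "\<lambda>v. if v = t ?J \<or> v = t (Suc ?J) then 1 else Q"
  let ?r = "r(i := t ?J, ?J := t ?J)"
  let ?f = "\<lambda>s. interlaced_weight Q m ?J t s * f s"
  let ?S = "\<lambda>v. {s \<in> interlaced m ?J t (r(?J := v)). m < ?J \<longrightarrow> s (?J - 1) < v}"
  have big: "?S v = interlaced m ?J t (r(?J := v))" if "v > t ?J" for v
  proof -
    have "s i < v" if "s \<in> interlaced m ?J t (r(?J := v))" for s
    proof -
      from that m have "s i \<le> t ?J" by (auto simp: interlaced_def)
      with \<open>v > t ?J\<close> show ?thesis by simp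
    qed
    then show ?thesis by auto
  qed
  have eq: "interlaced m ?J t (r(?J := t ?J)) = ?S (t ?J) \<union> interlaced m i t ?r"
    and disj: "?S (t ?J) \<inter> interlaced m i t ?r = {}"
  proof -
    show "?S (t ?J) \<inter> interlaced m i t ?r = {}"
      using m by (auto simp: interlaced_def)
    have "s \<in> interlaced m i t ?r" if s: "s \<in> interlaced m ?J t (r(?J := t ?J))" "\<not> s i < t ?J" for s
    proof -
      from s m have "s i = t ?J" by (force simp: interlaced_def)
      with s m show ?thesis unfolding interlaced_def by (auto simp: less_Suc_eq)
    qed
    moreover have "s \<in> interlaced m ?J t (r(?J := t ?J))" if s: "s \<in> interlaced m i t ?r" for s
    proof -
      from s have si: "s i = t ?J" by (simp add: interlaced_def)
      have "s k < s (Suc k)" if k: "m \<le> k" "Suc k < ?J" for k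
      proof (cases "Suc k = i")
        case True
        then have "s k \<le> t i" using s k unfolding interlaced_def by auto
        then show ?thesis using si t True by simp
      next
        case False
        then show ?thesis using s k unfolding interlaced_def by auto
      qed
      with s si t m show ?thesis unfolding interlaced_def by (auto simp: less_Suc_eq)
    qed
    ultimately show "interlaced m ?J t (r(?J := t ?J)) = ?S (t ?J) \<union> interlaced m i t ?r"
      using m by auto
  qed
  have fin: "finite (interlaced m ?J t r')" "finite (interlaced m i t r')" for r'
    using m by (auto intro: finite_interlaced)
  have low: "sum ?f (?S (t ?J)) = interlaced_sum Q m ?J t (r(?J := t ?J)) f - interlaced_sum Q m i t ?r f"
  proof -
    have "interlaced_sum Q m ?J t (r(?J := t ?J)) f = sum ?f (?S (t ?J)) + sum ?f (interlaced m i t ?r)"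
      unfolding interlaced_sum_def by (subst (1) eq, rule sum.union_disjoint) (use fin disj in auto)
    also have "sum ?f (interlaced m i t ?r) = interlaced_sum Q m i t ?r f"
      unfolding interlaced_sum_def
    proof (rule sum.cong[OF refl])
      fix s assume "s \<in> interlaced m i t ?r"
      then have "s i = t ?J" by (simp add: interlaced_def)
      then show "?f s = interlaced_weight Q m i t s * f s"
        using m by (simp add: interlaced_weight_def)
    qed
    finally show ?thesis unfolding eq_diff_eq by (rule sym)
  qed
  have split: "{t ?J..t (Suc ?J)} = insert (t ?J) {t ?J<..t (Suc ?J)}" using t by auto
  have "interlaced_sum Q m (Suc ?J) t r f = (\<Sum>v\<in>{t ?J..t (Suc ?J)}. ?w v * sum ?f (?S v))"
    using m by (intro interlaced_sum_split) simp
  also have "\<dots> = sum ?f (?S (t ?J)) + (\<Sum>v\<in>{t ?J<..t (Suc ?J)}. ?w v * sum ?f (?S v))"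
    unfolding split by (subst sum.insert) auto
  also have "(\<Sum>v\<in>{t ?J<..t (Suc ?J)}. ?w v * sum ?f (?S v)) =
      (\<Sum>v\<in>{t ?J<..t (Suc ?J)}. ?w v * interlaced_sum Q m ?J t (r(?J := v)) f)"
    by (intro sum.cong refl) (use big in \<open>auto simp: interlaced_sum_def\<close>)
  also have "sum ?f (?S (t ?J)) + \<dots> = (\<Sum>v\<in>{t ?J..t (Suc ?J)}. ?w v * interlaced_sum Q m ?J t (r(?J := v)) f)
      - interlaced_sum Q m i t ?r f"
    unfolding split low by (subst sum.insert) auto
  finally show ?thesis .
qed


section \<open>Constant terms as functions of the exponents of 1 + x, and their interlaced
  sums\<close>

definition kernel_fun :: "nat \<Rightarrow> 'a::field_char_0 mlaurent \<Rightarrow> (nat \<Rightarrow> int) \<Rightarrow> 'a" where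
  "kernel_fun N K u = ml_constant_term (K * ml_monom N u)"

lemma kernel_fun_add: "kernel_fun N (K + L) u = kernel_fun N K u + kernel_fun N L u"
  by (simp add: kernel_fun_def distrib_right constant_term_add)

lemma kernel_fun_diff: "kernel_fun N (K - L) u = kernel_fun N K u - kernel_fun N L u"
  by (simp add: kernel_fun_def left_diff_distrib constant_term_diff)

lemma constant_term_const_mult:
  "ml_constant_term (ml_const a * f) = a * ml_constant_term (f :: 'a::comm_ring_1 mlaurent)"
  unfolding ml_constant_term_def ml_coeff_mult
  by (subst ml_conv_eq_sum[of "{0}"]) (auto simp: ml_coeff_const split: if_splits)

lemma kernel_fun_const: "kernel_fun N (ml_const a * K) u = a * kernel_fun N K u"
  by (simp add: kernel_fun_def mult.assoc constant_term_const_mult)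

lemma kernel_fun_Y: "j < N \<Longrightarrow> kernel_fun N (ml_Y j * K) u = kernel_fun N K (u(j := u j + 1))"
proof -
  assume j: "j < N"
  have "ml_monom N (u(j := u j + 1)) = ml_of_fls j (fls_Y powi (u j + 1)) *
      (\<Prod>r\<in>{..<N} - {j}. ml_of_fls r (fls_Y powi (u r)) :: 'a mlaurent)"
    unfolding ml_monom_def using j by (subst prod.remove[of _ j]) auto
  also have "\<dots> = ml_Y j * ml_monom N u"
    unfolding ml_monom_def using j
    by (subst prod.remove[of "{..<N}" j]) (auto simp: power_int_add ml_of_fls_mult mult_ac)
  finally show ?thesis by (simp add: kernel_fun_def mult_ac)
qed

lemma sum_int_telescope:
  fixes \<phi> :: "int \<Rightarrow> 'a::ab_group_add"
  assumes "a < b"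
  shows "(\<Sum>v\<in>{a<..<b}. \<phi> (v + 1) - \<phi> v) = \<phi> b - \<phi> (a + 1)"
proof -
  have "a + 1 \<le> b" using assms by simp
  then show ?thesis
  proof (induction b rule: int_ge_induct)
    case (step b)
    have "{a<..<b + 1} = insert b {a<..<b}" using step by auto
    then show ?case using step by simp
  next
    case base
    have "{a<..<a + 1} = {}" by auto
    then show ?case by simp
  qed
qed

text \<open>As x_j = Y_j - 1 the summands are differences \<phi>(v + 1) - \<phi>(v), and the
  interior, which has weight Q throughout, telescopes. What is left at b has the symbol Y_j - 1 + Q,
  and what is left at a has the symbol (1 - Q) Y_j - 1.\<close>

lemma interval_sum_kernel_fun:
  assumes j: "j < N" and ab: "a < b"
  shows "(\<Sum>v\<in>{a..b}. (if v = a \<or> v = b then 1 else Q) * kernel_fun N (ml_X j * K) (u(j := v))) =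
    kernel_fun N (ml_upper Q j * K) (u(j := b)) + kernel_fun N (- ml_lower Q j * K) (u(j := a))"
proof -
  define \<phi> where "\<phi> v = kernel_fun N K (u(j := v))" for v
  have Y: "kernel_fun N (ml_Y j * K) (u(j := v)) = \<phi> (v + 1)" for v
    using j by (simp add: kernel_fun_Y \<phi>_def)
  have X: "kernel_fun N (ml_X j * K) (u(j := v)) = \<phi> (v + 1) - \<phi> v" for v
  proof -
    have "ml_X j * K = ml_Y j * K - K" by (simp add: ml_Y_conv algebra_simps)
    then show ?thesis by (simp add: kernel_fun_diff Y) (simp add: \<phi>_def)
  qed
  have U: "kernel_fun N (ml_upper Q j * K) (u(j := b)) = \<phi> (b + 1) - \<phi> b + Q * \<phi> b"
  proof -
    have "ml_upper Q j * K = ml_Y j * K - K + ml_const Q * K" by (simp add: ml_upper_conv algebra_simps)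
    then show ?thesis by (simp add: kernel_fun_diff kernel_fun_add kernel_fun_const Y) (simp add: \<phi>_def)
  qed
  have L: "kernel_fun N (- ml_lower Q j * K) (u(j := a)) = \<phi> (a + 1) - Q * \<phi> (a + 1) - \<phi> a"
  proof -
    have "- ml_lower Q j * K = ml_Y j * K - ml_const Q * (ml_Y j * K) - K"
      by (simp add: ml_lower_conv algebra_simps)
    then show ?thesis by (simp add: kernel_fun_diff kernel_fun_add kernel_fun_const Y) (simp add: \<phi>_def)
  qed
  have "{a..b} = insert a (insert b {a<..<b})" using ab by auto
  then have "(\<Sum>v\<in>{a..b}. (if v = a \<or> v = b then 1 else Q) * (\<phi> (v + 1) - \<phi> v)) =
      (\<phi> (a + 1) - \<phi> a) + ((\<phi> (b + 1) - \<phi> b) + (\<Sum>v\<in>{a<..<b}. Q * (\<phi> (v + 1) - \<phi> v)))"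
    using ab by (simp cong: sum.cong_simp)
  also have "(\<Sum>v\<in>{a<..<b}. Q * (\<phi> (v + 1) - \<phi> v)) = Q * (\<phi> b - \<phi> (a + 1))"
    unfolding sum_distrib_left[symmetric] sum_int_telescope[OF ab] ..
  finally show ?thesis unfolding X U L by (simp add: algebra_simps)
qed

lemma kernel_fun_antisymmetric:
  assumes "Suc i < N" "u i = u (Suc i)"
    and "ml_rename (Transposition.transpose i (Suc i)) K = - K"
  shows "kernel_fun N K u = 0"
proof -
  let ?\<tau> = "Transposition.transpose i (Suc i)"
  have "u \<circ> ?\<tau> = u" using assms(2) by (auto simp: fun_eq_iff Transposition.transpose_def)
  then have "ml_rename ?\<tau> (ml_monom N u) = (ml_monom N u :: 'a mlaurent)"
    using ml_rename_monom[of ?\<tau> N u] bij_betw_transpose[of i "{..<N}" "Suc i"] assms(1) by simp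
  then have "ml_rename ?\<tau> (K * ml_monom N u) = - (K * ml_monom N u)"
    using assms(3) by (simp add: ml_rename_mult)
  then have "kernel_fun N K u = - kernel_fun N K u"
    unfolding kernel_fun_def by (metis constant_term_rename constant_term_uminus inj_transpose)
  then have "kernel_fun N K u + kernel_fun N K u = 0" by (simp only: eq_neg_iff_add_eq_0)
  then show ?thesis by (simp flip: mult_2)
qed

text \<open>The points t_m, ..., t_j without t_p, assigned in order to the coordinates m, ..., j -
  1.\<close>

definition omit_point :: "nat \<Rightarrow> nat \<Rightarrow> nat \<Rightarrow> (nat \<Rightarrow> int) \<Rightarrow> (nat \<Rightarrow> int) \<Rightarrow> nat \<Rightarrow> int" where
  "omit_point m j p t r i = (if i \<in> {m..<p} then t i else if i \<in> {p..<j} then t (Suc i) else r i)"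

lemma omit_point_upd: "J \<notin> {m..<j} \<Longrightarrow> p \<in> {m..j} \<Longrightarrow> omit_point m j p t (r(J := v)) = (omit_point m j p t r)(J := v)"
  by (auto simp: omit_point_def fun_eq_iff)

text \<open>Telescoping moves every variable to an end of its interval. An upper end followed by a
  lower end puts two neighbours at one point and cancels against the excluded coincidences. The
  remaining patterns are lower ends up to some index p and upper ends from there on.\<close>

theorem interlaced_sum_kernel_fun:
  fixes K :: "'a::field_char_0 mlaurent"
  assumes "m \<le> j" "j \<le> N" "\<And>i. m \<le> i \<Longrightarrow> i < j \<Longrightarrow> t i < t (Suc i)"
    and "\<And>i. m \<le> i \<Longrightarrow> Suc i < j \<Longrightarrow>
      ml_rename (Transposition.transpose i (Suc i)) (pair_A Q (Suc i) i * K) = - (pair_A Q (Suc i) i * K)"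
  shows "interlaced_sum Q m j t r (kernel_fun N ((\<Prod>i\<in>{m..<j}. ml_X i) * K)) =
    (\<Sum>p\<in>{m..j}. kernel_fun N ((\<Prod>i\<in>{m..<p}. - ml_lower Q i) * (\<Prod>i\<in>{p..<j}. ml_upper Q i) * K)
       (omit_point m j p t r))"
  using assms
proof (induction j arbitrary: K r rule: less_induct)
  case (less j)
  let ?L = "\<lambda>p. (\<Prod>i\<in>{m..<p}. - ml_lower Q i)" and ?U = "\<lambda>p j. (\<Prod>i\<in>{p..<j}. ml_upper Q i)"
  consider "j = m" | "j = Suc m" | i where "j = Suc (Suc i)" "m \<le> i"
  proof -
    have "j = m \<or> j = Suc m \<or> (\<exists>i. j = Suc (Suc i) \<and> m \<le> i)" using \<open>m \<le> j\<close> by presburger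
    then show thesis using that by blast
  qed
  then show ?case
  proof cases
    case 1
    have "omit_point m m m t r = r" by (auto simp: omit_point_def)
    with 1 show ?thesis by (simp add: interlaced_sum_same)
  next
    case 2
    have "m < N" "t m < t (Suc m)" using 2 less.prems by auto
    from interval_sum_kernel_fun[OF this, of Q K r]
    have "interlaced_sum Q m (Suc m) t r (kernel_fun N (ml_X m * K)) =
      kernel_fun N (ml_upper Q m * K) (r(m := t (Suc m))) + kernel_fun N (- ml_lower Q m * K) (r(m := t m))"
      by (simp only: interlaced_sum_first)
    moreover have "omit_point m (Suc m) m t r = r(m := t (Suc m))"
      "omit_point m (Suc m) (Suc m) t r = r(m := t m)"
      by (auto simp: omit_point_def fun_eq_iff)
    moreover have "{m..Suc m} = {m, Suc m}" by auto
    ultimately show ?thesis unfolding 2 by simp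
  next
    case (3 i)
    let ?J = "Suc i"
    define F where "F = kernel_fun N ((\<Prod>i\<in>{m..<j}. ml_X i) * K)"
    have J: "?J < N" using 3 less.prems by auto
    have tJ: "t i < t ?J" "t ?J < t (Suc ?J)" using 3 less.prems by auto
    have swap: "ml_rename (Transposition.transpose k (Suc k)) (ml_X a) = (ml_X a :: 'a mlaurent)" if "Suc k < a" for k a
      using that by (simp add: ml_rename_X)
    let ?pt = "\<lambda>p. omit_point m ?J p t r"
    have X_split: "(\<Prod>i\<in>{m..<j}. ml_X i) * K = (\<Prod>i\<in>{m..<?J}. ml_X i) * (ml_X ?J * K)"
      "(\<Prod>i\<in>{m..<j}. ml_X i) * K = (\<Prod>i\<in>{m..<i}. ml_X i) * (ml_X i * ml_X ?J * K)"
      using 3 by (simp_all add: mult_ac)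
    \<comment> \<open>Both terms of \<open>interlaced_sum_Suc_Suc\<close> have the shape of the
      induction hypothesis once the surplus factors, here x_J and below x_i x_J, are moved into
      \<open>K\<close>. Antisymmetry persists because the transpositions in question do not move
      these variables.\<close>
    have IH1: "interlaced_sum Q m ?J t r' F =
      (\<Sum>p\<in>{m..?J}. kernel_fun N (?L p * ?U p ?J * (ml_X ?J * K)) (omit_point m ?J p t r'))" for r'
      unfolding F_def X_split(1)
    proof (rule less.IH)
      fix k assume k: "m \<le> k" "Suc k < ?J"
      then have "ml_rename (Transposition.transpose k (Suc k)) (ml_X ?J * (pair_A Q (Suc k) k * K)) =
        - (ml_X ?J * (pair_A Q (Suc k) k * K))"
        using less.prems(4)[of k] 3 swap[of k ?J] by (simp add: ml_rename_mult del: mult_minus_left)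
      then show "ml_rename (Transposition.transpose k (Suc k)) (pair_A Q (Suc k) k * (ml_X ?J * K)) =
        - (pair_A Q (Suc k) k * (ml_X ?J * K))" by (simp only: mult_ac)
    qed (use 3 less.prems in auto)
    have IH2: "interlaced_sum Q m i t r' F =
      (\<Sum>p\<in>{m..i}. kernel_fun N (?L p * ?U p i * (ml_X i * ml_X ?J * K)) (omit_point m i p t r'))" for r'
      unfolding F_def X_split(2)
    proof (rule less.IH)
      fix k assume k: "m \<le> k" "Suc k < i"
      then have "ml_rename (Transposition.transpose k (Suc k)) ((ml_X i * ml_X ?J) * (pair_A Q (Suc k) k * K)) =
        - ((ml_X i * ml_X ?J) * (pair_A Q (Suc k) k * K))"
        using less.prems(4)[of k] 3 swap[of k i] swap[of k ?J] by (simp add: ml_rename_mult del: mult_minus_left)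
      then show "ml_rename (Transposition.transpose k (Suc k)) (pair_A Q (Suc k) k * (ml_X i * ml_X ?J * K)) =
        - (pair_A Q (Suc k) k * (ml_X i * ml_X ?J * K))" by (simp only: mult_ac)
    qed (use 3 less.prems in auto)
    have "(\<Sum>v\<in>{t ?J..t (Suc ?J)}. (if v = t ?J \<or> v = t (Suc ?J) then 1 else Q) *
       interlaced_sum Q m ?J t (r(?J := v)) F) =
      (\<Sum>p\<in>{m..?J}. \<Sum>v\<in>{t ?J..t (Suc ?J)}. (if v = t ?J \<or> v = t (Suc ?J) then 1 else Q) *
         kernel_fun N (ml_X ?J * (?L p * ?U p ?J * K)) ((?pt p)(?J := v)))"
      unfolding IH1 sum_distrib_left
      by (subst sum.swap, intro sum.cong refl arg_cong2[of _ _ _ _ "(*)"])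
        (auto simp: omit_point_upd mult_ac)
    also have "\<dots> = (\<Sum>p\<in>{m..?J}. kernel_fun N (ml_upper Q ?J * (?L p * ?U p ?J * K)) ((?pt p)(?J := t (Suc ?J)))) +
      (\<Sum>p\<in>{m..?J}. kernel_fun N (- ml_lower Q ?J * (?L p * ?U p ?J * K)) ((?pt p)(?J := t ?J)))"
      unfolding interval_sum_kernel_fun[OF J tJ(2)] sum.distrib ..
    also have "(\<Sum>p\<in>{m..?J}. kernel_fun N (- ml_lower Q ?J * (?L p * ?U p ?J * K)) ((?pt p)(?J := t ?J))) =
      kernel_fun N (?L (Suc ?J) * K) (omit_point m j (Suc ?J) t r) +
      (\<Sum>p\<in>{m..i}. kernel_fun N (- ml_lower Q ?J * (?L p * ?U p ?J * K)) ((?pt p)(?J := t ?J)))"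
    proof -
      have "{m..?J} = insert ?J {m..i}" using 3 by auto
      moreover have "(?pt ?J)(?J := t ?J) = omit_point m j (Suc ?J) t r"
        using 3 by (auto simp: omit_point_def fun_eq_iff less_Suc_eq)
      moreover have "- ml_lower Q ?J * (?L ?J * ?U ?J ?J * K) = ?L (Suc ?J) * K"
        using 3 by (simp add: mult_ac)
      ultimately show ?thesis by simp
    qed
    also have "(\<Sum>p\<in>{m..?J}. kernel_fun N (ml_upper Q ?J * (?L p * ?U p ?J * K)) ((?pt p)(?J := t (Suc ?J)))) =
      (\<Sum>p\<in>{m..?J}. kernel_fun N (?L p * ?U p j * K) (omit_point m j p t r))"
    proof (rule sum.cong[OF refl])
      fix p assume p: "p \<in> {m..?J}"
      then have "(?pt p)(?J := t (Suc ?J)) = omit_point m j p t r"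
        using 3 by (auto simp: omit_point_def fun_eq_iff less_Suc_eq)
      moreover have "ml_upper Q ?J * (?L p * ?U p ?J * K) = ?L p * ?U p j * K"
        using 3 p by (simp add: mult_ac)
      ultimately show "kernel_fun N (ml_upper Q ?J * (?L p * ?U p ?J * K)) ((?pt p)(?J := t (Suc ?J))) =
        kernel_fun N (?L p * ?U p j * K) (omit_point m j p t r)" by simp
    qed
    \<comment> \<open>These are the terms with the last variable at its lower end and its neighbour
      at its upper end; they amount exactly to the coincidence that is subtracted.\<close>
    also have "(\<Sum>p\<in>{m..i}. kernel_fun N (- ml_lower Q ?J * (?L p * ?U p ?J * K)) ((?pt p)(?J := t ?J))) =
      interlaced_sum Q m i t (r(i := t ?J, ?J := t ?J)) F"
      unfolding IH2
    proof (rule sum.cong[OF refl])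
      fix p assume p: "p \<in> {m..i}"
      let ?g = "(?pt p)(?J := t ?J)"
      let ?M = "ml_const Q * (?L p * ?U p i)"
      have g: "omit_point m i p t (r(i := t ?J, ?J := t ?J)) = ?g"
        using p by (auto simp: omit_point_def fun_eq_iff less_Suc_eq)
      have gi: "?g i = ?g (Suc i)" using p by (auto simp: omit_point_def)
      have inv: "ml_rename (Transposition.transpose i (Suc i)) ?M = ?M"
        using p by (simp add: ml_rename_mult ml_rename_prod ml_rename_of_fls ml_rename_const ml_rename_uminus)
      have "ml_rename (Transposition.transpose i (Suc i)) (?M * (pair_A Q (Suc i) i * K)) =
          ?M * ml_rename (Transposition.transpose i (Suc i)) (pair_A Q (Suc i) i * K)"
        by (subst ml_rename_mult) (simp_all only: inv inj_transpose)
      also have "\<dots> = - (?M * (pair_A Q (Suc i) i * K))"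
        using less.prems(4)[of i] 3 by simp
      finally have zero: "kernel_fun N (?M * (pair_A Q (Suc i) i * K)) ?g = 0"
        by (rule kernel_fun_antisymmetric[OF J gi])
      \<comment> \<open>Excluding the coincidence of two neighbours produces exactly the factor \<open>pair_A\<close>.\<close>
      have key: "- ml_lower Q ?J * ml_upper Q i - ml_X i * ml_X ?J = - (ml_const Q * pair_A Q ?J i)"
        by (simp add: ml_lower_conv ml_upper_conv pair_A_def ml_Y_conv algebra_simps)
      have "- ml_lower Q ?J * (?L p * ?U p ?J * K) =
          ?L p * ?U p i * K * (- ml_lower Q ?J * ml_upper Q i - ml_X i * ml_X ?J) + ?L p * ?U p i * (ml_X i * ml_X ?J * K)"
        using p by (simp add: algebra_simps)
      also have "\<dots> = ?L p * ?U p i * (ml_X i * ml_X ?J * K) - ?M * (pair_A Q (Suc i) i * K)"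
        unfolding key by (simp add: algebra_simps)
      finally show "kernel_fun N (- ml_lower Q ?J * (?L p * ?U p ?J * K)) ?g =
        kernel_fun N (?L p * ?U p i * (ml_X i * ml_X ?J * K)) (omit_point m i p t (r(i := t ?J, ?J := t ?J)))"
        unfolding g using zero by (simp only: kernel_fun_diff diff_zero)
    qed
    finally have "interlaced_sum Q m j t r F =
      (\<Sum>p\<in>{m..?J}. kernel_fun N (?L p * ?U p j * K) (omit_point m j p t r)) +
      kernel_fun N (?L (Suc ?J) * K) (omit_point m j (Suc ?J) t r)"
      by (simp only: 3(1) interlaced_sum_Suc_Suc[OF \<open>m \<le> i\<close> tJ] add.assoc[symmetric] add_diff_cancel_right')
    moreover have "{m..j} = insert (Suc ?J) {m..?J}" using 3 by auto
    ultimately show ?thesis unfolding F_def using 3(1) by (simp add: add.commute)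
  qed
qed

subsection \<open>Adding a row\<close>

definition fls_kappa :: "'a::field_char_0 \<Rightarrow> 'a fls" where
  "fls_kappa Q = fls_X / fls_lower Q"

text \<open>What distinguishes the kernel after an odd row from the one after the even row before
  it: in each variable the inverse of \<open>- fls_kappa Q\<close>.\<close>

definition odd_factor :: "'a::field_char_0 \<Rightarrow> nat \<Rightarrow> 'a mlaurent" where
  "odd_factor Q N = (\<Prod>r<N. ml_of_fls r (- (fls_lower Q / fls_X)))"

lemma fls_lower_neq_0 [simp]: "fls_lower Q \<noteq> 0"
proof
  assume *: "fls_lower Q = 0"
  have "fls_nth (fls_lower Q) 0 = Q" "fls_nth (fls_lower Q) 1 = Q - 1"
    by (simp_all add: fls_lower_def)
  with * show False by simp
qed

lemma fls_kappa_neq_0 [simp]: "fls_kappa Q \<noteq> 0"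
  unfolding fls_kappa_def divide_eq_0_iff by simp

lemma fls_subdegree_kappa:
  assumes "Q \<noteq> 0"
  shows "fls_subdegree (fls_kappa Q) = 1"
proof -
  have "fls_subdegree (fls_lower Q) = 0"
    using assms by (intro fls_subdegree_eqI) (auto simp: fls_lower_def)
  then show ?thesis unfolding fls_kappa_def by (subst fls_divide_subdegree) auto
qed

lemma lower_times_kappa: "fls_lower Q / fls_X * fls_kappa Q = 1"
  unfolding fls_kappa_def by (simp only: times_divide_times_eq) (simp add: mult.commute)

lemma ml_rename_prod_of_fls:
  assumes "inj \<rho>" "bij_betw \<rho> S S"
  shows "ml_rename \<rho> (\<Prod>a\<in>S. ml_of_fls a f) = (\<Prod>a\<in>S. ml_of_fls a (f :: 'a::comm_ring_1 fls))"
  using assms by (simp add: ml_rename_prod ml_rename_of_fls prod.reindex_bij_betw[of \<rho> S S "\<lambda>a. ml_of_fls a f"])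

lemma ml_rename_transpose_Z:
  assumes "m \<le> i"
  shows "ml_rename (Transposition.transpose i (Suc i)) (\<Prod>r<m. ml_of_fls r (z r)) =
    (\<Prod>r<m. ml_of_fls r (z r :: 'a::comm_ring_1 fls))"
  using assms by (auto simp: ml_rename_prod ml_rename_of_fls intro!: prod.cong)

lemma kernel_antisymmetric_mult:
  assumes "Suc i < N" "ml_rename (Transposition.transpose i (Suc i)) M = M"
  shows "ml_rename (Transposition.transpose i (Suc i)) (pair_A Q (Suc i) i * (kernel Q N * M)) =
    - (pair_A Q (Suc i) i * (kernel Q N * M))"
proof -
  have "ml_rename (Transposition.transpose i (Suc i)) ((pair_A Q (Suc i) i * kernel Q N) * M) =
      - (pair_A Q (Suc i) i * kernel Q N) * M"
    by (subst ml_rename_mult) (simp_all only: kernel_antisymmetric[OF assms(1)] assms(2) inj_transpose)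
  then show ?thesis by (simp only: mult.assoc mult_minus_left)
qed

lemma prod_X_inverse:
  "(\<Prod>i\<in>S. ml_X i) * (\<Prod>i\<in>S. ml_of_fls i (inverse fls_X)) = (1 :: 'a::field_char_0 mlaurent)"
  unfolding prod.distrib[symmetric] ml_X_def ml_of_fls_mult[symmetric]
  by (rule prod.neutral) (simp del: fls_inverse_X)

text \<open>Exponent 0 means that the last variable sits on the axis. Then x_N occurs only in the
  kernel, which lies in \<open>V_span N\<close>, and in the simple pole, so
  \<open>constant_term_V_span\<close> applies.\<close>

lemma kernel_fun_boundary:
  assumes "g N = 0" "ml_free N M"
  shows "kernel_fun (Suc N) (kernel Q (Suc N) * (M * ml_of_fls N (inverse fls_X))) g = 0"
proof -
  have mon: "ml_monom (Suc N) g = (ml_monom N g :: 'a mlaurent)"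
    using assms(1) by (simp add: ml_monom_def)
  have "ml_free N (M * ml_monom N g)"
    unfolding ml_monom_def by (intro ml_free_mult ml_free_prod assms(2) ml_free_of_fls) auto
  then have "kernel Q (Suc N) * (M * ml_monom N g) \<in> V_span N"
    by (intro V_span_mult kernel_V_span V_span_free)
  from constant_term_V_span[OF this] show ?thesis
    unfolding kernel_fun_def mon by (simp only: mult_ac)
qed

lemma ml_free_lower: "r \<noteq> i \<Longrightarrow> ml_free r (- ml_lower Q i)"
  by (intro ml_free_uminus ml_free_of_fls)

lemma kernel_fun_cong: "(\<And>r. r < N \<Longrightarrow> u r = v r) \<Longrightarrow> kernel_fun N K u = kernel_fun N K v"
  unfolding kernel_fun_def by (simp cong: ml_monom_cong)

text \<open>The axis at 0 serves as the upper bound of the last column, which has to stay strictly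
  below it. Removing the value 0 reduces the end factor x_k + Q of a last variable on the axis to Q,
  and these terms vanish by \<open>kernel_fun_boundary\<close>. Only the term with all active
  variables at their lower ends survives.\<close>

lemma odd_row_sum:
  fixes z :: "nat \<Rightarrow> 'a::field_char_0 fls"
  assumes m: "m \<le> N" and t: "\<And>i. m \<le> i \<Longrightarrow> Suc i < N \<Longrightarrow> t i < t (Suc i)" "m < N \<Longrightarrow> t (N - 1) < 0"
  shows "(\<Sum>s | s \<in> interlaced m N (t(N := 0)) t \<and> (m < N \<longrightarrow> s (N - 1) < 0).
      interlaced_weight Q m N (t(N := 0)) s * kernel_fun N (kernel Q N * (\<Prod>r<m. ml_of_fls r (z r))) s) =
    kernel_fun N (kernel Q N * odd_factor Q N * (\<Prod>r<m. ml_of_fls r (z r * - fls_kappa Q))) t"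
proof -
  define Z where "Z = (\<Prod>r<m. ml_of_fls r (z r))"
  define I where "I = (\<Prod>i\<in>{m..<N}. ml_of_fls i (inverse fls_X) :: 'a mlaurent)"
  define K where "K = kernel Q N * (I * Z)"
  \<comment> \<open>For an ended column the new factor \<open>- fls_kappa Q\<close> and
    \<open>odd_factor\<close> cancel; for an active one \<open>odd_factor\<close> is the lower end
    factor \<open>- ml_lower Q\<close> divided by x, as required by the antidifference.\<close>
  have target: "kernel Q N * odd_factor Q N * (\<Prod>r<m. ml_of_fls r (z r * - fls_kappa Q)) =
    (\<Prod>i\<in>{m..<N}. - ml_lower Q i) * K"
  proof -
    have "{..<N} = {..<m} \<union> {m..<N}" using m by auto
    then have "odd_factor Q N = (\<Prod>r<m. ml_of_fls r (- (fls_lower Q / fls_X))) * (\<Prod>i\<in>{m..<N}. ml_of_fls i (- (fls_lower Q / fls_X)))"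
      unfolding odd_factor_def by (simp add: prod.union_disjoint[symmetric] ivl_disj_int del: fls_divide_X)
    also have "(\<Prod>i\<in>{m..<N}. ml_of_fls i (- (fls_lower Q / fls_X))) = (\<Prod>i\<in>{m..<N}. - ml_lower Q i) * I"
      unfolding I_def prod.distrib[symmetric] by (simp only: ml_of_fls_uminus divide_inverse ml_of_fls_mult mult_minus_left)
    finally have "odd_factor Q N * (\<Prod>r<m. ml_of_fls r (z r * - fls_kappa Q)) =
       ((\<Prod>r<m. ml_of_fls r (- (fls_lower Q / fls_X))) * (\<Prod>r<m. ml_of_fls r (z r * - fls_kappa Q))) *
       ((\<Prod>i\<in>{m..<N}. - ml_lower Q i) * I)"
      by (simp only: mult_ac)
    also have "(\<Prod>r<m. ml_of_fls r (- (fls_lower Q / fls_X))) * (\<Prod>r<m. ml_of_fls r (z r * - fls_kappa Q)) = Z"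
    proof -
      have "- (fls_lower Q / fls_X) * (z r * - fls_kappa Q) = z r * (fls_lower Q / fls_X * fls_kappa Q)" for r
        by (simp only: mult_minus_left mult_minus_right minus_minus mult_ac)
      then show ?thesis
        unfolding Z_def prod.distrib[symmetric] ml_of_fls_mult[symmetric] lower_times_kappa by (simp only: mult_1_right)
    qed
    finally show ?thesis by (simp add: K_def mult_ac)
  qed
  show ?thesis
  proof (cases "m = N")
    case True
    then have "I = 1" "interlaced m N (t(N := 0)) t = {t}" by (simp_all add: I_def interlaced_same)
    then show ?thesis
      unfolding target using True by (simp add: interlaced_weight_def K_def Z_def Collect_conv_if)
  next
    case False
    then obtain k where k: "N = Suc k" "m \<le> k" using m by (cases N) auto
    define t' where "t' = t(N := 0)"
    have t'N: "t' N = 0" and t'i: "\<And>i. i < N \<Longrightarrow> t' i = t i" by (auto simp: t'_def)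
    let ?L = "\<lambda>p. (\<Prod>i\<in>{m..<p}. - ml_lower Q i)" and ?U = "\<lambda>p j. (\<Prod>i\<in>{p..<j}. ml_upper Q i)"
    define F where "F = kernel_fun N (kernel Q N * Z)"
    have F1: "F = kernel_fun N ((\<Prod>i\<in>{m..<N}. ml_X i) * K)"
    proof -
      have "(\<Prod>i\<in>{m..<N}. ml_X i) * K = ((\<Prod>i\<in>{m..<N}. ml_X i) * I) * (kernel Q N * Z)"
        unfolding K_def by (simp only: mult_ac)
      then show ?thesis unfolding F_def I_def prod_X_inverse by simp
    qed
    have F2: "F = kernel_fun N ((\<Prod>i\<in>{m..<k}. ml_X i) * (ml_X k * K))"
      unfolding F1 using k by (simp add: mult_ac)
    have anti: "ml_rename (Transposition.transpose i (Suc i)) (pair_A Q (Suc i) i * K) = - (pair_A Q (Suc i) i * K)"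
      if i: "m \<le> i" "Suc i < N" for i
    proof -
      have "ml_rename (Transposition.transpose i (Suc i)) (I * Z) = I * Z"
        unfolding I_def Z_def using i
        by (simp add: ml_rename_mult ml_rename_transpose_Z ml_rename_prod_of_fls bij_betw_transpose
            del: fls_inverse_X)
      from kernel_antisymmetric_mult[OF i(2) this] show ?thesis by (simp only: K_def)
    qed
    have anti2: "ml_rename (Transposition.transpose i (Suc i)) (pair_A Q (Suc i) i * (ml_X k * K)) =
        - (pair_A Q (Suc i) i * (ml_X k * K))" if i: "m \<le> i" "Suc i < k" for i
    proof -
      have "ml_rename (Transposition.transpose i (Suc i)) (ml_X k) = (ml_X k :: 'a mlaurent)"
        using i by (simp add: ml_rename_X)
      then have "ml_rename (Transposition.transpose i (Suc i)) (ml_X k * (pair_A Q (Suc i) i * K)) =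
        ml_X k * - (pair_A Q (Suc i) i * K)"
        using anti[of i] i k by (subst ml_rename_mult) simp_all
      then show ?thesis by (simp only: mult_minus_right mult_ac)
    qed
    have incr: "t' i < t' (Suc i)" if "m \<le> i" "i < N" for i
      using that t k by (cases "Suc i = N") (auto simp: t'_def)
    have all: "interlaced_sum Q m N t' t F =
      (\<Sum>p\<in>{m..N}. kernel_fun N (?L p * ?U p N * K) (omit_point m N p t' t))"
      unfolding F1 by (rule interlaced_sum_kernel_fun) (use m incr anti in auto)
    have top: "interlaced_sum Q m k t' (t(k := 0)) F =
      (\<Sum>p\<in>{m..k}. kernel_fun N (?L p * ?U p k * (ml_X k * K)) (omit_point m k p t' (t(k := 0))))"
      unfolding F2
    proof (rule interlaced_sum_kernel_fun)
      show "m \<le> k" "k \<le> N" using k by auto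
      show "t' i < t' (Suc i)" if "m \<le> i" "i < k" for i by (rule incr) (use that k in auto)
    qed (rule anti2)
    let ?S = "{s \<in> interlaced m N t' t. m < N \<longrightarrow> s (N - 1) < 0}"
    let ?T = "interlaced m k t' (t(k := 0))"
    \<comment> \<open>The rows in \<open>?T\<close> reach the axis: their last coordinate is 0, and
      the preceding ones are interlaced as before because t_k < 0.\<close>
    have eq: "interlaced m N t' t = ?S \<union> ?T" and disj: "?S \<inter> ?T = {}"
    proof -
      show "?S \<inter> ?T = {}" using k by (auto simp: interlaced_def)
      have "s \<in> ?T" if s: "s \<in> interlaced m N t' t" "\<not> s k < 0" for s
      proof -
        from s k t'N have "s k = 0" by (force simp: interlaced_def)
        with s k show ?thesis unfolding interlaced_def by (auto simp: less_Suc_eq)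
      qed
      moreover have "s \<in> interlaced m N t' t" if s: "s \<in> ?T" for s
      proof -
        from s have sk: "s k = 0" by (simp add: interlaced_def)
        have "s a < s (Suc a)" if a: "m \<le> a" "Suc a < N" for a
        proof (cases "Suc a = k")
          case True
          then have "s a \<le> t' k" using s a unfolding interlaced_def by auto
          then show ?thesis using sk t t'i[of k] k True by auto
        next
          case False
          then show ?thesis using s a k unfolding interlaced_def by auto
        qed
        moreover have "t k \<le> 0" using t(2) k by simp
        ultimately show ?thesis using s sk t'N t'i[of k] k unfolding interlaced_def by (auto simp: less_Suc_eq)
      qed
      ultimately show "interlaced m N t' t = ?S \<union> ?T" using k by auto
    qed
    have "interlaced_sum Q m N t' t F = (\<Sum>s\<in>?S. interlaced_weight Q m N t' s * F s) +
        (\<Sum>s\<in>?T. interlaced_weight Q m N t' s * F s)"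
      unfolding interlaced_sum_def
      by (subst (1) eq, rule sum.union_disjoint)
        (use finite_interlaced[of m N t' t] finite_interlaced[OF k(2), of t'] m disj in auto)
    also have "(\<Sum>s\<in>?T. interlaced_weight Q m N t' s * F s) = interlaced_sum Q m k t' (t(k := 0)) F"
      unfolding interlaced_sum_def
    proof (rule sum.cong[OF refl])
      fix s assume "s \<in> ?T"
      then have "s k = 0" by (simp add: interlaced_def)
      then show "interlaced_weight Q m N t' s * F s = interlaced_weight Q m k t' s * F s"
        using k t'N by (simp add: interlaced_weight_def)
    qed
    finally have "(\<Sum>s\<in>?S. interlaced_weight Q m N t' s * F s) =
      interlaced_sum Q m N t' t F - interlaced_sum Q m k t' (t(k := 0)) F"
      unfolding eq_diff_eq by (rule sym)
    also have "\<dots> = kernel_fun N (?L N * K) (omit_point m N N t' t) +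
      ((\<Sum>p\<in>{m..k}. kernel_fun N (?L p * ?U p N * K) (omit_point m N p t' t)) -
       (\<Sum>p\<in>{m..k}. kernel_fun N (?L p * ?U p k * (ml_X k * K)) (omit_point m k p t' (t(k := 0)))))"
    proof -
      have "{m..N} = insert N {m..k}" using k by auto
      then show ?thesis unfolding all top using k by simp
    qed
    also have "(\<Sum>p\<in>{m..k}. kernel_fun N (?L p * ?U p N * K) (omit_point m N p t' t)) =
       (\<Sum>p\<in>{m..k}. kernel_fun N (?L p * ?U p k * (ml_X k * K)) (omit_point m k p t' (t(k := 0))))"
    proof (rule sum.cong[OF refl])
      fix p assume p: "p \<in> {m..k}"
      let ?g = "omit_point m N p t' t"
      have g: "omit_point m k p t' (t(k := 0)) = ?g"
        using p k t'N by (auto simp: omit_point_def fun_eq_iff less_Suc_eq)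
      have gk: "?g k = 0" using p k t'N by (auto simp: omit_point_def)
      define I' where "I' = (\<Prod>i\<in>{m..<k}. ml_of_fls i (inverse fls_X) :: 'a mlaurent)"
      have I: "I = I' * ml_of_fls k (inverse fls_X)" using k by (simp add: I_def I'_def)
      define M where "M = ml_const Q * (?L p * ?U p k) * (I' * Z)"
      have "ml_free k M"
        unfolding M_def I'_def Z_def using p k
        by (intro ml_free_mult ml_free_const ml_free_prod ml_free_lower ml_free_of_fls) auto
      with gk have "kernel_fun N (kernel Q N * (M * ml_of_fls k (inverse fls_X))) ?g = 0"
        unfolding k(1) by (intro kernel_fun_boundary)
      moreover have "kernel Q N * (M * ml_of_fls k (inverse fls_X)) = ml_const Q * (?L p * ?U p k * K)"
        unfolding M_def K_def I by (simp only: mult_ac)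
      \<comment> \<open>In x_k + Q the part x_k reproduces the term that is subtracted, and the part
        Q keeps the pole 1 / x_k of \<open>I\<close> while the exponent in that variable is
        0.\<close>
      moreover have "?L p * ?U p N * K = ?L p * ?U p k * (ml_X k * K) + ml_const Q * (?L p * ?U p k * K)"
      proof -
        have "?U p N = ?U p k * (ml_X k + ml_const Q)"
          using p k by (simp add: ml_upper_conv ml_Y_conv)
        then show ?thesis by (simp add: algebra_simps)
      qed
      ultimately show "kernel_fun N (?L p * ?U p N * K) ?g =
        kernel_fun N (?L p * ?U p k * (ml_X k * K)) (omit_point m k p t' (t(k := 0)))"
        unfolding g by (simp only: kernel_fun_add add_0_right)
    qed
    also have "kernel_fun N (?L N * K) (omit_point m N N t' t) = kernel_fun N (?L N * K) t"
      by (rule kernel_fun_cong) (auto simp: omit_point_def t'_def)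
    finally show ?thesis unfolding target Z_def[symmetric] F_def[symmetric] t'_def[symmetric] by simp
  qed
qed

text \<open>The boundary term that omits the point t_p equals the term of
  \<open>constant_term_kernel_Suc\<close> in which variable p is removed. Ended columns restrict
  both sums to p \<ge> m.\<close>

lemma even_row_sum:
  fixes z :: "nat \<Rightarrow> 'a::field_char_0 fls"
  assumes Q: "Q \<noteq> 0" and m: "m \<le> N" and t: "\<And>i. m \<le> i \<Longrightarrow> i < N \<Longrightarrow> t i < t (Suc i)"
    and z: "\<And>r. r < m \<Longrightarrow> z r \<noteq> 0 \<and> fls_subdegree (z r) \<ge> 0"
  shows "(\<Sum>s\<in>interlaced m N t t.
      interlaced_weight Q m N t s * kernel_fun N (kernel Q N * odd_factor Q N * (\<Prod>r<m. ml_of_fls r (z r))) s) =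
    kernel_fun (Suc N) (kernel Q (Suc N) * (\<Prod>r<m. ml_of_fls r (z r * - fls_kappa Q))) t"
proof -
  define Z where "Z = (\<Prod>r<m. ml_of_fls r (z r))"
  define Z' where "Z' = (\<Prod>r<m. ml_of_fls r (z r * - fls_kappa Q))"
  define I where "I = (\<Prod>i\<in>{m..<N}. ml_of_fls i (inverse fls_X) :: 'a mlaurent)"
  define K where "K = kernel Q N * (odd_factor Q N * (I * Z))"
  let ?L = "\<lambda>p. (\<Prod>i\<in>{m..<p}. - ml_lower Q i)" and ?U = "\<lambda>p j. (\<Prod>i\<in>{p..<j}. ml_upper Q i)"
  have sub: "fls_subdegree (z r * - fls_kappa Q) \<ge> 1" if "r < m" for r
    using z[OF that] fls_subdegree_kappa[OF Q] by (simp del: mult_minus_right)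
  have anti: "ml_rename (Transposition.transpose i (Suc i)) (pair_A Q (Suc i) i * K) = - (pair_A Q (Suc i) i * K)"
    if i: "m \<le> i" "Suc i < N" for i
  proof -
    have "ml_rename (Transposition.transpose i (Suc i)) (odd_factor Q N * (I * Z)) = odd_factor Q N * (I * Z)"
      unfolding I_def Z_def odd_factor_def using i
      by (simp add: ml_rename_mult ml_rename_transpose_Z ml_rename_prod_of_fls bij_betw_transpose del: fls_divide_X)
    from kernel_antisymmetric_mult[OF i(2) this] show ?thesis by (simp only: K_def)
  qed
  have F: "kernel_fun N (kernel Q N * odd_factor Q N * Z) = kernel_fun N ((\<Prod>i\<in>{m..<N}. ml_X i) * K)"
  proof -
    have "(\<Prod>i\<in>{m..<N}. ml_X i) * K = ((\<Prod>i\<in>{m..<N}. ml_X i) * I) * (kernel Q N * odd_factor Q N * Z)"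
      unfolding K_def by (simp only: mult_ac)
    then show ?thesis unfolding I_def prod_X_inverse by simp
  qed
  have "interlaced_sum Q m N t t (kernel_fun N ((\<Prod>i\<in>{m..<N}. ml_X i) * K)) =
    (\<Sum>p\<in>{m..N}. kernel_fun N (?L p * ?U p N * K) (omit_point m N p t t))"
    by (rule interlaced_sum_kernel_fun) (use m t anti in auto)
  also have "\<dots> = (\<Sum>p\<in>{m..N}. (-1) ^ (p + N) * ml_constant_term (kernel Q N * Z' *
       ((\<Prod>i<N. ml_of_fls i (fls_lower Q / fls_X\<^sup>2)) *
        ((\<Prod>i<p. ml_lower Q i) * ?U p N)) * ml_monom N (t \<circ> skip p)))"
  proof (rule sum.cong[OF refl])
    fix p assume p: "p \<in> {m..N}"
    have pt: "kernel_fun N (?L p * ?U p N * K) (omit_point m N p t t) = kernel_fun N (?L p * ?U p N * K) (t \<circ> skip p)"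
      using p by (intro kernel_fun_cong) (auto simp: omit_point_def skip_def)
    \<comment> \<open>The sign (-1)^p goes to the p factors \<open>ml_lower\<close> and (-1)^N to
      \<open>odd_factor\<close>. In each ended variable \<open>- ml_lower Q\<close> divided by x is
      the inverse of the new factor \<open>- fls_kappa Q\<close>, so \<open>Z'\<close> turns back
      into \<open>Z\<close>.\<close>
    have ker: "?L p * ?U p N * K = (-1) ^ (p + N) * (kernel Q N * Z' *
       ((\<Prod>i<N. ml_of_fls i (fls_lower Q / fls_X\<^sup>2)) * ((\<Prod>i<p. ml_lower Q i) * ?U p N)))"
    proof -
      have set_p: "{..<p} = {..<m} \<union> {m..<p}" and set_N: "{..<N} = {..<m} \<union> {m..<N}" using p by auto
      have a: "(-1) ^ p * (\<Prod>i<p. ml_lower Q i) = (\<Prod>i<m. - ml_lower Q i) * ?L p"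
      proof -
        have "(-1) ^ p * (\<Prod>i<p. ml_lower Q i) = (\<Prod>i<p. - ml_lower Q i)"
          by (simp add: prod_uminus)
        also have "\<dots> = (\<Prod>i<m. - ml_lower Q i) * ?L p"
          unfolding set_p by (rule prod.union_disjoint) auto
        finally show ?thesis .
      qed
      have b: "(-1) ^ N * (\<Prod>i<N. ml_of_fls i (fls_lower Q / fls_X\<^sup>2)) =
        odd_factor Q N * ((\<Prod>i<m. ml_of_fls i (inverse fls_X)) * I)"
      proof -
        have "(\<Prod>i<m. ml_of_fls i (inverse fls_X)) * I = (\<Prod>i<N. ml_of_fls i (inverse fls_X) :: 'a mlaurent)"
          unfolding set_N I_def by (rule prod.union_disjoint[symmetric]) auto
        then have "odd_factor Q N * ((\<Prod>i<m. ml_of_fls i (inverse fls_X)) * I) =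
          (\<Prod>i<N. ml_of_fls i (- (fls_lower Q / fls_X)) * ml_of_fls i (inverse fls_X))"
          by (simp only: odd_factor_def prod.distrib)
        also have "\<dots> = (\<Prod>i<N. - ml_of_fls i (fls_lower Q / fls_X\<^sup>2))"
          by (simp only: ml_of_fls_mult[symmetric] ml_of_fls_uminus[symmetric] divide_inverse
              power2_eq_square inverse_mult_distrib mult_minus_left mult.assoc)
        also have "\<dots> = (-1) ^ N * (\<Prod>i<N. ml_of_fls i (fls_lower Q / fls_X\<^sup>2))"
          by (simp add: prod_uminus del: fls_divide_X)
        finally show ?thesis by simp
      qed
      have c: "Z' * ((\<Prod>i<m. - ml_lower Q i) * (\<Prod>i<m. ml_of_fls i (inverse fls_X))) = Z"
      proof -
        have "z r * - fls_kappa Q * (- fls_lower Q * inverse fls_X) = z r * (fls_lower Q / fls_X * fls_kappa Q)" for r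
          by (simp only: mult_minus_left mult_minus_right minus_minus divide_inverse mult_ac)
        then have "z r * - fls_kappa Q * (- fls_lower Q * inverse fls_X) = z r" for r
          unfolding lower_times_kappa by simp
        then show ?thesis
          unfolding Z'_def Z_def prod.distrib[symmetric]
          by (simp only: ml_of_fls_uminus[symmetric] ml_of_fls_mult[symmetric])
      qed
      have "(-1) ^ (p + N) * (kernel Q N * Z' *
       ((\<Prod>i<N. ml_of_fls i (fls_lower Q / fls_X\<^sup>2)) * ((\<Prod>i<p. ml_lower Q i) * ?U p N))) =
       kernel Q N * Z' * (((-1) ^ N * (\<Prod>i<N. ml_of_fls i (fls_lower Q / fls_X\<^sup>2))) *
         (((-1) ^ p * (\<Prod>i<p. ml_lower Q i)) * ?U p N))"
        by (simp only: power_add mult_ac)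
      also have "\<dots> = ?L p * ?U p N * (kernel Q N * (odd_factor Q N * (I *
          (Z' * ((\<Prod>i<m. - ml_lower Q i) * (\<Prod>i<m. ml_of_fls i (inverse fls_X)))))))"
        unfolding a b by (simp only: mult_ac)
      finally show ?thesis unfolding c K_def by simp
    qed
    show "kernel_fun N (?L p * ?U p N * K) (omit_point m N p t t) =
      (-1) ^ (p + N) * ml_constant_term (kernel Q N * Z' *
       ((\<Prod>i<N. ml_of_fls i (fls_lower Q / fls_X\<^sup>2)) *
        ((\<Prod>i<p. ml_lower Q i) * ?U p N)) * ml_monom N (t \<circ> skip p))"
      unfolding pt unfolding ker kernel_fun_def by (simp only: mult.assoc constant_term_sign)
  qed
  also have "\<dots> = ml_constant_term (kernel Q (Suc N) * Z' * ml_monom (Suc N) t)"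
    unfolding Z'_def using m sub by (intro constant_term_kernel_Suc[symmetric]) auto
  finally show ?thesis
    unfolding F[symmetric] interlaced_sum_def Z_def Z'_def kernel_fun_def .
qed

text \<open>With all N + 1 variables divisible the range of summation in
  \<open>constant_term_kernel_Suc\<close> is empty. This is the algebraic counterpart of the fact
  that N + 1 ended columns cannot come from a state with N columns.\<close>

lemma even_row_sum_frozen:
  fixes z :: "nat \<Rightarrow> 'a::field_char_0 fls"
  assumes "\<And>r. r \<le> N \<Longrightarrow> fls_subdegree (z r) \<ge> 1"
  shows "kernel_fun (Suc N) (kernel Q (Suc N) * (\<Prod>r<Suc N. ml_of_fls r (z r))) t = 0"
  using constant_term_kernel_Suc[of "Suc N" N z Q t] assms unfolding kernel_fun_def by simp

section \<open>Rows of a trapezoid as sets of columns\<close>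

text \<open>The i-th element of an increasing enumeration, counted from 0, is at most x iff more
  than i elements are. This turns the conditions on partial sums of a row into interlacing
  inequalities and back.\<close>

lemma less_card_le_iff:
  assumes "strict_mono_on {..<k} (t :: nat \<Rightarrow> int)"
  shows "i < card {y \<in> t ` {..<k}. y \<le> x} \<longleftrightarrow> i < k \<and> t i \<le> x"
proof -
  have inj: "inj_on t {..<k}" using assms by (rule strict_mono_on_imp_inj_on)
  have "{y \<in> t ` {..<k}. y \<le> x} = t ` {j \<in> {..<k}. t j \<le> x}" by auto
  then have card: "card {y \<in> t ` {..<k}. y \<le> x} = card {j \<in> {..<k}. t j \<le> x}"
    using card_image[OF inj_on_subset[OF inj], of "{j \<in> {..<k}. t j \<le> x}"] by auto
  have mono: "t a \<le> t b" if "a \<le> b" "b < k" for a b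
    using strict_mono_onD[OF assms, of a b] that by (cases "a = b") auto
  show ?thesis
  proof
    assume "i < k \<and> t i \<le> x"
    then have "{..i} \<subseteq> {j \<in> {..<k}. t j \<le> x}" using mono by fastforce
    from card_mono[OF _ this] show "i < card {y \<in> t ` {..<k}. y \<le> x}" by (simp add: card)
  next
    assume *: "i < card {y \<in> t ` {..<k}. y \<le> x}"
    show "i < k \<and> t i \<le> x"
    proof (rule ccontr)
      assume "\<not> (i < k \<and> t i \<le> x)"
      then have "{j \<in> {..<k}. t j \<le> x} \<subseteq> {..<i}" using mono by (fastforce simp: not_less)
      from card_mono[OF _ this] * show False by (simp add: card)
    qed
  qed
qed

text \<open>
  \<open>S\<close> and \<open>T\<close> are the sets of columns with partial sum 1 before and after a row that starts in
  column \<open>a\<close>; the difference of the counts is a partial sum of that row.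
\<close>

definition row_transition :: "int \<Rightarrow> nat \<Rightarrow> int set \<Rightarrow> int set \<Rightarrow> bool" where
  "row_transition a e S T \<longleftrightarrow> finite S \<and> S \<subseteq> {..<0} \<and> (\<forall>x<a. x \<in> S \<longleftrightarrow> x \<in> T) \<and>
     (\<forall>x. card {y \<in> S. y \<le> x} \<le> card {y \<in> T. y \<le> x} \<and> card {y \<in> T. y \<le> x} \<le> card {y \<in> S. y \<le> x} + 1) \<and>
     card T = card S + e"

text \<open>\<open>S - T\<close> consists of the columns with entry -1. Column a has its lowest
  entry in this row, and it lies in both sets exactly if its sum is 1 and that entry is 0.\<close>

definition row_weight :: "'a::comm_ring_1 \<Rightarrow> 'a \<Rightarrow> int \<Rightarrow> int set \<Rightarrow> int set \<Rightarrow> 'a" where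
  "row_weight P Q a S T = Q ^ card (S - T) * (if a \<in> S \<and> a \<in> T then P else 1)"

lemma card_le_iff:
  fixes A B :: nat shows "A \<le> B \<longleftrightarrow> (\<forall>i. i < A \<longrightarrow> i < B)"
  by (meson linorder_not_less order_less_irrefl order_less_le_trans)

locale row_step =
  fixes N e k m :: nat and a :: int and t :: "nat \<Rightarrow> int"
  assumes k: "k = N + e" and e: "e \<le> 1" and strict: "strict_mono_on {..<k} t"
    and neg: "\<And>i. i < k \<Longrightarrow> t i < 0" and frozen: "\<And>i. i < k \<Longrightarrow> t i < a \<longleftrightarrow> i < m" and mk: "m \<le> k"
begin

text \<open>If the row adds no column, the last old column has no right neighbour in the new state,
  and the axis at 0 takes its place as an upper bound.\<close>

definition "t' = (if e = 0 then t(N := 0) else t)"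

lemma t'_eq: "i < k \<Longrightarrow> t' i = t i"
  using k by (auto simp: t'_def)

lemma t_less: "i < j \<Longrightarrow> j < k \<Longrightarrow> t i < t j"
  using strict_mono_onD[OF strict, of i j] by auto

lemma t'_less: "i < N \<Longrightarrow> t' i < t' (Suc i)"
  using k e neg[of i] t_less[of i "Suc i"] by (auto simp: t'_def)

text \<open>The extra condition keeps the last coordinate off the axis, which
  \<open>interlaced\<close> would permit as an end point.\<close>

definition "prev_rows = {s \<in> interlaced m N t' t. \<forall>i\<in>{m..<N}. s i < 0}"

lemma rows_strict:
  assumes "s \<in> prev_rows"
  shows "strict_mono_on {..<N} s"
proof -
  have st: "s i < s (Suc i)" if "Suc i < N" for i
  proof -
    consider "Suc i < m" | "Suc i = m" | "m \<le> i" by linarith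
    then show ?thesis
    proof cases
      case 1
      then show ?thesis using assms that t_less[of i "Suc i"] k by (auto simp: prev_rows_def interlaced_def)
    next
      case 2
      then have "s i = t i" "t' m \<le> s m" using assms that by (auto simp: prev_rows_def interlaced_def)
      moreover have "t i < t' m" using t_less[of i m] t'_eq[of m] 2 that k by simp
      ultimately show ?thesis using 2 by simp
    next
      case 3
      then show ?thesis using assms that by (auto simp: prev_rows_def interlaced_def)
    qed
  qed
  show ?thesis
  proof (rule strict_mono_onI)
    fix i j assume "i \<in> {..<N}" "j \<in> {..<N}" "i < (j :: nat)"
    then have "j < N" "i < j" by auto
    from \<open>i < j\<close> \<open>j < N\<close> show "s i < s j"
    proof (induction j rule: less_Suc_induct)
      case (1 i) then show ?case by (rule st)
    next
      case (2 i j k) then show ?case by simp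
    qed
  qed
qed

lemma rows_frozen: "s \<in> prev_rows \<Longrightarrow> i < m \<Longrightarrow> s i = t i"
  by (auto simp: prev_rows_def interlaced_def)

lemma rows_active: "s \<in> prev_rows \<Longrightarrow> m \<le> i \<Longrightarrow> i < N \<Longrightarrow> a \<le> s i"
proof -
  assume s: "s \<in> prev_rows" "m \<le> i" "i < N"
  then have "t' i \<le> s i" by (auto simp: prev_rows_def interlaced_def)
  then show ?thesis using frozen[of i] s t'_eq[of i] k by auto
qed

lemma rows_bounds: "s \<in> prev_rows \<Longrightarrow> i < N \<Longrightarrow> t i \<le> s i \<and> (Suc i < k \<longrightarrow> s i \<le> t (Suc i)) \<and> s i < 0"
proof -
  assume s: "s \<in> prev_rows" "i < N"
  show ?thesis
  proof (cases "i < m")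
    case True
    then show ?thesis using rows_frozen[OF s(1)] t_less[of i "Suc i"] neg[of i] s k by auto
  next
    case False
    then have "t' i \<le> s i" "s i \<le> t' (Suc i)" "s i < 0" using s by (auto simp: prev_rows_def interlaced_def)
    then show ?thesis using t'_eq[of i] t'_eq[of "Suc i"] s k by auto
  qed
qed

text \<open>The inequalities t_i \<le> s_i \<le> t_{i+1} say that the counting function of the new
  state exceeds that of the old one by 0 or 1.\<close>

lemma rows_transition:
  assumes s: "s \<in> prev_rows" and mN: "m \<le> N"
  shows "row_transition a e (s ` {..<N}) (t ` {..<k})"
proof -
  note strict_s = rows_strict[OF s]
  have inj: "inj_on s {..<N}" "inj_on t {..<k}"
    using strict_s strict by (auto intro: strict_mono_on_imp_inj_on)
  have "x \<in> s ` {..<N} \<longleftrightarrow> x \<in> t ` {..<k}" if "x < a" for x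
  proof
    assume "x \<in> s ` {..<N}"
    then obtain i where i: "x = s i" "i < N" by auto
    then have "i < m" using rows_active[OF s, of i] that by fastforce
    then show "x \<in> t ` {..<k}" using rows_frozen[OF s] i k by auto
  next
    assume "x \<in> t ` {..<k}"
    then obtain i where i: "x = t i" "i < k" by auto
    then have "i < m" using frozen that by auto
    then show "x \<in> s ` {..<N}" using rows_frozen[OF s, of i] i mN
      by (intro image_eqI[of _ _ i]) auto
  qed
  moreover have "card {y \<in> s ` {..<N}. y \<le> x} \<le> card {y \<in> t ` {..<k}. y \<le> x}" for x
    unfolding card_le_iff less_card_le_iff[OF strict] less_card_le_iff[OF strict_s]
    using rows_bounds[OF s] k by fastforce
  moreover have "card {y \<in> t ` {..<k}. y \<le> x} \<le> card {y \<in> s ` {..<N}. y \<le> x} + 1" for x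
    unfolding card_le_iff less_card_le_iff[OF strict]
  proof (intro allI impI)
    fix i assume i: "i < k \<and> t i \<le> x"
    show "i < card {y \<in> s ` {..<N}. y \<le> x} + 1"
    proof (cases i)
      case (Suc j)
      then have "j < N \<and> s j \<le> x" using i rows_bounds[OF s, of j] k e by force
      then have "j < card {y \<in> s ` {..<N}. y \<le> x}" unfolding less_card_le_iff[OF strict_s] .
      then show ?thesis using Suc by simp
    qed simp
  qed
  moreover have "s ` {..<N} \<subseteq> {..<0}" using rows_bounds[OF s] by auto
  moreover have "card (t ` {..<k}) = card (s ` {..<N}) + e"
    using inj k by (simp add: card_image)
  ultimately show ?thesis unfolding row_transition_def by auto
qed

text \<open>The witness enumerates \<open>S\<close> increasingly and continues with the values of
  \<open>t\<close> from N on, as \<open>interlaced\<close> prescribes. The bound m \<le> N holds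
  because every ended column already belongs to \<open>S\<close>.\<close>

lemma transition_rows:
  assumes S: "row_transition a e S (t ` {..<k})"
  shows "m \<le> N \<and> (\<exists>s\<in>prev_rows. S = s ` {..<N})"
proof -
  have fin: "finite S" and S0: "S \<subseteq> {..<0}" using S by (auto simp: row_transition_def)
  have "card (t ` {..<k}) = k" using strict by (simp add: card_image strict_mono_on_imp_inj_on)
  then have cardS: "card S = N" using S k by (simp add: row_transition_def)
  define s where "s i = (if i < N then sorted_list_of_set S ! i else t i)" for i
  have strict_s: "strict_mono_on {..<N} s"
  proof (rule strict_mono_onI)
    fix i j assume "i \<in> {..<N}" "j \<in> {..<N}" "i < j"
    then show "s i < s j"
      using sorted_wrt_nth_less[OF strict_sorted_list_of_set[of S], of i j] cardS by (simp add: s_def)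
  qed
  have Ss: "S = s ` {..<N}"
  proof -
    have "S = set (sorted_list_of_set S)" using fin by simp
    also have "\<dots> = (\<lambda>i. sorted_list_of_set S ! i) ` {..<N}"
      using cardS by (auto simp: set_conv_nth)
    finally show ?thesis by (simp add: s_def)
  qed
  have c1: "i < k \<and> t i \<le> s i" if "i < N" for i
  proof -
    have "card {y \<in> s ` {..<N}. y \<le> s i} \<le> card {y \<in> t ` {..<k}. y \<le> s i}"
      using S unfolding row_transition_def Ss by blast
    then show ?thesis
      unfolding card_le_iff less_card_le_iff[OF strict] less_card_le_iff[OF strict_s] using that by auto
  qed
  have c2: "i < N \<and> s i \<le> t (Suc i)" if "Suc i < k" for i
  proof -
    have "card {y \<in> t ` {..<k}. y \<le> t (Suc i)} \<le> card {y \<in> s ` {..<N}. y \<le> t (Suc i)} + 1"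
      using S unfolding row_transition_def Ss by blast
    moreover have "Suc i < card {y \<in> t ` {..<k}. y \<le> t (Suc i)}"
      unfolding less_card_le_iff[OF strict] using that by simp
    ultimately have "i < card {y \<in> s ` {..<N}. y \<le> t (Suc i)}" by simp
    then show ?thesis unfolding less_card_le_iff[OF strict_s] .
  qed
  have c3: "i < N \<and> s i = t i" if "i < m" for i
  proof -
    have ti: "t i < a" "i < k" using that frozen[of i] mk by auto
    have iff: "x \<in> s ` {..<N} \<longleftrightarrow> x \<in> t ` {..<k}" if "x < a" for x
      using S that unfolding row_transition_def Ss by blast
    have "{y \<in> s ` {..<N}. y \<le> t i} = {y \<in> t ` {..<k}. y \<le> t i}"
    proof (rule Collect_cong)
      fix y show "y \<in> s ` {..<N} \<and> y \<le> t i \<longleftrightarrow> y \<in> t ` {..<k} \<and> y \<le> t i"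
        using iff[of y] ti(1) by linarith
    qed
    moreover have "i < card {y \<in> t ` {..<k}. y \<le> t i}"
      unfolding less_card_le_iff[OF strict] using ti by simp
    ultimately have "i < card {y \<in> s ` {..<N}. y \<le> t i}" by simp
    then have "i < N" "s i \<le> t i" unfolding less_card_le_iff[OF strict_s] by auto
    then show ?thesis using c1[of i] by auto
  qed
  have "m \<le> N" using c3[of "m - 1"] by (cases m) auto
  moreover have "s \<in> prev_rows"
    unfolding prev_rows_def interlaced_def
  proof (intro CollectI conjI allI impI ballI)
    show "s i = t i" if "i \<notin> {m..<N}" for i
      using that c3[of i] by (cases "i < m") (auto simp: s_def)
    show neg_s: "s i < 0" if "i \<in> {m..<N}" for i
      using S0 that unfolding Ss by auto
    show "t' i \<le> s i" if "i \<in> {m..<N}" for i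
      using c1[of i] t'_eq[of i] that by auto
    show "s i \<le> t' (Suc i)" if "i \<in> {m..<N}" for i
      using c2[of i] t'_eq[of "Suc i"] neg_s[OF that] that k e by (cases "Suc i < k") (auto simp: t'_def)
    show "s i < s (Suc i)" if "m \<le> i \<and> Suc i < N" for i
      using that strict_mono_onD[OF strict_s, of i "Suc i"] by auto
  qed
  ultimately show ?thesis using Ss by blast
qed

lemma bij_betw_rows:
  assumes "m \<le> N"
  shows "bij_betw (\<lambda>s. s ` {..<N}) prev_rows {S. row_transition a e S (t ` {..<k})}"
  unfolding bij_betw_def
proof
  show "inj_on (\<lambda>s. s ` {..<N}) prev_rows"
  proof (rule inj_onI)
    fix s s' assume s: "s \<in> prev_rows" "s' \<in> prev_rows" and eq: "s ` {..<N} = s' ` {..<N}"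
    have "s i = s' i" for i
    proof (cases "i < N")
      case True
      have iff: "i < N \<and> s i \<le> x \<longleftrightarrow> i < N \<and> s' i \<le> x" for x
        unfolding less_card_le_iff[OF rows_strict[OF s(1)], symmetric] less_card_le_iff[OF rows_strict[OF s(2)], symmetric]
        by (simp only: eq)
      show ?thesis using iff[of "s i"] iff[of "s' i"] True by simp
    next
      case False
      then show ?thesis using s by (simp add: prev_rows_def interlaced_def)
    qed
    then show "s = s'" by (rule ext)
  qed
  show "(\<lambda>s. s ` {..<N}) ` prev_rows = {S. row_transition a e S (t ` {..<k})}"
    using rows_transition[OF _ assms] transition_rows by blast
qed

text \<open>As \<open>t\<close> is strictly increasing, s_i can meet the new state only in one of
  its own two bounds; a bound on the axis is never attained.\<close>

lemma rows_weight:
  assumes s: "s \<in> prev_rows"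
  shows "interlaced_weight Q m N t' s = Q ^ card (s ` {..<N} - t ` {..<k})"
proof -
  let ?D = "{i \<in> {m..<N}. \<not> (s i = t' i \<or> s i = t' (Suc i))}"
  have inj: "inj_on s {..<N}" using rows_strict[OF s] by (rule strict_mono_on_imp_inj_on)
  have iff: "s i \<in> t ` {..<k} \<longleftrightarrow> s i = t' i \<or> s i = t' (Suc i)" if i: "i \<in> {m..<N}" for i
  proof
    assume "s i \<in> t ` {..<k}"
    then obtain j where j: "s i = t j" "j < k" by auto
    have b: "t' i \<le> s i" "s i \<le> t' (Suc i)" using s i by (auto simp: prev_rows_def interlaced_def)
    have "\<not> j < i" using t_less[of j i] b j t'_eq[of i] i k by auto
    moreover have "\<not> Suc i < j" using t_less[of "Suc i" j] b j t'_eq[of "Suc i"] by auto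
    ultimately have "j = i \<or> j = Suc i" by auto
    then show "s i = t' i \<or> s i = t' (Suc i)" using j t'_eq[of j] by auto
  next
    assume *: "s i = t' i \<or> s i = t' (Suc i)"
    have "s i < 0" using s i by (auto simp: prev_rows_def)
    then have "t' (Suc i) \<noteq> s i \<or> Suc i < k" using i k e by (auto simp: t'_def split: if_splits)
    with * i k show "s i \<in> t ` {..<k}" using t'_eq[of i] t'_eq[of "Suc i"] by auto
  qed
  have "s ` {..<N} - t ` {..<k} = s ` ?D"
  proof (intro equalityI subsetI)
    fix x assume x: "x \<in> s ` {..<N} - t ` {..<k}"
    then obtain i where i: "x = s i" "i < N" by auto
    have "m \<le> i" using x i rows_frozen[OF s, of i] mk by fastforce
    then show "x \<in> s ` ?D" using i x iff[of i] by auto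
  qed (use iff in auto)
  then have "card (s ` {..<N} - t ` {..<k}) = card ?D"
    using card_image[OF inj_on_subset[OF inj], of ?D] by auto
  moreover have "interlaced_weight Q m N t' s = (\<Prod>i\<in>?D. Q)"
    unfolding interlaced_weight_def
    by (subst prod.inter_filter) (auto intro!: prod.cong)
  ultimately show ?thesis by simp
qed

lemma sum_transitions:
  assumes mN: "m \<le> N"
  shows "(\<Sum>S | row_transition a e S (t ` {..<k}). row_weight P Q a S (t ` {..<k}) * f S) =
    (\<Sum>s\<in>prev_rows. interlaced_weight Q m N t' s *
      ((if m < N \<and> m < k \<and> t m = a \<and> s m = a then P else 1) * f (s ` {..<N})))"
proof -
  have "(\<Sum>S | row_transition a e S (t ` {..<k}). row_weight P Q a S (t ` {..<k}) * f S) =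
    (\<Sum>s\<in>prev_rows. row_weight P Q a (s ` {..<N}) (t ` {..<k}) * f (s ` {..<N}))"
    by (rule sum.reindex_bij_betw[OF bij_betw_rows[OF mN], symmetric])
  also have "\<dots> = (\<Sum>s\<in>prev_rows. interlaced_weight Q m N t' s *
      ((if m < N \<and> m < k \<and> t m = a \<and> s m = a then P else 1) * f (s ` {..<N})))"
  proof (rule sum.cong[OF refl])
    fix s assume s: "s \<in> prev_rows"
    have T: "a \<in> t ` {..<k} \<longleftrightarrow> m < k \<and> t m = a"
    proof
      assume "a \<in> t ` {..<k}"
      then obtain j where j: "a = t j" "j < k" by auto
      then have "m \<le> j" using frozen[of j] by auto
      moreover have "\<not> m < j" using t_less[of m j] frozen[of m] j by auto
      ultimately show "m < k \<and> t m = a" using j by auto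
    qed auto
    have Sm: "a \<in> s ` {..<N} \<longleftrightarrow> m < N \<and> s m = a"
    proof
      assume "a \<in> s ` {..<N}"
      then obtain j where j: "a = s j" "j < N" by auto
      then have "m \<le> j" using rows_frozen[OF s, of j] frozen[of j] k by force
      moreover have "\<not> m < j"
        using strict_mono_onD[OF rows_strict[OF s], of m j] rows_active[OF s, of m] j by force
      ultimately show "m < N \<and> s m = a" using j by auto
    qed auto
    show "row_weight P Q a (s ` {..<N}) (t ` {..<k}) * f (s ` {..<N}) = interlaced_weight Q m N t' s *
      ((if m < N \<and> m < k \<and> t m = a \<and> s m = a then P else 1) * f (s ` {..<N}))"
      unfolding row_weight_def rows_weight[OF s] T Sm by auto
  qed
  finally show ?thesis .
qed

text \<open>If column a lies in both states, then coordinate m is pinned to t_m just as for an ended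
  column. The contribution of P - 1 thereby becomes a row sum with m + 1 ended columns.\<close>

lemma rows_freeze:
  assumes "m < N" "t m = a"
  shows "{s \<in> prev_rows. s m = a} = {s \<in> interlaced (Suc m) N t' t. \<forall>i\<in>{Suc m..<N}. s i < 0}"
proof (intro equalityI subsetI)
  fix s assume "s \<in> {s \<in> prev_rows. s m = a}"
  then have s: "s \<in> interlaced m N t' t" "s m = a" "\<forall>i\<in>{m..<N}. s i < 0"
    by (auto simp: prev_rows_def)
  have "s i = t i" if "i \<notin> {Suc m..<N}" for i
  proof (cases "i = m")
    case True
    then show ?thesis using s assms by simp
  next
    case False
    then have "i \<notin> {m..<N}" using that by auto
    then show ?thesis using s(1) unfolding interlaced_def by blast
  qed
  moreover have "t' i \<le> s i \<and> s i \<le> t' (Suc i)" if "i \<in> {Suc m..<N}" for i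
    using s(1) that unfolding interlaced_def by auto
  moreover have "s i < s (Suc i)" if "Suc m \<le> i" "Suc i < N" for i
    using s(1) that unfolding interlaced_def by auto
  ultimately show "s \<in> {s \<in> interlaced (Suc m) N t' t. \<forall>i\<in>{Suc m..<N}. s i < 0}"
    using s(3) unfolding interlaced_def by auto
next
  fix s assume s: "s \<in> {s \<in> interlaced (Suc m) N t' t. \<forall>i\<in>{Suc m..<N}. s i < 0}"
  have sm: "s m = a" using s assms by (auto simp: interlaced_def)
  have tm: "t' m = a" "m < k" using t'_eq[of m] assms k by auto
  have inc: "s i < s (Suc i)" if "m \<le> i" "Suc i < N" for i
  proof (cases "i = m")
    case True
    have "t' (Suc m) \<le> s (Suc m)" using s that True by (auto simp: interlaced_def)
    then show ?thesis using True sm tm t'_less[of m] assms by simp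
  next
    case False
    then show ?thesis using s that by (auto simp: interlaced_def)
  qed
  have "t' i \<le> s i \<and> s i \<le> t' (Suc i) \<and> s i < 0" if "i \<in> {m..<N}" for i
  proof (cases "i = m")
    case True
    then show ?thesis using sm tm t'_less[of m] assms neg[of m] by auto
  next
    case False
    then show ?thesis using s that by (auto simp: interlaced_def)
  qed
  then have "s \<in> prev_rows" using s inc unfolding prev_rows_def interlaced_def by auto
  then show "s \<in> {s \<in> prev_rows. s m = a}" using sm by simp
qed

end

text \<open>
  Column \<open>j\<close> is placed at \<open>j - (M + 1)\<close>, so that the axis of symmetry is at 0. In a symmetric
  trapezoid the central entries alternate \<open>1, -1, 1, \<dots>\<close>, which forces the left half of row \<open>i\<close> to
  sum to \<open>row_parity i\<close>.
\<close>

definition row_pos :: "nat \<Rightarrow> nat \<Rightarrow> int" where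
  "row_pos M i = int i - int M - 1"

definition row_parity :: "nat \<Rightarrow> nat" where
  "row_parity i = (if even i then 1 else 0)"

text \<open>The recursion runs backwards because the last state is the prescribed one: it is given
  by the 1-column vector.\<close>

fun state_weight :: "'a::comm_ring_1 \<Rightarrow> 'a \<Rightarrow> nat \<Rightarrow> nat \<Rightarrow> int set \<Rightarrow> 'a" where
  "state_weight P Q M 0 T = (if T = {} then 1 else 0)"
| "state_weight P Q M (Suc i) T =
     (\<Sum>S | row_transition (row_pos M (Suc i)) (row_parity (Suc i)) S T.
        row_weight P Q (row_pos M (Suc i)) S T * state_weight P Q M i S)"

definition row_kernel :: "'a::field_char_0 \<Rightarrow> nat \<Rightarrow> 'a mlaurent" where
  "row_kernel Q i = kernel Q (i div 2) * (if odd i then odd_factor Q (i div 2) else 1)"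

text \<open>The symbol of \<open>P_op P Q\<close>.\<close>

definition fls_pi :: "'a::field_char_0 \<Rightarrow> 'a \<Rightarrow> 'a fls" where
  "fls_pi P Q = 1 - fls_const (P - 1) * fls_kappa Q"

lemma fls_pi_subdegree:
  assumes "Q \<noteq> 0"
  shows "fls_subdegree (fls_pi P Q) = 0" "fls_pi P Q \<noteq> 0"
proof -
  have z: "fls_nth (fls_kappa Q) i = 0" if "i < 1" for i
    using fls_subdegree_kappa[OF assms] that by simp
  have "fls_nth (fls_pi P Q) 0 = 1" by (simp add: fls_pi_def z)
  moreover have "fls_nth (fls_pi P Q) i = 0" if "i < 0" for i
    using that by (simp add: fls_pi_def z)
  ultimately show "fls_subdegree (fls_pi P Q) = 0" "fls_pi P Q \<noteq> 0"
    by (auto intro!: fls_subdegree_eqI)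
qed

text \<open>The series of a column d rows after its lowest entry. For d = -c - 1 it is the symbol of
  the single-variable operators in the operator formula.\<close>

definition frozen_series :: "'a::field_char_0 \<Rightarrow> 'a \<Rightarrow> int \<Rightarrow> 'a fls" where
  "frozen_series P Q d = fls_pi P Q * (- fls_kappa Q) ^ nat d"

lemma frozen_series_regular:
  assumes "Q \<noteq> 0"
  shows "frozen_series P Q d \<noteq> 0 \<and> fls_subdegree (frozen_series P Q d) \<ge> 0"
proof -
  have nz: "(- fls_kappa Q) ^ nat d \<noteq> 0" by simp
  have "fls_subdegree ((- fls_kappa Q) ^ nat d) = int (nat d) * fls_subdegree (- fls_kappa Q)"
    by (rule fls_subdegree_pow)
  then show ?thesis
    unfolding frozen_series_def using fls_pi_subdegree[OF assms, of P] nz fls_subdegree_kappa[OF assms] by simp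
qed

text \<open>A common form of \<open>odd_row_sum\<close> and \<open>even_row_sum\<close>. Negativity
  of all coordinates reduces to that of the last one in an odd row and is automatic in an even row,
  where every upper bound is a column of the new state.\<close>

lemma row_step_sum:
  fixes z :: "nat \<Rightarrow> 'a::field_char_0 fls"
  assumes Q: "Q \<noteq> 0" and N: "N = i div 2" and e: "e = row_parity (Suc i)" and k: "k = N + e"
    and strict: "\<And>i j. i < j \<Longrightarrow> j < k \<Longrightarrow> t i < t j" and neg: "\<And>i. i < k \<Longrightarrow> t i < 0" and m: "m \<le> N"
    and z: "\<And>r. r < m \<Longrightarrow> z r \<noteq> 0 \<and> fls_subdegree (z r) \<ge> 0"
    and t': "t' = (if e = 0 then t(N := 0) else t)"
  shows "(\<Sum>s | s \<in> interlaced m N t' t \<and> (\<forall>i\<in>{m..<N}. s i < 0).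
      interlaced_weight Q m N t' s * kernel_fun N (row_kernel Q i * (\<Prod>r<m. ml_of_fls r (z r))) s) =
    kernel_fun k (row_kernel Q (Suc i) * (\<Prod>r<m. ml_of_fls r (z r * - fls_kappa Q))) t"
proof (cases "even i")
  case True
  then have ek: "e = 0" "k = N" "Suc i div 2 = N" using e N k by (auto simp: row_parity_def)
  have "{s. s \<in> interlaced m N t' t \<and> (\<forall>i\<in>{m..<N}. s i < 0)} =
    {s. s \<in> interlaced m N (t(N := 0)) t \<and> (m < N \<longrightarrow> s (N - 1) < 0)}"
  proof (rule Collect_cong)
    fix s
    have "s i < 0" if s: "s \<in> interlaced m N (t(N := 0)) t" "m < N \<longrightarrow> s (N - 1) < 0" and i: "i \<in> {m..<N}" for i
    proof (cases "Suc i = N")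
      case True
      then show ?thesis using s i by auto
    next
      case False
      have "s i \<le> (t(N := 0)) (Suc i)" using s(1) i unfolding interlaced_def by blast
      then show ?thesis using False neg[of "Suc i"] ek i by auto
    qed
    then show "s \<in> interlaced m N t' t \<and> (\<forall>i\<in>{m..<N}. s i < 0) \<longleftrightarrow>
      s \<in> interlaced m N (t(N := 0)) t \<and> (m < N \<longrightarrow> s (N - 1) < 0)"
      using t' ek by auto
  qed
  moreover have "row_kernel Q i = kernel Q N" "row_kernel Q (Suc i) = kernel Q N * odd_factor Q N"
    using True ek N by (auto simp: row_kernel_def)
  ultimately show ?thesis
    using odd_row_sum[OF m, of t Q z] strict neg ek t' by (simp add: mult.assoc)
next
  case False
  then have ek: "e = 1" "k = Suc N" "Suc i div 2 = Suc N" using e N k by (auto simp: row_parity_def elim: oddE)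
  have "{s. s \<in> interlaced m N t' t \<and> (\<forall>i\<in>{m..<N}. s i < 0)} = interlaced m N t t"
  proof -
    have "s i < 0" if s: "s \<in> interlaced m N t t" and i: "i \<in> {m..<N}" for s i
    proof -
      have "s i \<le> t (Suc i)" using s i by (auto simp: interlaced_def)
      then show ?thesis using neg[of "Suc i"] i ek by auto
    qed
    then show ?thesis using t' ek by auto
  qed
  moreover have "row_kernel Q i = kernel Q N * odd_factor Q N" "row_kernel Q (Suc i) = kernel Q (Suc N)"
    using False ek N by (auto simp: row_kernel_def)
  ultimately show ?thesis
    using even_row_sum[OF Q m, of t z] strict z ek t' by simp
qed

lemma kernel_fun_pi:
  "kernel_fun k (K * Z) t + (P - 1) * kernel_fun k (K * (Z * ml_of_fls m (- fls_kappa Q))) t =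
   kernel_fun k (K * (Z * ml_of_fls m (fls_pi P Q))) t"
proof -
  have "ml_of_fls m (fls_pi P Q) = 1 + ml_const (P - 1) * ml_of_fls m (- fls_kappa Q)"
    by (simp add: fls_pi_def ml_of_fls_diff ml_of_fls_mult ml_of_fls_const ml_of_fls_uminus)
  then have "K * (Z * ml_of_fls m (fls_pi P Q)) = K * Z + ml_const (P - 1) * (K * (Z * ml_of_fls m (- fls_kappa Q)))"
    by (simp add: algebra_simps)
  then show ?thesis by (simp only: kernel_fun_add kernel_fun_const)
qed

text \<open>Induction over the rows for arbitrary \<open>t\<close>. An ended column keeps its
  position, and so its power of 1 + x_r, while its series gains one factor
  \<open>- fls_kappa Q\<close> per row. The columns that have ended after row i are those at
  positions up to \<open>row_pos M i\<close>.\<close>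

theorem state_weight_eq:
  fixes P Q :: "'a::field_char_0"
  assumes Q: "Q \<noteq> 0" and "strict_mono_on {..<i div 2} t" and "\<And>r. r < i div 2 \<Longrightarrow> t r < 0"
  shows "state_weight P Q M i (t ` {..<i div 2}) = kernel_fun (i div 2) (row_kernel Q i *
     (\<Prod>r<card {y \<in> t ` {..<i div 2}. y \<le> row_pos M i}. ml_of_fls r (frozen_series P Q (row_pos M i - t r)))) t"
  using assms(2,3)
proof (induction i arbitrary: t)
  case 0
  then show ?case by (simp add: kernel_fun_def ml_monom_def row_kernel_def kernel_def index_pairs_def)
next
  case (Suc i)
  define N where "N = i div 2"
  define k where "k = Suc i div 2"
  define e where "e = row_parity (Suc i)"
  define a where "a = row_pos M (Suc i)"
  define T where "T = t ` {..<k}"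
  define m where "m = card {y \<in> T. y \<le> a - 1}"
  have strict: "strict_mono_on {..<k} t" using Suc.prems k_def by simp
  have neg: "\<And>r. r < k \<Longrightarrow> t r < 0" using Suc.prems k_def by simp
  have ke: "k = N + e" "e \<le> 1"
    unfolding k_def N_def e_def row_parity_def by (auto elim!: oddE evenE)
  have pos: "row_pos M i = a - 1" by (simp add: a_def row_pos_def)
  have mm: "r < m \<longleftrightarrow> r < k \<and> t r \<le> a - 1" for r
    unfolding m_def T_def by (rule less_card_le_iff[OF strict])
  interpret row_step N e k m a t
  proof
    show "k = N + e" "e \<le> 1" by (rule ke)+
    show "strict_mono_on {..<k} t" by (rule strict)
    show "t r < 0" if "r < k" for r using neg that .
    show "t r < a \<longleftrightarrow> r < m" if "r < k" for r using mm that by auto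
    show "m \<le> k" using mm[of k] by auto
  qed
  define z where "z r = frozen_series P Q (a - 1 - t r)" for r
  have z: "z r \<noteq> 0 \<and> fls_subdegree (z r) \<ge> 0" for r
    unfolding z_def by (rule frozen_series_regular[OF Q])
  have z_next: "z r * - fls_kappa Q = frozen_series P Q (a - t r)" if "r < m" for r
  proof -
    have "t r \<le> a - 1" using mm[of r] that by simp
    then have "nat (a - t r) = Suc (nat (a - 1 - t r))" by simp
    then show ?thesis by (simp only: z_def frozen_series_def power_Suc2 mult.assoc)
  qed
  have sub1: "fls_subdegree (x * - fls_kappa Q) \<ge> 1" if "x \<noteq> 0 \<and> fls_subdegree x \<ge> 0" for x
    using that fls_subdegree_kappa[OF Q] by (simp del: mult_minus_right)
  let ?K = "row_kernel Q (Suc i)"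
  define Z where "Z = (\<Prod>r<m. ml_of_fls r (frozen_series P Q (a - t r)))"
  have ZZ: "(\<Prod>r<m. ml_of_fls r (z r * - fls_kappa Q)) = Z"
    unfolding Z_def by (rule prod.cong) (simp_all only: z_next lessThan_iff)
  define f where "f s = kernel_fun N (row_kernel Q i * (\<Prod>r<m. ml_of_fls r (z r))) s" for s
  have IH: "state_weight P Q M i (s ` {..<N}) = f s" if s: "s \<in> prev_rows" and mN: "m \<le> N" for s
  proof -
    have "{y \<in> s ` {..<N}. y \<le> a - 1} = {y \<in> T. y \<le> a - 1}"
    proof (rule Collect_cong)
      fix y
      have "y < a \<longrightarrow> (y \<in> s ` {..<N} \<longleftrightarrow> y \<in> T)"
        using rows_transition[OF s mN] unfolding row_transition_def T_def by blast
      then show "y \<in> s ` {..<N} \<and> y \<le> a - 1 \<longleftrightarrow> y \<in> T \<and> y \<le> a - 1" by auto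
    qed
    then have "card {y \<in> s ` {..<N}. y \<le> a - 1} = m" by (simp add: m_def)
    then have "state_weight P Q M i (s ` {..<N}) =
      kernel_fun N (row_kernel Q i * (\<Prod>r<m. ml_of_fls r (frozen_series P Q (a - 1 - s r)))) s"
      using Suc.IH[of s] rows_strict[OF s] rows_bounds[OF s] unfolding pos N_def by auto
    also have "(\<Prod>r<m. ml_of_fls r (frozen_series P Q (a - 1 - s r))) = (\<Prod>r<m. ml_of_fls r (z r))"
      using rows_frozen[OF s] by (simp add: z_def)
    finally show ?thesis by (simp add: f_def)
  qed
  have total: "(\<Sum>s\<in>prev_rows. interlaced_weight Q m N t' s * f s) = kernel_fun k (?K * Z) t" if mN: "m \<le> N"
    unfolding f_def prev_rows_def ZZ[symmetric]
    by (rule row_step_sum[OF Q N_def e_def ke(1) _ neg mN z]) (auto simp: t'_def intro: t_less)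
  have lhs: "state_weight P Q M (Suc i) T =
    (\<Sum>S | row_transition a e S T. row_weight P Q a S T * state_weight P Q M i S)"
    by (simp add: a_def e_def)
  have main: "state_weight P Q M (Suc i) T = kernel_fun k (?K *
     (\<Prod>r<card {y \<in> T. y \<le> a}. ml_of_fls r (frozen_series P Q (a - t r)))) t"
  \<comment> \<open>If more columns have ended than the old state can contain, there is no
    transition, and the constant term vanishes by \<open>even_row_sum_frozen\<close>.\<close>
  proof (cases "m \<le> N")
    case False
    then have mk': "m = k" "e = 1" "k = Suc N" using mk ke by auto
    have "{S. row_transition a e S T} = {}" using transition_rows False unfolding T_def by blast
    moreover have "kernel_fun k (?K * (\<Prod>r<card {y \<in> T. y \<le> a}. ml_of_fls r (frozen_series P Q (a - t r)))) t = 0"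
    proof -
      have "{y \<in> T. y \<le> a} = {y \<in> T. y \<le> a - 1}"
        unfolding T_def using mm mk' by fastforce
      then have c: "card {y \<in> T. y \<le> a} = Suc N" using mk' by (simp add: m_def)
      have "even (Suc i)" using mk' by (auto simp: e_def row_parity_def split: if_splits)
      then have "?K = kernel Q (Suc N)" using mk' by (simp add: row_kernel_def k_def)
      moreover have "fls_subdegree (frozen_series P Q (a - t r)) \<ge> 1" if "r \<le> N" for r
      proof -
        have "r < m" using that mk' by simp
        from sub1[OF z[of r]] show ?thesis unfolding z_next[OF \<open>r < m\<close>] .
      qed
      ultimately show ?thesis
        unfolding c mk'(3) by (simp only: even_row_sum_frozen)
    qed
    ultimately show ?thesis unfolding lhs by simp
  next
    case mN: True
    have "state_weight P Q M (Suc i) T = (\<Sum>s\<in>prev_rows. interlaced_weight Q m N t' s *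
      ((if m < N \<and> m < k \<and> t m = a \<and> s m = a then P else 1) * f s))"
      unfolding lhs unfolding T_def sum_transitions[OF mN]
      by (rule sum.cong[OF refl]) (simp only: IH[OF _ mN])
    also have "\<dots> = (\<Sum>s\<in>prev_rows. interlaced_weight Q m N t' s * f s) +
      (P - 1) * (\<Sum>s\<in>prev_rows. if m < N \<and> m < k \<and> t m = a \<and> s m = a then interlaced_weight Q m N t' s * f s else 0)"
      unfolding sum_distrib_left sum.distrib[symmetric]
      by (rule sum.cong) (auto simp: algebra_simps)
    finally have sw: "state_weight P Q M (Suc i) T = kernel_fun k (?K * Z) t +
      (P - 1) * (\<Sum>s\<in>prev_rows. if m < N \<and> m < k \<and> t m = a \<and> s m = a then interlaced_weight Q m N t' s * f s else 0)"
      unfolding total[OF mN] .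
    show ?thesis
    proof (cases "m < k \<and> t m = a")
      case False
      have "{y \<in> T. y \<le> a} = {y \<in> T. y \<le> a - 1}"
      proof -
        have "r < m" if "r < k" "t r \<le> a" for r
        proof (rule ccontr)
          assume "\<not> r < m"
          then have "t r = a" "m \<le> r" using that mm[of r] by auto
          moreover have "m < k" using \<open>m \<le> r\<close> that by simp
          ultimately have "m < r" using False by (cases "m = r") auto
          then have "t m < a" using t_less[of m r] that by auto
          then show False using mm[of m] \<open>m < k\<close> by auto
        qed
        then show ?thesis unfolding T_def using mm by fastforce
      qed
      then have "card {y \<in> T. y \<le> a} = m" by (simp add: m_def)
      moreover have "(\<Sum>s\<in>prev_rows. if m < N \<and> m < k \<and> t m = a \<and> s m = a then interlaced_weight Q m N t' s * f s else 0) = 0"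
        using False by (intro sum.neutral) auto
      ultimately show ?thesis unfolding sw Z_def by simp
    next
      case True
      have "{y \<in> T. y \<le> a} = insert a {y \<in> T. y \<le> a - 1}" using True unfolding T_def by force
      moreover have "finite {y \<in> T. y \<le> a - 1}" unfolding T_def by simp
      ultimately have c: "card {y \<in> T. y \<le> a} = Suc m" by (simp add: m_def)
      \<comment> \<open>Column a counts as already ended, with the series 1 so far; the row sum then
        supplies exactly one factor \<open>- fls_kappa Q\<close> in x_m.\<close>
      define z' where "z' = z(m := 1)"
      have z': "z' r \<noteq> 0 \<and> fls_subdegree (z' r) \<ge> 0" for r using z[of r] by (simp add: z'_def)
      have Z1: "(\<Prod>r<Suc m. ml_of_fls r (z' r)) = (\<Prod>r<m. ml_of_fls r (z r))"
        by (simp add: z'_def)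
      have Z2: "(\<Prod>r<Suc m. ml_of_fls r (z' r * - fls_kappa Q)) = Z * ml_of_fls m (- fls_kappa Q)"
        unfolding ZZ[symmetric] by (simp add: z'_def)
      have "(\<Sum>s\<in>prev_rows. if m < N \<and> m < k \<and> t m = a \<and> s m = a then interlaced_weight Q m N t' s * f s else 0) =
        kernel_fun k (?K * (Z * ml_of_fls m (- fls_kappa Q))) t"
      \<comment> \<open>For m = N the old state has no coordinate m that could lie at a, and all N +
        1 series have a zero, so both sides are 0.\<close>
      proof (cases "m < N")
        case False
        then have mk': "m = N" "e = 1" "k = Suc N" using mN ke True by auto
        have "even (Suc i)" using mk' by (auto simp: e_def row_parity_def split: if_splits)
        then have "?K = kernel Q (Suc N)" using mk' by (simp add: row_kernel_def k_def)
        moreover have "fls_subdegree (z' r * - fls_kappa Q) \<ge> 1" for r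
          by (rule sub1[OF z'])
        ultimately have "kernel_fun k (?K * (Z * ml_of_fls m (- fls_kappa Q))) t = 0"
          unfolding Z2[symmetric] unfolding mk'(1,3) by (simp only: even_row_sum_frozen)
        then show ?thesis using False by simp
      next
        case mN': True
        have fin: "finite prev_rows"
          unfolding prev_rows_def by (rule finite_subset[OF _ finite_interlaced[OF mN]]) auto
        have "(\<Sum>s\<in>prev_rows. if m < N \<and> m < k \<and> t m = a \<and> s m = a then interlaced_weight Q m N t' s * f s else 0) =
          (\<Sum>s\<in>{s \<in> prev_rows. s m = a}. interlaced_weight Q m N t' s * f s)"
          using True mN' fin by (simp add: sum.inter_filter)
        also have "\<dots> = (\<Sum>s | s \<in> interlaced (Suc m) N t' t \<and> (\<forall>i\<in>{Suc m..<N}. s i < 0).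
            interlaced_weight Q (Suc m) N t' s * kernel_fun N (row_kernel Q i * (\<Prod>r<Suc m. ml_of_fls r (z' r))) s)"
        proof (rule sum.cong)
          show "{s \<in> prev_rows. s m = a} = {s. s \<in> interlaced (Suc m) N t' t \<and> (\<forall>i\<in>{Suc m..<N}. s i < 0)}"
            using rows_freeze[OF mN'] True by auto
          fix s assume "s \<in> {s. s \<in> interlaced (Suc m) N t' t \<and> (\<forall>i\<in>{Suc m..<N}. s i < 0)}"
          then have "s m = t' m" using True t'_eq[of m] by (auto simp: interlaced_def)
          then have "interlaced_weight Q m N t' s = interlaced_weight Q (Suc m) N t' s"
            unfolding interlaced_weight_def using mN' by (subst prod.atLeast_Suc_lessThan) auto
          then show "interlaced_weight Q m N t' s * f s = interlaced_weight Q (Suc m) N t' s *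
              kernel_fun N (row_kernel Q i * (\<Prod>r<Suc m. ml_of_fls r (z' r))) s"
            by (simp only: f_def Z1)
        qed
        also have "\<dots> = kernel_fun k (?K * (\<Prod>r<Suc m. ml_of_fls r (z' r * - fls_kappa Q))) t"
          by (rule row_step_sum[OF Q N_def e_def ke(1) _ neg _ z']) (use mN' in \<open>auto simp: t'_def intro: t_less\<close>)
        finally show ?thesis unfolding Z2 .
      qed
      then have "state_weight P Q M (Suc i) T = kernel_fun k (?K * (Z * ml_of_fls m (fls_pi P Q))) t"
        unfolding sw by (simp only: kernel_fun_pi)
      also have "Z * ml_of_fls m (fls_pi P Q) = (\<Prod>r<Suc m. ml_of_fls r (frozen_series P Q (a - t r)))"
        using True by (simp add: Z_def frozen_series_def)
      finally show ?thesis unfolding c .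
    qed
  qed
  then show ?case unfolding T_def k_def a_def .
qed

subsection \<open>Alternating signs and partial sums\<close>

text \<open>Arrays vanish outside the index set, so the sign conditions on a row or a column can be
  stated for functions on all natural numbers.\<close>

definition alternating_from_one :: "(nat \<Rightarrow> int) \<Rightarrow> bool" where
  "alternating_from_one f \<longleftrightarrow> (\<forall>i. f i \<in> {-1, 0, 1}) \<and>
     (\<forall>i j. i < j \<and> f i \<noteq> 0 \<and> f j \<noteq> 0 \<and> (\<forall>k. i < k \<and> k < j \<longrightarrow> f k = 0) \<longrightarrow> f j = - f i) \<and>
     (\<forall>i. f i \<noteq> 0 \<and> (\<forall>k<i. f k = 0) \<longrightarrow> f i = 1)"

text \<open>The induction needs to know the last nonzero entry as well: the partial sum is 1 exactly
  if that entry is 1.\<close>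

lemma partial_sum_alternating:
  assumes "alternating_from_one f"
  shows "(\<Sum>k\<le>i. f k) = 0 \<and> ((\<forall>k\<le>i. f k = 0) \<or> (\<exists>k\<le>i. f k = -1 \<and> (\<forall>k'. k < k' \<and> k' \<le> i \<longrightarrow> f k' = 0))) \<or>
    (\<Sum>k\<le>i. f k) = 1 \<and> (\<exists>k\<le>i. f k = 1 \<and> (\<forall>k'. k < k' \<and> k' \<le> i \<longrightarrow> f k' = 0))"
proof (induction i)
  case 0
  have "f 0 \<noteq> 0 \<longrightarrow> f 0 = 1" using assms unfolding alternating_from_one_def by (metis less_nat_zero_code)
  then show ?case by (cases "f 0 = 0") auto
next
  case (Suc i)
  show ?case
  proof (cases "f (Suc i) = 0")
    case True
    then have e1: "(\<Sum>k\<le>Suc i. f k) = (\<Sum>k\<le>i. f k)" by simp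
    have e2: "(\<forall>k\<le>i. f k = 0) \<longleftrightarrow> (\<forall>k\<le>Suc i. f k = 0)" using True by (auto simp: le_Suc_eq)
    have e3: "(\<exists>k\<le>i. f k = v \<and> (\<forall>k'. k < k' \<and> k' \<le> i \<longrightarrow> f k' = 0)) \<longrightarrow>
        (\<exists>k\<le>Suc i. f k = v \<and> (\<forall>k'. k < k' \<and> k' \<le> Suc i \<longrightarrow> f k' = 0))" for v
      using True by (metis le_Suc_eq)
    show ?thesis unfolding e1 using Suc.IH e2 e3[of 1] e3[of "- 1"] by blast
  next
    case False
    have last: "f (Suc i) = v \<Longrightarrow> \<exists>k\<le>Suc i. f k = v \<and> (\<forall>k'. k < k' \<and> k' \<le> Suc i \<longrightarrow> f k' = 0)" for v
      by (rule exI[of _ "Suc i"]) auto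
    have alt: "f (Suc i) = - f k" if "k \<le> i" "f k \<noteq> 0" "\<forall>k'. k < k' \<and> k' \<le> i \<longrightarrow> f k' = 0" for k
      using assms that False unfolding alternating_from_one_def by (metis le_imp_less_Suc less_Suc_eq_le)
    from Suc.IH consider "(\<Sum>k\<le>i. f k) = 0" "\<forall>k\<le>i. f k = 0"
      | k where "(\<Sum>k\<le>i. f k) = 0" "k \<le> i" "f k = -1" "\<forall>k'. k < k' \<and> k' \<le> i \<longrightarrow> f k' = 0"
      | k where "(\<Sum>k\<le>i. f k) = 1" "k \<le> i" "f k = 1" "\<forall>k'. k < k' \<and> k' \<le> i \<longrightarrow> f k' = 0"
      by blast
    then show ?thesis
    proof cases
      case 1
      then have "f (Suc i) = 1" using assms False unfolding alternating_from_one_def by (metis less_Suc_eq_le)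
      then show ?thesis using 1 last by simp
    next
      case 2
      then have "f (Suc i) = 1" using alt[of k] by simp
      then show ?thesis using 2 last by simp
    next
      case 3
      then have "f (Suc i) = -1" using alt[of k] by simp
      then show ?thesis using 3 last by simp
    qed
  qed
qed

text \<open>For the converse, the entries are the steps of a sequence with values 0 and 1 that
  starts at 0, so up and down steps alternate, beginning with an up step.\<close>

lemma alternating_iff_partial_sums:
  "alternating_from_one f \<longleftrightarrow> (\<forall>i. (\<Sum>k\<le>i. f k) \<in> {0, 1})"
proof
  assume "alternating_from_one f"
  then show "\<forall>i. (\<Sum>k\<le>i. f k) \<in> {0, 1}" using partial_sum_alternating by blast
next
  assume S: "\<forall>i. (\<Sum>k\<le>i. f k) \<in> {0, 1}"
  define s where "s i = (\<Sum>k<i. f k)" for i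
  have s01: "s i = 0 \<or> s i = 1" for i
  proof (cases i)
    case (Suc j)
    have "s i = (\<Sum>k\<le>j. f k)" by (simp add: s_def Suc lessThan_Suc_atMost)
    then show ?thesis using S by auto
  qed (simp add: s_def)
  have f: "f i = s (Suc i) - s i" for i by (simp add: s_def)
  have const: "s j = s (Suc i)" if "i < j" "\<forall>k. i < k \<and> k < j \<longrightarrow> f k = 0" for i j
    using that
  proof (induction j)
    case (Suc j)
    show ?case
    proof (cases "i = j")
      case False
      then have "s j = s (Suc i)" "f j = 0" using Suc by auto
      then show ?thesis using f[of j] by simp
    qed simp
  qed simp
  have zero: "s j = 0" if "\<forall>k<j. f k = 0" for j using that by (simp add: s_def)
  show "alternating_from_one f"
    unfolding alternating_from_one_def
  proof (intro conjI allI impI)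
    fix i show "f i \<in> {-1, 0, 1}" using f[of i] s01[of i] s01[of "Suc i"] by auto
  next
    fix i j assume *: "i < j \<and> f i \<noteq> 0 \<and> f j \<noteq> 0 \<and> (\<forall>k. i < k \<and> k < j \<longrightarrow> f k = 0)"
    then have "s j = s (Suc i)" using const by blast
    then show "f j = - f i" using * f[of i] f[of j] s01[of i] s01[of "Suc i"] s01[of "Suc j"] by auto
  next
    fix i assume *: "f i \<noteq> 0 \<and> (\<forall>k<i. f k = 0)"
    then show "f i = 1" using zero[of i] f[of i] s01[of "Suc i"] by auto
  qed
qed

text \<open>If the first nonzero entry were -1, the negated sequence would alternate starting from
  1, and no partial sum of \<open>f\<close> could be positive.\<close>

lemma alternating_sum_one:
  assumes ent: "\<forall>i. f i \<in> {-1, 0, 1 :: int}"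
    and alt: "\<forall>i j. i < j \<and> f i \<noteq> 0 \<and> f j \<noteq> 0 \<and> (\<forall>k. i < k \<and> k < j \<longrightarrow> f k = 0) \<longrightarrow> f j = - f i"
    and sum: "(\<Sum>k\<le>n. f k) = 1"
  shows "alternating_from_one f"
proof (rule ccontr)
  assume "\<not> alternating_from_one f"
  then obtain i where i: "f i \<noteq> 0" "\<forall>k<i. f k = 0" "f i \<noteq> 1"
    using ent alt unfolding alternating_from_one_def by blast
  then have fi: "f i = -1" using ent by blast
  have "alternating_from_one (\<lambda>k. - f k)"
    unfolding alternating_from_one_def
  proof (intro conjI allI impI)
    fix j show "- f j \<in> {-1, 0, 1}" using ent[rule_format, of j] by auto
  next
    fix k j assume "k < j \<and> - f k \<noteq> 0 \<and> - f j \<noteq> 0 \<and> (\<forall>l. k < l \<and> l < j \<longrightarrow> - f l = 0)"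
    then have "f j = - f k" using alt by simp
    then show "- f j = - (- f k)" by simp
  next
    fix j assume j: "- f j \<noteq> 0 \<and> (\<forall>k<j. - f k = 0)"
    then have "i = j" using i by (metis linorder_neqE_nat neg_equal_0_iff_equal)
    then show "- f j = 1" using fi by simp
  qed
  then have "(\<Sum>k\<le>n. - f k) \<in> {0, 1}" unfolding alternating_iff_partial_sums by blast
  then show False using sum by (simp add: sum_negf)
qed

text \<open>For columns the leading entry 1 is part of the definition; for rows it follows from the
  row sum 1 by \<open>alternating_sum_one\<close>.\<close>

lemma alternating_sign_trapezoid_iff:
  "alternating_sign_trapezoid n l a \<longleftrightarrow>
     (\<forall>i j. (i, j) \<notin> ast_index n l \<longrightarrow> a i j = 0) \<and>
     (\<forall>i j. (\<Sum>k\<le>j. a i k) \<in> {0, 1}) \<and> (\<forall>i j. (\<Sum>k\<le>i. a k j) \<in> {0, 1}) \<and>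
     (\<forall>i\<in>{1..n}. row_sum n l a i = 1) \<and> (\<Sum>j = n + 1..n + l - 2. col_sum n l a j) = 0"
    (is "?L \<longleftrightarrow> ?zero \<and> ?row \<and> ?col \<and> ?sum \<and> ?mid")
proof
  assume L: ?L
  then have z: ?zero and s: ?sum and m: ?mid unfolding alternating_sign_trapezoid_def by blast+
  have nz: "(i, j) \<in> ast_index n l" if "a i j \<noteq> 0" for i j using z that by blast
  have ent: "a i j \<in> {-1, 0, 1}" for i j
    using L z unfolding alternating_sign_trapezoid_def by (cases "(i, j) \<in> ast_index n l") auto
  note L' = L[unfolded alternating_sign_trapezoid_def, THEN conjunct2, THEN conjunct2]
  note Lr = L'[THEN conjunct1] and Lc = L'[THEN conjunct2, THEN conjunct1]
    and Lt = L'[THEN conjunct2, THEN conjunct2, THEN conjunct1]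
  have alt_r: "a i j' = - a i j" if "j < j'" "a i j \<noteq> 0" "a i j' \<noteq> 0" "\<forall>k. j < k \<and> k < j' \<longrightarrow> a i k = 0" for i j j'
    using Lr[rule_format, of i j j'] that nz by blast
  have alt_c: "a i' j = - a i j" if "i < i'" "a i j \<noteq> 0" "a i' j \<noteq> 0" "\<forall>k. i < k \<and> k < i' \<longrightarrow> a k j = 0" for i i' j
    using Lc[rule_format, of i j i'] that nz by blast
  have top: "a i j = 1" if "a i j \<noteq> 0" "\<forall>k<i. a k j = 0" for i j
    using Lt nz[OF that(1)] that by fastforce
  have "alternating_from_one (\<lambda>i. a i j)" for j
    unfolding alternating_from_one_def using ent alt_c top by blast
  then have ?col unfolding alternating_iff_partial_sums by blast
  moreover have "alternating_from_one (a i)" for i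
  proof (cases "i \<in> {1..n}")
    case True
    have "row_sum n l a i = (\<Sum>k\<le>2 * n + l. a i k)"
      unfolding row_sum_def by (rule sum.mono_neutral_left) (use z in \<open>auto simp: ast_index_def\<close>)
    then have "(\<Sum>k\<le>2 * n + l. a i k) = 1" using s True by simp
    then show ?thesis by (intro alternating_sum_one) (use ent alt_r in blast)+
  next
    case False
    then have "a i j = 0" for j using z by (auto simp: ast_index_def)
    then show ?thesis by (simp add: alternating_from_one_def)
  qed
  then have ?row unfolding alternating_iff_partial_sums by blast
  ultimately show "?zero \<and> ?row \<and> ?col \<and> ?sum \<and> ?mid" using z s m by blast
next
  assume R: "?zero \<and> ?row \<and> ?col \<and> ?sum \<and> ?mid"
  then have r: "alternating_from_one (a i)" and c: "alternating_from_one (\<lambda>i. a i j)" for i j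
    unfolding alternating_iff_partial_sums by blast+
  have z: ?zero using R by blast
  have topc: "a i j = 1" if "a i j \<noteq> 0" "\<forall>k. (k, j) \<in> ast_index n l \<and> k < i \<longrightarrow> a k j = 0" for i j
  proof -
    have "\<forall>k<i. a k j = 0" using that z by blast
    then show ?thesis using c[of j] that unfolding alternating_from_one_def by blast
  qed
  show ?L
    unfolding alternating_sign_trapezoid_def
  proof (intro conjI)
    show ?zero ?sum ?mid using R by blast+
    show "\<forall>(i, j)\<in>ast_index n l. a i j \<in> {-1, 0, 1}"
      using r unfolding alternating_from_one_def by blast
    have "a i j' = - a i j" if "j < j' \<and> a i j \<noteq> 0 \<and> a i j' \<noteq> 0 \<and> (\<forall>k. j < k \<and> k < j' \<longrightarrow> a i k = 0)" for i j j'
      using r[of i] that unfolding alternating_from_one_def by blast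
    then show "\<forall>i j j'. (i, j) \<in> ast_index n l \<and> (i, j') \<in> ast_index n l \<and> j < j' \<and>
        a i j \<noteq> 0 \<and> a i j' \<noteq> 0 \<and> (\<forall>k. j < k \<and> k < j' \<longrightarrow> a i k = 0) \<longrightarrow> a i j' = - a i j"
      by simp
    have "a i' j = - a i j" if "i < i' \<and> a i j \<noteq> 0 \<and> a i' j \<noteq> 0 \<and> (\<forall>k. i < k \<and> k < i' \<longrightarrow> a k j = 0)" for i i' j
      using c[of j] that unfolding alternating_from_one_def by blast
    then show "\<forall>i i' j. (i, j) \<in> ast_index n l \<and> (i', j) \<in> ast_index n l \<and> i < i' \<and>
        a i j \<noteq> 0 \<and> a i' j \<noteq> 0 \<and> (\<forall>k. i < k \<and> k < i' \<longrightarrow> a k j = 0) \<longrightarrow> a i' j = - a i j"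
      by simp
    show "\<forall>(i, j)\<in>ast_index n l. a i j \<noteq> 0 \<and>
        (\<forall>k. (k, j) \<in> ast_index n l \<and> k < i \<longrightarrow> a k j = 0) \<longrightarrow> a i j = 1"
      using topc by blast
  qed
qed


subsection \<open>Paths of states\<close>

text \<open>The value \<open>{}\<close> beyond n makes every path a single function, so that paths
  correspond bijectively to trapezoids.\<close>

definition state_paths :: "nat \<Rightarrow> nat \<Rightarrow> int set \<Rightarrow> (nat \<Rightarrow> int set) set" where
  "state_paths M n T = {\<sigma>. \<sigma> 0 = {} \<and> \<sigma> n = T \<and> (\<forall>i>n. \<sigma> i = {}) \<and>
     (\<forall>i<n. row_transition (row_pos M (Suc i)) (row_parity (Suc i)) (\<sigma> i) (\<sigma> (Suc i)))}"

lemma finite_row_transition: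
  assumes "finite T"
  shows "finite {S. row_transition a e S T}"
proof (rule finite_subset)
  show "{S. row_transition a e S T} \<subseteq> Pow (T \<union> {a..<0})"
    unfolding row_transition_def by (auto simp: not_le)
  show "finite (Pow (T \<union> {a..<0}))" using assms by simp
qed

lemma state_paths_Suc:
  "state_paths M (Suc n) T =
    (\<Union>S\<in>{S. row_transition (row_pos M (Suc n)) (row_parity (Suc n)) S T}. (\<lambda>\<sigma>. \<sigma>(Suc n := T)) ` state_paths M n S)"
    (is "?L = ?R")
proof (intro equalityI subsetI)
  fix \<sigma> assume \<sigma>: "\<sigma> \<in> ?L"
  define \<sigma>' where "\<sigma>' = \<sigma>(Suc n := {})"
  have "\<sigma>' \<in> state_paths M n (\<sigma> n)" using \<sigma> unfolding state_paths_def \<sigma>'_def by auto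
  moreover have "\<sigma> = \<sigma>'(Suc n := T)" using \<sigma> unfolding state_paths_def \<sigma>'_def by auto
  moreover have "row_transition (row_pos M (Suc n)) (row_parity (Suc n)) (\<sigma> n) T"
    using \<sigma> unfolding state_paths_def by auto
  ultimately show "\<sigma> \<in> ?R" by blast
next
  fix \<sigma> assume "\<sigma> \<in> ?R"
  then obtain S \<sigma>' where S: "row_transition (row_pos M (Suc n)) (row_parity (Suc n)) S T"
    "\<sigma>' \<in> state_paths M n S" "\<sigma> = \<sigma>'(Suc n := T)" by blast
  then show "\<sigma> \<in> ?L" unfolding state_paths_def by (auto simp: less_Suc_eq)
qed

lemma finite_state_paths: "finite T \<Longrightarrow> finite (state_paths M n T)"
proof (induction n arbitrary: T)
  case 0
  have "state_paths M 0 T \<subseteq> {\<lambda>_. {}}"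
    by (auto simp: state_paths_def fun_eq_iff) (metis empty_iff not_gr_zero)+
  then show ?case by (rule finite_subset) simp
next
  case (Suc n)
  have "finite S" if "row_transition a e S T" for a e S using that by (simp add: row_transition_def)
  then show ?case unfolding state_paths_Suc
    using Suc.IH finite_row_transition[OF Suc.prems] by (intro finite_UN_I finite_imageI) auto
qed

lemma sum_state_paths:
  assumes "finite T"
  shows "(\<Sum>\<sigma>\<in>state_paths M n T. \<Prod>i<n. row_weight P Q (row_pos M (Suc i)) (\<sigma> i) (\<sigma> (Suc i))) = state_weight P Q M n T"
  using assms
proof (induction n arbitrary: T)
  case 0
  have "state_paths M 0 T = (if T = {} then {\<lambda>_. {}} else {})"
    by (auto simp: state_paths_def fun_eq_iff) (metis empty_iff not_gr_zero)+
  then show ?case by simp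
next
  case (Suc n)
  let ?w = "\<lambda>n \<sigma>. \<Prod>i<n. row_weight P Q (row_pos M (Suc i)) (\<sigma> i) (\<sigma> (Suc i))"
  let ?S = "{S. row_transition (row_pos M (Suc n)) (row_parity (Suc n)) S T}"
  have fin: "finite S" if "S \<in> ?S" for S using that by (simp add: row_transition_def)
  have val: "\<sigma> n = S" if "\<sigma> \<in> (\<lambda>\<sigma>. \<sigma>(Suc n := T)) ` state_paths M n S" for \<sigma> S
    using that by (auto simp: state_paths_def)
  have "(\<Sum>\<sigma>\<in>state_paths M (Suc n) T. ?w (Suc n) \<sigma>) =
    (\<Sum>S\<in>?S. \<Sum>\<sigma>\<in>(\<lambda>\<sigma>. \<sigma>(Suc n := T)) ` state_paths M n S. ?w (Suc n) \<sigma>)"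
    unfolding state_paths_Suc
  proof (rule sum.UNION_disjoint)
    show "finite ?S" by (rule finite_row_transition[OF Suc.prems])
    show "\<forall>S\<in>?S. finite ((\<lambda>\<sigma>. \<sigma>(Suc n := T)) ` state_paths M n S)"
      using fin finite_state_paths by blast
    show "\<forall>S\<in>?S. \<forall>S'\<in>?S. S \<noteq> S' \<longrightarrow> (\<lambda>\<sigma>. \<sigma>(Suc n := T)) ` state_paths M n S \<inter>
      (\<lambda>\<sigma>. \<sigma>(Suc n := T)) ` state_paths M n S' = {}"
      using val by blast
  qed
  also have "\<dots> = (\<Sum>S\<in>?S. row_weight P Q (row_pos M (Suc n)) S T * state_weight P Q M n S)"
  proof (rule sum.cong[OF refl])
    fix S assume S: "S \<in> ?S"
    have inj: "inj_on (\<lambda>\<sigma>. \<sigma>(Suc n := T)) (state_paths M n S)"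
    proof (rule inj_onI, rule ext)
      fix \<sigma> \<sigma>' i assume *: "\<sigma> \<in> state_paths M n S" "\<sigma>' \<in> state_paths M n S" "\<sigma>(Suc n := T) = \<sigma>'(Suc n := T)"
      show "\<sigma> i = \<sigma>' i"
      proof (cases "i = Suc n")
        case True
        then show ?thesis using * by (simp add: state_paths_def)
      next
        case False
        then show ?thesis using fun_cong[OF *(3), of i] by simp
      qed
    qed
    have "(\<Sum>\<sigma>\<in>(\<lambda>\<sigma>. \<sigma>(Suc n := T)) ` state_paths M n S. ?w (Suc n) \<sigma>) =
      (\<Sum>\<sigma>\<in>state_paths M n S. ?w (Suc n) (\<sigma>(Suc n := T)))"
      by (simp only: sum.reindex[OF inj] o_def)
    also have "\<dots> = (\<Sum>\<sigma>\<in>state_paths M n S. row_weight P Q (row_pos M (Suc n)) S T * ?w n \<sigma>)"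
    proof (rule sum.cong[OF refl])
      fix \<sigma> assume "\<sigma> \<in> state_paths M n S"
      then have "\<sigma> n = S" by (simp add: state_paths_def)
      moreover have "?w n (\<sigma>(Suc n := T)) = ?w n \<sigma>" by (rule prod.cong) auto
      ultimately show "?w (Suc n) (\<sigma>(Suc n := T)) = row_weight P Q (row_pos M (Suc n)) S T * ?w n \<sigma>"
        by (simp add: mult.commute)
    qed
    also have "\<dots> = row_weight P Q (row_pos M (Suc n)) S T * state_weight P Q M n S"
      by (simp only: sum_distrib_left[symmetric] Suc.IH[OF fin[OF S]])
    finally show "(\<Sum>\<sigma>\<in>(\<lambda>\<sigma>. \<sigma>(Suc n := T)) ` state_paths M n S. ?w (Suc n) \<sigma>) =
      row_weight P Q (row_pos M (Suc n)) S T * state_weight P Q M n S" .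
  qed
  finally show ?case by simp
qed

subsection \<open>Symmetric trapezoids as paths\<close>

text \<open>M is the number of columns to the left of the axis; the axis is column M + 1.\<close>

locale trapezoid =
  fixes n l M :: nat
  assumes n: "even n" "n \<ge> 2" and l: "odd l" "l \<ge> 3" and M: "M = n - 1 + (l - 1) div 2"
begin

lemma width: "2 * n + l - 1 = 2 * Suc M"
  using n l by (auto simp: M elim!: oddE evenE)

lemma n_le_M: "n \<le> M"
  using n l by (auto simp: M elim!: oddE)

lemma index_iff: "(i, j) \<in> ast_index n l \<longleftrightarrow> 1 \<le> i \<and> i \<le> n \<and> i \<le> j \<and> j \<le> 2 * Suc M - i"
  by (simp only: ast_index_def width mem_Collect_eq case_prod_conv)

definition state :: "(nat \<Rightarrow> nat \<Rightarrow> int) \<Rightarrow> nat \<Rightarrow> int set" where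
  "state a i = (if i \<le> n then row_pos M ` {j \<in> {1..M}. (\<Sum>k\<le>i. a k j) = 1} else {})"

definition entry :: "(nat \<Rightarrow> int set) \<Rightarrow> nat \<Rightarrow> nat \<Rightarrow> int" where
  "entry \<sigma> i j = of_bool (row_pos M j \<in> \<sigma> i) - of_bool (row_pos M j \<in> \<sigma> (i - 1))"

text \<open>Inverse to \<open>state\<close>: the left half consists of differences of consecutive
  states, the right half is its reflection, and the central entry is what a row sum of 1 leaves
  over.\<close>

definition array :: "(nat \<Rightarrow> int set) \<Rightarrow> nat \<Rightarrow> nat \<Rightarrow> int" where
  "array \<sigma> i j = (if (i, j) \<notin> ast_index n l then 0 else if j \<le> M then entry \<sigma> i j
     else if j = Suc M then 1 - 2 * int (row_parity i) else entry \<sigma> i (2 * Suc M - j))"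

lemma row_pos_less_iff [simp]: "row_pos M i < row_pos M j \<longleftrightarrow> i < j"
  and row_pos_le_iff [simp]: "row_pos M i \<le> row_pos M j \<longleftrightarrow> i \<le> j"
  and row_pos_eq_iff [simp]: "row_pos M i = row_pos M j \<longleftrightarrow> i = j"
  by (auto simp: row_pos_def)

lemma inj_row_pos: "inj_on (row_pos M) A"
  by (auto simp: inj_on_def)

lemma card_below:
  assumes "S \<subseteq> row_pos M ` {1..M}" "J \<le> M"
  shows "int (card {y \<in> S. y \<le> row_pos M J}) = (\<Sum>j\<in>{1..J}. of_bool (row_pos M j \<in> S))"
proof -
  have "{y \<in> S. y \<le> row_pos M J} = row_pos M ` {j \<in> {1..J}. row_pos M j \<in> S}"
    using assms by auto
  then have "card {y \<in> S. y \<le> row_pos M J} = card {j \<in> {1..J}. row_pos M j \<in> S}"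
    by (simp only: card_image[OF inj_row_pos])
  also have "int \<dots> = (\<Sum>j\<in>{1..J}. of_bool (row_pos M j \<in> S))"
    by (simp add: of_bool_def sum.If_cases Int_def)
  finally show ?thesis .
qed

text \<open>The counts in \<open>row_transition\<close> have arbitrary integer thresholds, while
  partial sums of a row end at columns. A threshold is clipped to a column; J = 0 covers those left
  of column 1.\<close>

lemma below_row_pos:
  "\<exists>J\<le>M. \<forall>S. S \<subseteq> row_pos M ` {1..M} \<longrightarrow> {y \<in> S. y \<le> x} = {y \<in> S. y \<le> row_pos M J}"
proof (intro exI conjI allI impI)
  let ?J = "nat (min (int M) (x + int M + 1))"
  show "?J \<le> M" by simp
  fix S assume S: "S \<subseteq> row_pos M ` {1..M}"
  have "y \<le> x \<longleftrightarrow> y \<le> row_pos M ?J" if "y \<in> S" for y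
  proof -
    obtain j where "y = row_pos M j" "j \<in> {1..M}" using S \<open>y \<in> S\<close> by blast
    then show ?thesis by (auto simp: row_pos_def min_def)
  qed
  then show "{y \<in> S. y \<le> x} = {y \<in> S. y \<le> row_pos M ?J}" by blast
qed

lemma row_transition_iff:
  assumes "S \<subseteq> row_pos M ` {1..M}" "T \<subseteq> row_pos M ` {1..M}"
  shows "row_transition (row_pos M i) e S T \<longleftrightarrow>
    (\<forall>j\<in>{1..M}. j < i \<longrightarrow> (row_pos M j \<in> S \<longleftrightarrow> row_pos M j \<in> T)) \<and>
    (\<forall>J\<le>M. (\<Sum>j\<in>{1..J}. of_bool (row_pos M j \<in> T) - of_bool (row_pos M j \<in> S) :: int) \<in> {0, 1}) \<and>
    (\<Sum>j\<in>{1..M}. of_bool (row_pos M j \<in> T) - of_bool (row_pos M j \<in> S)) = int e"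
proof -
  have fin: "finite S" "finite T" using assms finite_subset by blast+
  have neg: "row_pos M j < 0" if "j \<in> {1..M}" for j using that by (simp add: row_pos_def)
  have S0: "S \<subseteq> {..<0}" using assms(1) neg by auto
  have froz: "(\<forall>x<row_pos M i. x \<in> S \<longleftrightarrow> x \<in> T) \<longleftrightarrow>
      (\<forall>j\<in>{1..M}. j < i \<longrightarrow> (row_pos M j \<in> S \<longleftrightarrow> row_pos M j \<in> T))" (is "?A \<longleftrightarrow> ?B")
  proof
    assume ?B
    show ?A
    proof (intro allI impI)
      fix x assume "x < row_pos M i"
      show "x \<in> S \<longleftrightarrow> x \<in> T"
      proof (cases "x \<in> row_pos M ` {1..M}")
        case True
        then show ?thesis using \<open>?B\<close> \<open>x < row_pos M i\<close> by auto
      next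
        case False
        then show ?thesis using assms by blast
      qed
    qed
  qed simp
  have diff: "(\<Sum>j\<in>{1..J}. of_bool (row_pos M j \<in> T) - of_bool (row_pos M j \<in> S)) =
      int (card {y \<in> T. y \<le> row_pos M J}) - int (card {y \<in> S. y \<le> row_pos M J})" if "J \<le> M" for J
    using that assms by (simp add: card_below sum_subtractf)
  have cnt: "(\<forall>x. card {y \<in> S. y \<le> x} \<le> card {y \<in> T. y \<le> x} \<and> card {y \<in> T. y \<le> x} \<le> card {y \<in> S. y \<le> x} + 1) \<longleftrightarrow>
      (\<forall>J\<le>M. (\<Sum>j\<in>{1..J}. of_bool (row_pos M j \<in> T) - of_bool (row_pos M j \<in> S) :: int) \<in> {0, 1})" (is "?A \<longleftrightarrow> ?B")
  proof
    assume A: ?A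
    show ?B
    proof (intro allI impI)
      fix J assume "J \<le> M"
      from diff[OF this] A[rule_format, of "row_pos M J"]
      show "(\<Sum>j\<in>{1..J}. of_bool (row_pos M j \<in> T) - of_bool (row_pos M j \<in> S) :: int) \<in> {0, 1}" by auto
    qed
  next
    assume B: ?B
    show ?A
    proof
      fix x
      obtain J where J: "J \<le> M" "\<And>S. S \<subseteq> row_pos M ` {1..M} \<Longrightarrow> {y \<in> S. y \<le> x} = {y \<in> S. y \<le> row_pos M J}"
        using below_row_pos[of x] by blast
      show "card {y \<in> S. y \<le> x} \<le> card {y \<in> T. y \<le> x} \<and> card {y \<in> T. y \<le> x} \<le> card {y \<in> S. y \<le> x} + 1"
        unfolding J(2)[OF assms(1)] J(2)[OF assms(2)] using diff[OF J(1)] B[rule_format, OF J(1)] by auto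
    qed
  qed
  have "{y \<in> S. y \<le> row_pos M M} = S" "{y \<in> T. y \<le> row_pos M M} = T" using assms by auto
  then have tot: "card T = card S + e \<longleftrightarrow>
      (\<Sum>j\<in>{1..M}. of_bool (row_pos M j \<in> T) - of_bool (row_pos M j \<in> S)) = int e"
    using diff[of M] by auto
  show ?thesis unfolding row_transition_def froz cnt tot using fin S0 by blast
qed

lemma state_subset: "state a i \<subseteq> row_pos M ` {1..M}"
  by (auto simp: state_def)

lemma row_sum_split:
  assumes i: "i \<in> {1..n}" and z: "\<And>j. (i, j) \<notin> ast_index n l \<Longrightarrow> a i j = 0"
    and sym: "\<And>j. (i, j) \<in> ast_index n l \<Longrightarrow> a i j = a i (2 * Suc M - j)"
  shows "row_sum n l a i = 2 * (\<Sum>j\<in>{1..M}. a i j) + a i (Suc M)"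
proof -
  have iM: "i \<le> M" using i n_le_M by simp
  have "{j. (i, j) \<in> ast_index n l} = {i..M} \<union> (insert (Suc M) {Suc (Suc M)..2 * Suc M - i})"
    using i iM by (auto simp: index_iff)
  then have "row_sum n l a i = (\<Sum>j\<in>{i..M}. a i j) + (a i (Suc M) + (\<Sum>j\<in>{Suc (Suc M)..2 * Suc M - i}. a i j))"
    unfolding row_sum_def by (simp only:) (subst sum.union_disjoint, auto)
  also have "(\<Sum>j\<in>{Suc (Suc M)..2 * Suc M - i}. a i j) = (\<Sum>j\<in>{i..M}. a i j)"
  proof (rule sum.reindex_bij_witness[of _ "\<lambda>j. 2 * Suc M - j" "\<lambda>j. 2 * Suc M - j"])
    fix j assume j: "j \<in> {Suc (Suc M)..2 * Suc M - i}"
    then have "(i, j) \<in> ast_index n l" using i iM by (auto simp: index_iff)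
    from sym[OF this] show "a i (2 * Suc M - j) = a i j" by simp
  qed (use i iM in auto)
  also have "(\<Sum>j\<in>{i..M}. a i j) = (\<Sum>j\<in>{1..M}. a i j)"
    by (rule sum.mono_neutral_left) (use i in \<open>auto intro!: z simp: index_iff\<close>)
  finally show ?thesis by simp
qed

section \<open>From a symmetric trapezoid to its path of states\<close>

context
  fixes a :: "nat \<Rightarrow> nat \<Rightarrow> int"
  assumes ast: "alternating_sign_trapezoid n l a" and vs: "vertically_symmetric n l a"
begin

lemma a_zero: "(i, j) \<notin> ast_index n l \<Longrightarrow> a i j = 0"
  using ast unfolding alternating_sign_trapezoid_iff by blast

lemma a_sym: "(i, j) \<in> ast_index n l \<Longrightarrow> a i j = a i (2 * Suc M - j)"
  using vs unfolding vertically_symmetric_def width by blast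

lemma a_col: "(\<Sum>k\<le>i. a k j) = 0 \<or> (\<Sum>k\<le>i. a k j) = 1"
  using ast unfolding alternating_sign_trapezoid_iff by blast

lemma a_row: "(\<Sum>k\<le>j. a i k) = 0 \<or> (\<Sum>k\<le>j. a i k) = 1"
  using ast unfolding alternating_sign_trapezoid_iff by blast

lemma a_row': "(\<Sum>k\<in>{1..j}. a i k) = (\<Sum>k\<le>j. a i k)"
  by (rule sum.mono_neutral_left) (auto intro!: a_zero simp: index_iff)

lemma a_center: "i \<in> {1..n} \<Longrightarrow> 2 * (\<Sum>j\<in>{1..M}. a i j) + a i (Suc M) = 1"
  using row_sum_split[of i a] a_zero a_sym ast unfolding alternating_sign_trapezoid_iff by auto

text \<open>By symmetry the row sum 1 is an even number plus the central entry, which is therefore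
  odd. Partial sums 0 and 1 of the central column then leave no choice.\<close>

lemma a_center_col: "i \<le> n \<Longrightarrow> (\<Sum>k\<le>i. a k (Suc M)) = of_bool (odd i)"
proof (induction i)
  case 0
  then show ?case by (simp add: a_zero index_iff)
next
  case (Suc i)
  then have IH: "(\<Sum>k\<le>i. a k (Suc M)) = of_bool (odd i)" by simp
  have "2 * (\<Sum>j\<in>{1..M}. a (Suc i) j) + a (Suc i) (Suc M) = 1" using Suc by (intro a_center) auto
  then have "odd (a (Suc i) (Suc M))" by presburger
  moreover have "(\<Sum>k\<le>Suc i. a k (Suc M)) = of_bool (odd i) + a (Suc i) (Suc M)" using IH by simp
  ultimately show ?case using a_col[where i = "Suc i" and j = "Suc M"] by (cases "even i") (auto simp del: sum.atMost_Suc)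
qed

lemma a_left_sum: "i \<in> {1..n} \<Longrightarrow> (\<Sum>j\<in>{1..M}. a i j) = int (row_parity i)"
proof -
  assume i: "i \<in> {1..n}"
  then obtain k where k: "i = Suc k" by (cases i) auto
  have "a i (Suc M) = of_bool (odd i) - of_bool (odd k)"
    using a_center_col[of i] a_center_col[of k] i unfolding k by simp
  then show ?thesis using a_center[OF i] k by (cases "even i") (auto simp: row_parity_def)
qed

lemma state_indicator: "i \<le> n \<Longrightarrow> j \<in> {1..M} \<Longrightarrow> of_bool (row_pos M j \<in> state a i) = (\<Sum>k\<le>i. a k j)"
  using a_col[where i = i and j = j] by (auto simp: state_def)

lemma a_entry: "i \<in> {1..n} \<Longrightarrow> j \<in> {1..M} \<Longrightarrow> a i j = entry (state a) i j"
proof -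
  assume i: "i \<in> {1..n}" and j: "j \<in> {1..M}"
  then obtain k where k: "i = Suc k" by (cases i) auto
  show ?thesis unfolding entry_def using state_indicator[of i j] state_indicator[of "i - 1" j] i j k by simp
qed

lemma state_transition:
  assumes "i < n"
  shows "row_transition (row_pos M (Suc i)) (row_parity (Suc i)) (state a i) (state a (Suc i))"
proof -
  have e: "of_bool (row_pos M j \<in> state a (Suc i)) - of_bool (row_pos M j \<in> state a i) = a (Suc i) j"
    if "j \<in> {1..M}" for j
    using a_entry[of "Suc i" j] assms that by (simp add: entry_def)
  have sum: "(\<Sum>j\<in>{1..J}. of_bool (row_pos M j \<in> state a (Suc i)) - of_bool (row_pos M j \<in> state a i)) =
      (\<Sum>j\<in>{1..J}. a (Suc i) j)" if "J \<le> M" for J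
    by (rule sum.cong[OF refl], rule e) (use that in auto)
  show ?thesis
    unfolding row_transition_iff[OF state_subset state_subset]
  proof (intro conjI ballI allI impI)
    fix j assume j: "j \<in> {1..M}" "j < Suc i"
    then have "a (Suc i) j = 0" by (intro a_zero) (auto simp: index_iff)
    with e[OF j(1)] show "row_pos M j \<in> state a i \<longleftrightarrow> row_pos M j \<in> state a (Suc i)"
      by (auto simp: of_bool_def split: if_splits)
  next
    fix J assume J: "J \<le> M"
    show "(\<Sum>j\<in>{1..J}. of_bool (row_pos M j \<in> state a (Suc i)) - of_bool (row_pos M j \<in> state a i) :: int) \<in> {0, 1}"
      unfolding sum[OF J] a_row' using a_row[where i = "Suc i" and j = J] by auto
  next
    show "(\<Sum>j\<in>{1..M}. of_bool (row_pos M j \<in> state a (Suc i)) - of_bool (row_pos M j \<in> state a i)) =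
      int (row_parity (Suc i))"
      unfolding sum[OF order.refl] using assms by (intro a_left_sum) auto
  qed
qed

lemma state_path: "state a \<in> state_paths M n (state a n)"
proof -
  have "state a 0 = {}" using a_zero by (auto simp: state_def index_iff)
  then show ?thesis using state_transition by (auto simp: state_paths_def state_def)
qed

lemma array_state: "array (state a) = a"
proof (intro ext)
  fix i j
  show "array (state a) i j = a i j"
  proof (cases "(i, j) \<in> ast_index n l")
    case False
    then show ?thesis using a_zero by (simp add: array_def)
  next
    case True
    then have i: "i \<in> {1..n}" "i \<le> j" "j \<le> 2 * Suc M - i" by (auto simp: index_iff)
    consider "j \<le> M" | "j = Suc M" | "j > Suc M" by linarith
    then show ?thesis
    proof cases
      case 1
      then show ?thesis using a_entry[of i j] i True by (auto simp: array_def)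
    next
      case 2
      then show ?thesis using a_center[OF i(1)] a_left_sum[OF i(1)] True by (simp add: array_def)
    next
      case 3
      then have "2 * Suc M - j \<in> {1..M}" using i by auto
      then show ?thesis using a_entry[OF i(1)] a_sym[OF True] 3 True by (simp add: array_def)
    qed
  qed
qed

lemma col_sum_eq: "col_sum n l a j = (\<Sum>k\<le>n. a k j)"
  unfolding col_sum_def by (rule sum.mono_neutral_left) (auto simp: index_iff intro!: a_zero)

text \<open>Every column sum is 0 or 1, so the vanishing of their total over the central columns
  forces each of them to vanish.\<close>

lemma central_columns: "n < j \<Longrightarrow> j \<le> M \<Longrightarrow> (\<Sum>k\<le>n. a k j) = 0"
proof -
  assume j: "n < j" "j \<le> M"
  have "(\<Sum>j = n + 1..n + l - 2. col_sum n l a j) = 0"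
    using ast unfolding alternating_sign_trapezoid_iff by blast
  moreover have "col_sum n l a j \<ge> 0" for j using a_col[where i = n and j = j] by (auto simp: col_sum_eq)
  ultimately have "\<forall>j\<in>{n + 1..n + l - 2}. col_sum n l a j = 0"
    by (subst (asm) sum_nonneg_eq_0_iff) auto
  moreover have "j \<in> {n + 1..n + l - 2}" using j width by auto
  ultimately show ?thesis by (simp add: col_sum_eq)
qed

text \<open>Column j has the number j - n - 1 and the position j - M - 1, whence the shift by n - M.
  By \<open>central_columns\<close> no column between n and the axis enters the last state.\<close>

lemma one_column_vector_iff:
  assumes c: "sorted_wrt (<) cs"
  shows "one_column_vector n l a = cs \<longleftrightarrow> state a n = (\<lambda>x. x + int n - int M) ` set cs"
proof -
  let ?J = "{j \<in> {1..n}. one_column n l a j}"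
  let ?f = "\<lambda>j. int j - int n - 1" and ?g = "\<lambda>x. x + int n - int M"
  have "one_column_vector n l a = cs \<longleftrightarrow> ?f ` ?J = set cs"
  proof
    assume "one_column_vector n l a = cs"
    then show "?f ` ?J = set cs" unfolding one_column_vector_def
      by (metis (no_types, lifting) finite_Collect_conjI finite_atLeastAtMost finite_imageI
          mem_Collect_eq set_sorted_list_of_set finite_subset subsetI)
  next
    assume "?f ` ?J = set cs"
    then show "one_column_vector n l a = cs"
      unfolding one_column_vector_def using c
      by (simp only:) (metis sorted_list_of_set.idem_if_sorted_distinct strict_sorted_iff)
  qed
  also have "\<dots> \<longleftrightarrow> ?g ` (?f ` ?J) = ?g ` set cs"
    by (rule inj_image_eq_iff[symmetric]) (auto simp: inj_def)
  also have "?g ` (?f ` ?J) = state a n"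
  proof -
    have "?g (?f j) = row_pos M j" for j by (simp add: row_pos_def)
    then have "?g ` (?f ` ?J) = row_pos M ` ?J" by (simp only: image_image)
    moreover have "?J = {j \<in> {1..M}. (\<Sum>k\<le>n. a k j) = 1}"
    proof (rule Set.set_eqI)
      fix j
      show "j \<in> ?J \<longleftrightarrow> j \<in> {j \<in> {1..M}. (\<Sum>k\<le>n. a k j) = 1}"
        using n_le_M central_columns[of j] by (cases "j \<le> n") (auto simp: one_column_def col_sum_eq)
    qed
    ultimately show ?thesis by (simp only: state_def order.refl if_True)
  qed
  finally show ?thesis .
qed

lemma Q_weight_eq: "Q_weight Q n l a = (\<Prod>i<n. Q ^ card (state a i - state a (Suc i)))"
proof -
  let ?N = "\<lambda>i. {j \<in> {1..M}. a i j = -1}"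
  have "{(i, j). (i, j) \<in> ast_index n l \<and> j \<le> n - 1 + (l - 1) div 2 \<and> a i j = -1} = (SIGMA i:Suc ` {..<n}. ?N i)"
  proof -
    have "(i, j) \<in> ast_index n l \<and> j \<le> M \<and> a i j = -1 \<longleftrightarrow> i \<in> Suc ` {..<n} \<and> j \<in> ?N i" for i j
    proof -
      have "i \<in> Suc ` {..<n} \<longleftrightarrow> i \<in> {1..n}" by (cases i) auto
      moreover have "a i j = -1 \<Longrightarrow> (i, j) \<in> ast_index n l" using a_zero[of i j] by force
      ultimately show ?thesis using index_iff[of i j] by auto
    qed
    then show ?thesis unfolding M[symmetric] by auto
  qed
  then have "Q_weight Q n l a = Q ^ (\<Sum>i\<in>Suc ` {..<n}. card (?N i))"
    unfolding Q_weight_def by (simp add: card_SigmaI)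
  also have "\<dots> = (\<Prod>i<n. Q ^ card (?N (Suc i)))"
    by (simp add: sum.reindex power_sum)
  also have "\<dots> = (\<Prod>i<n. Q ^ card (state a i - state a (Suc i)))"
  proof (rule prod.cong[OF refl])
    fix i assume "i \<in> {..<n}"
    then have i: "Suc i \<in> {1..n}" by auto
    have "state a i - state a (Suc i) = row_pos M ` ?N (Suc i)"
      using state_subset[of a i] a_entry[OF i] by (auto simp: entry_def of_bool_def split: if_splits)
    then show "Q ^ card (?N (Suc i)) = Q ^ card (state a i - state a (Suc i))"
      by (simp only: card_image[OF inj_row_pos])
  qed
  finally show ?thesis .
qed

lemma state_frozen: "j \<in> {1..M} \<Longrightarrow> j \<le> i \<Longrightarrow> i \<le> n \<Longrightarrow> row_pos M j \<in> state a i \<longleftrightarrow> row_pos M j \<in> state a j"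
proof -
  assume j: "j \<in> {1..M}" "j \<le> i" "i \<le> n"
  have "(\<Sum>k\<le>j. a k j) = (\<Sum>k\<le>i. a k j)"
    by (rule sum.mono_neutral_left) (use j in \<open>auto simp: index_iff intro!: a_zero\<close>)
  then have "of_bool (row_pos M j \<in> state a i) = (of_bool (row_pos M j \<in> state a j) :: int)"
    using state_indicator[of i j] state_indicator[of j j] j by simp
  then show ?thesis by (simp add: of_bool_def split: if_splits)
qed

text \<open>A column j \<le> n has its lowest entry in row j, and its membership is settled from
  then on. The product has n factors but the weight covers n - 1 columns; the factor of column n is
  1 by \<open>last\<close>.\<close>

lemma P_weight_eq:
  "P_weight P n l a = (\<Prod>i<n. if row_pos M (Suc i) \<in> state a i \<and> row_pos M (Suc i) \<in> state a (Suc i) then P else 1)"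
proof -
  let ?C = "\<lambda>j. row_pos M j \<in> state a (j - 1) \<and> row_pos M j \<in> state a j"
  \<comment> \<open>In row n the columns before n are fixed, and the last state has no column after
    n. If column n lay in both states, the last state would be contained in the previous one,
    although the even row n adds a column.\<close>
  have last: "\<not> ?C n"
  proof
    assume C: "?C n"
    have n1: "n = Suc (n - 1)" "n - 1 < n" using n by auto
    have tr: "row_transition (row_pos M n) (row_parity n) (state a (n - 1)) (state a n)"
      using state_transition[of "n - 1"] n1 by simp
    have "state a n \<subseteq> state a (n - 1)"
    proof
      fix x assume x: "x \<in> state a n"
      then obtain j where j: "x = row_pos M j" "j \<in> {1..M}" "(\<Sum>k\<le>n. a k j) = 1" by (auto simp: state_def)
      then have "j \<le> n" using central_columns[of j] by force
      then show "x \<in> state a (n - 1)"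
        using tr x C j unfolding row_transition_def by (cases "j = n") auto
    qed
    moreover have "finite (state a (n - 1))" by (simp add: state_def)
    ultimately have "card (state a n) \<le> card (state a (n - 1))" by (rule card_mono[rotated])
    moreover have "card (state a n) = card (state a (n - 1)) + 1"
      using tr n by (simp add: row_transition_def row_parity_def)
    ultimately show False by simp
  qed
  have one_zero: "one_zero_column n l a j \<longleftrightarrow> ?C j" if j: "j \<in> {1..n - 1}" for j
  proof -
    have jM: "j \<in> {1..M}" "j \<in> {1..n}" using j n_le_M by auto
    have "{i. (i, j) \<in> ast_index n l} = {1..j}" using jM n_le_M by (auto simp: index_iff)
    moreover have "Max {1..j} = j" using j by (intro Max_eqI) auto
    ultimately have "Max {i. (i, j) \<in> ast_index n l} = j" by simp
    moreover have "one_column n l a j \<longleftrightarrow> row_pos M j \<in> state a j"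
      using state_indicator[of n j] state_frozen[of j n] jM
      by (auto simp: one_column_def col_sum_eq of_bool_def split: if_splits)
    moreover have "a j j = entry (state a) j j" using a_entry jM by blast
    ultimately show ?thesis by (auto simp: one_zero_column_def entry_def)
  qed
  have "{j \<in> {1..n - 1}. one_zero_column n l a j} = {j \<in> Suc ` {..<n}. ?C j}"
  proof (rule Set.set_eqI)
    fix j
    have "j \<in> Suc ` {..<n} \<longleftrightarrow> j \<in> {1..n - 1} \<or> j = n" using n by (cases j) auto
    then show "j \<in> {j \<in> {1..n - 1}. one_zero_column n l a j} \<longleftrightarrow> j \<in> {j \<in> Suc ` {..<n}. ?C j}"
      using one_zero[of j] last by auto
  qed
  then have "P_weight P n l a = (\<Prod>j\<in>{j \<in> Suc ` {..<n}. ?C j}. P)"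
    by (simp add: P_weight_def)
  also have "\<dots> = (\<Prod>j\<in>Suc ` {..<n}. if ?C j then P else 1)"
    by (rule prod.inter_filter) simp
  finally show ?thesis by (simp add: prod.reindex)
qed

end

section \<open>From a path of states back to a symmetric trapezoid\<close>

context
  fixes \<sigma> :: "nat \<Rightarrow> int set" and T :: "int set"
  assumes path: "\<sigma> \<in> state_paths M n T" and T: "T \<subseteq> row_pos M ` {1..n}"
begin

lemma path_transition: "i < n \<Longrightarrow> row_transition (row_pos M (Suc i)) (row_parity (Suc i)) (\<sigma> i) (\<sigma> (Suc i))"
  using path by (simp add: state_paths_def)

text \<open>A transition imposes no left bound on the states, but every row starts at column 1 or
  later, so positions left of column 1 remain as empty as in the initial state.\<close>

lemma path_ge: "i \<le> n \<Longrightarrow> \<sigma> i \<subseteq> {row_pos M 1..}"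
proof (induction i)
  case 0
  then show ?case using path by (simp add: state_paths_def)
next
  case (Suc i)
  show ?case
  proof
    fix x assume x: "x \<in> \<sigma> (Suc i)"
    show "x \<in> {row_pos M 1..}"
    proof (rule ccontr)
      assume "x \<notin> {row_pos M 1..}"
      then have lt: "x < row_pos M 1" by simp
      then have "x < row_pos M (Suc i)" by (simp add: row_pos_def)
      then have "x \<in> \<sigma> i" using path_transition[of i] Suc.prems x unfolding row_transition_def by auto
      then show False using Suc lt by auto
    qed
  qed
qed

lemma path_subset: "i \<le> n \<Longrightarrow> \<sigma> i \<subseteq> row_pos M ` {1..M}"
proof
  fix x assume i: "i \<le> n" and x: "x \<in> \<sigma> i"
  show "x \<in> row_pos M ` {1..M}"
  proof (cases "i = n")
    case True
    then have "\<sigma> i = T" using path by (simp add: state_paths_def)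
    then show ?thesis using x T n_le_M by fastforce
  next
    case False
    then have "x < 0" using path_transition[of i] i x unfolding row_transition_def by auto
    moreover have "row_pos M 1 \<le> x" using path_ge[OF i] x by auto
    ultimately have "x = row_pos M (nat (x + int M + 1))" "nat (x + int M + 1) \<in> {1..M}"
      by (auto simp: row_pos_def)
    then show ?thesis by blast
  qed
qed

lemma path_transition_iff:
  assumes "i \<in> {1..n}"
  shows "\<forall>j\<in>{1..M}. j < i \<longrightarrow> entry \<sigma> i j = 0"
    and "\<forall>J\<le>M. (\<Sum>j\<in>{1..J}. entry \<sigma> i j) \<in> {0, 1}"
    and "(\<Sum>j\<in>{1..M}. entry \<sigma> i j) = int (row_parity i)"
proof -
  obtain k where k: "i = Suc k" "k < n" using assms by (cases i) auto
  have "row_transition (row_pos M i) (row_parity i) (\<sigma> k) (\<sigma> i)" using path_transition[OF k(2)] k(1) by simp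
  moreover have "\<sigma> k \<subseteq> row_pos M ` {1..M}" "\<sigma> i \<subseteq> row_pos M ` {1..M}" using path_subset k by auto
  ultimately have *: "(\<forall>j\<in>{1..M}. j < i \<longrightarrow> (row_pos M j \<in> \<sigma> k \<longleftrightarrow> row_pos M j \<in> \<sigma> i)) \<and>
    (\<forall>J\<le>M. (\<Sum>j\<in>{1..J}. of_bool (row_pos M j \<in> \<sigma> i) - of_bool (row_pos M j \<in> \<sigma> k) :: int) \<in> {0, 1}) \<and>
    (\<Sum>j\<in>{1..M}. of_bool (row_pos M j \<in> \<sigma> i) - of_bool (row_pos M j \<in> \<sigma> k)) = int (row_parity i)"
    using row_transition_iff by blast
  then show "\<forall>j\<in>{1..M}. j < i \<longrightarrow> entry \<sigma> i j = 0"
    "\<forall>J\<le>M. (\<Sum>j\<in>{1..J}. entry \<sigma> i j) \<in> {0, 1}"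
    "(\<Sum>j\<in>{1..M}. entry \<sigma> i j) = int (row_parity i)"
    unfolding entry_def k(1) by auto
qed

lemma array_left: "i \<in> {1..n} \<Longrightarrow> j \<in> {1..M} \<Longrightarrow> array \<sigma> i j = entry \<sigma> i j"
  using path_transition_iff(1)[of i] n_le_M by (auto simp: array_def index_iff not_le)

lemma array_col_left: "i \<le> n \<Longrightarrow> j \<in> {1..M} \<Longrightarrow> (\<Sum>k\<le>i. array \<sigma> k j) = of_bool (row_pos M j \<in> \<sigma> i)"
proof (induction i)
  case 0
  then show ?case using path by (simp add: array_def index_iff state_paths_def)
next
  case (Suc i)
  then show ?case using array_left[of "Suc i" j] by (simp add: entry_def)
qed

lemma array_sym: "(i, j) \<in> ast_index n l \<Longrightarrow> array \<sigma> i j = array \<sigma> i (2 * Suc M - j)"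
  by (auto simp: array_def index_iff)

lemma array_zero: "(i, j) \<notin> ast_index n l \<Longrightarrow> array \<sigma> i j = 0"
  by (simp add: array_def)

lemma array_row_left: "i \<in> {1..n} \<Longrightarrow> J \<le> M \<Longrightarrow> (\<Sum>j\<le>J. array \<sigma> i j) = (\<Sum>j\<in>{1..J}. entry \<sigma> i j)"
proof -
  assume i: "i \<in> {1..n}" "J \<le> M"
  have "(\<Sum>j\<le>J. array \<sigma> i j) = (\<Sum>j\<in>{1..J}. array \<sigma> i j)"
    by (rule sum.mono_neutral_right) (auto intro!: array_zero simp: index_iff)
  also have "\<dots> = (\<Sum>j\<in>{1..J}. entry \<sigma> i j)" by (rule sum.cong) (use i array_left in auto)
  finally show ?thesis .
qed

text \<open>The row is a palindrome with total 1, so what follows column M + 1 + q mirrors the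
  entries up to column M - q. Partial sums beyond the centre are thus 0 or 1 as soon as those on the
  left are.\<close>

lemma array_row_right:
  assumes i: "i \<in> {1..n}" and q: "q \<le> Suc M"
  shows "(\<Sum>j\<le>Suc M + q. array \<sigma> i j) = 1 - (\<Sum>j\<le>M - q. array \<sigma> i j)"
  using q
proof (induction q)
  case 0
  have "(\<Sum>j\<le>M. array \<sigma> i j) = int (row_parity i)"
    using array_row_left[OF i] path_transition_iff(3)[OF i] by simp
  moreover have "array \<sigma> i (Suc M) = 1 - 2 * int (row_parity i)"
    using i n_le_M by (auto simp: array_def index_iff)
  ultimately show ?case by simp
next
  case (Suc q)
  then have q: "q \<le> M" by simp
  have "array \<sigma> i (Suc M + Suc q) = array \<sigma> i (M - q)"
  proof (cases "(i, M - q) \<in> ast_index n l")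
    case True
    have "2 * Suc M - (M - q) = Suc M + Suc q" using q by simp
    with array_sym[OF True] show ?thesis by simp
  next
    case False
    then have "(i, Suc M + Suc q) \<notin> ast_index n l" using i q by (auto simp: index_iff)
    with False show ?thesis by (simp add: array_zero)
  qed
  moreover have "(\<Sum>j\<le>M - q. array \<sigma> i j) = (\<Sum>j\<le>M - Suc q. array \<sigma> i j) + array \<sigma> i (M - q)"
  proof (cases "M - q = 0")
    case True
    then show ?thesis by (simp add: array_zero index_iff)
  next
    case False
    then have "M - q = Suc (M - Suc q)" by simp
    then show ?thesis by (metis sum.atMost_Suc)
  qed
  ultimately show ?case using Suc by simp
qed

lemma array_row: "(\<Sum>k\<le>j. array \<sigma> i k) \<in> {0, 1}"
proof (cases "i \<in> {1..n}")
  case False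
  then have "array \<sigma> i k = 0" for k by (intro array_zero) (auto simp: index_iff)
  then show ?thesis by simp
next
  case i: True
  have left: "(\<Sum>k\<le>j. array \<sigma> i k) \<in> {0, 1}" if "j \<le> M" for j
    using array_row_left[OF i that] path_transition_iff(2)[OF i] that by auto
  have right: "(\<Sum>k\<le>Suc M + q. array \<sigma> i k) \<in> {0, 1}" if "q \<le> Suc M" for q
    using array_row_right[OF i that] left[of "M - q"] by auto
  show ?thesis
  proof (cases "j \<le> 2 * Suc M")
    case True
    show ?thesis
    proof (cases "j \<le> M")
      case False
      then have "j = Suc M + (j - Suc M)" "j - Suc M \<le> Suc M" using True by auto
      then show ?thesis using right by metis
    qed (rule left)
  next
    case False
    then have "(\<Sum>k\<le>j. array \<sigma> i k) = (\<Sum>k\<le>Suc M + Suc M. array \<sigma> i k)"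
      by (intro sum.mono_neutral_right) (auto intro!: array_zero simp: index_iff)
    then show ?thesis using right[of "Suc M"] by simp
  qed
qed

lemma array_col: "i \<le> n \<Longrightarrow> (\<Sum>k\<le>i. array \<sigma> k j) =
    (if j \<in> {1..M} then of_bool (row_pos M j \<in> \<sigma> i) else if j = Suc M then of_bool (odd i)
     else if j \<in> {Suc M..2 * Suc M - 1} then of_bool (row_pos M (2 * Suc M - j) \<in> \<sigma> i) else 0)"
proof -
  assume i: "i \<le> n"
  consider "j \<in> {1..M}" | "j = Suc M" | "j \<in> {Suc (Suc M)..2 * Suc M - 1}" | "j = 0 \<or> j > 2 * Suc M - 1"
    by fastforce
  then show ?thesis
  proof cases
    case 1
    then show ?thesis using array_col_left[OF i] by simp
  next
    case 2
    have "(\<Sum>k\<le>i. array \<sigma> k (Suc M)) = of_bool (odd i)"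
      using i
    proof (induction i)
      case (Suc i)
      have "array \<sigma> (Suc i) (Suc M) = 1 - 2 * int (row_parity (Suc i))"
        using Suc n_le_M by (auto simp: array_def index_iff)
      then show ?case using Suc by (auto simp: row_parity_def)
    qed (simp add: array_zero index_iff)
    then show ?thesis using 2 by simp
  next
    case 3
    let ?j = "2 * Suc M - j"
    have "array \<sigma> k j = array \<sigma> k ?j" for k
    proof (cases "(k, j) \<in> ast_index n l")
      case True
      then show ?thesis by (rule array_sym)
    next
      case False
      then have "(k, ?j) \<notin> ast_index n l" using 3 by (auto simp: index_iff)
      with False show ?thesis by (simp add: array_zero)
    qed
    then have "(\<Sum>k\<le>i. array \<sigma> k j) = (\<Sum>k\<le>i. array \<sigma> k ?j)" by simp
    also have "\<dots> = of_bool (row_pos M ?j \<in> \<sigma> i)" using 3 by (intro array_col_left[OF i]) auto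
    finally show ?thesis using 3 by auto
  next
    case 4
    then have "array \<sigma> k j = 0" for k by (intro array_zero) (auto simp: index_iff)
    then show ?thesis using 4 by auto
  qed
qed

lemma array_col_sum: "col_sum n l (array \<sigma>) j = (\<Sum>k\<le>n. array \<sigma> k j)"
  unfolding col_sum_def by (rule sum.mono_neutral_left) (auto simp: index_iff intro!: array_zero)

lemma array_trapezoid: "alternating_sign_trapezoid n l (array \<sigma>)" "vertically_symmetric n l (array \<sigma>)"
proof -
  show "vertically_symmetric n l (array \<sigma>)"
    unfolding vertically_symmetric_def width using array_sym by blast
  show "alternating_sign_trapezoid n l (array \<sigma>)"
    unfolding alternating_sign_trapezoid_iff
  proof (intro conjI allI ballI impI)
    show "array \<sigma> i j = 0" if "(i, j) \<notin> ast_index n l" for i j using array_zero[OF that] .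
    show "(\<Sum>k\<le>j. array \<sigma> i k) \<in> {0, 1}" for i j by (rule array_row)
    show "(\<Sum>k\<le>i. array \<sigma> k j) \<in> {0, 1}" for i j
    proof (cases "i \<le> n")
      case True
      then show ?thesis unfolding array_col[OF True] by auto
    next
      case False
      then have "(\<Sum>k\<le>i. array \<sigma> k j) = (\<Sum>k\<le>n. array \<sigma> k j)"
        by (intro sum.mono_neutral_right) (auto intro!: array_zero simp: index_iff)
      then show ?thesis unfolding array_col[OF order.refl] by auto
    qed
    show "row_sum n l (array \<sigma>) i = 1" if "i \<in> {1..n}" for i
    proof -
      have "(\<Sum>j\<in>{1..M}. array \<sigma> i j) = int (row_parity i)"
        using path_transition_iff(3)[OF that] array_left[OF that] by simp
      moreover have "array \<sigma> i (Suc M) = 1 - 2 * int (row_parity i)"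
        using that n_le_M by (auto simp: array_def index_iff)
      ultimately show ?thesis using row_sum_split[of i "array \<sigma>", OF that array_zero array_sym] by simp
    qed
    show "(\<Sum>j = n + 1..n + l - 2. col_sum n l (array \<sigma>) j) = 0"
    proof (rule sum.neutral, rule ballI)
      fix j assume j: "j \<in> {n + 1..n + l - 2}"
      have "\<sigma> n = T" using path by (simp add: state_paths_def)
      then have out: "row_pos M j' \<notin> \<sigma> n" if "j' > n" for j' using T that by fastforce
      have "2 * Suc M - j > n" using j width by auto
      then show "col_sum n l (array \<sigma>) j = 0"
        unfolding array_col_sum array_col[OF order.refl] using out j n by auto
    qed
  qed
qed

lemma state_array: "state (array \<sigma>) = \<sigma>"
proof
  fix i
  show "state (array \<sigma>) i = \<sigma> i"
  proof (cases "i \<le> n")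
    case True
    have "state (array \<sigma>) i = row_pos M ` {j \<in> {1..M}. row_pos M j \<in> \<sigma> i}"
      using True array_col_left[OF True] by (auto simp: state_def)
    also have "\<dots> = \<sigma> i" using path_subset[OF True] by auto
    finally show ?thesis .
  next
    case False
    then show ?thesis using path by (simp add: state_def state_paths_def)
  qed
qed

end

theorem sum_trapezoids:
  assumes cs: "sorted_wrt (<) cs" "set cs \<subseteq> {- int n.. - 1}"
  shows "(\<Sum>a | alternating_sign_trapezoid n l a \<and> vertically_symmetric n l a \<and> one_column_vector n l a = cs.
      P_weight P n l a * Q_weight Q n l a) = state_weight P Q M n ((\<lambda>x. x + int n - int M) ` set cs)"
proof -
  let ?T = "(\<lambda>x. x + int n - int M) ` set cs"
  let ?A = "{a. alternating_sign_trapezoid n l a \<and> vertically_symmetric n l a \<and> one_column_vector n l a = cs}"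
  have T: "?T \<subseteq> row_pos M ` {1..n}"
  proof
    fix y assume "y \<in> ?T"
    then obtain x where "x \<in> set cs" "y = x + int n - int M" by blast
    then have "y = row_pos M (nat (x + int n + 1))" "nat (x + int n + 1) \<in> {1..n}"
      using cs(2) by (auto simp: row_pos_def subset_iff)
    then show "y \<in> row_pos M ` {1..n}" by blast
  qed
  have "(\<Sum>a\<in>?A. P_weight P n l a * Q_weight Q n l a) =
    (\<Sum>\<sigma>\<in>state_paths M n ?T. \<Prod>i<n. row_weight P Q (row_pos M (Suc i)) (\<sigma> i) (\<sigma> (Suc i)))"
  proof (rule sum.reindex_bij_witness[of _ array state])
    fix a assume "a \<in> ?A"
    then have a: "alternating_sign_trapezoid n l a" "vertically_symmetric n l a" "one_column_vector n l a = cs" by auto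
    show "array (state a) = a" by (rule array_state[OF a(1,2)])
    show "state a \<in> state_paths M n ?T"
      using state_path[OF a(1,2)] one_column_vector_iff[OF a(1,2) cs(1)] a(3) by simp
    show "(\<Prod>i<n. row_weight P Q (row_pos M (Suc i)) (state a i) (state a (Suc i))) =
      P_weight P n l a * Q_weight Q n l a"
      unfolding P_weight_eq[OF a(1,2)] Q_weight_eq[OF a(1,2)] row_weight_def prod.distrib by (rule mult.commute)
  next
    fix \<sigma> assume \<sigma>: "\<sigma> \<in> state_paths M n ?T"
    show st: "state (array \<sigma>) = \<sigma>" by (rule state_array[OF \<sigma> T])
    have "\<sigma> n = ?T" using \<sigma> by (simp add: state_paths_def)
    then show "array \<sigma> \<in> ?A"
      using array_trapezoid[OF \<sigma> T] one_column_vector_iff[OF array_trapezoid(1)[OF \<sigma> T] array_trapezoid(2)[OF \<sigma> T] cs(1)] st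
      by simp
  qed
  also have "\<dots> = state_weight P Q M n ?T" by (rule sum_state_paths) simp
  finally show ?thesis .
qed

end

section \<open>The operator formula\<close>

text \<open>
  The variables of \<open>kernel_fun\<close> are numbered from 0, those of \<open>op_fun\<close> from 1.
\<close>

definition op_fun :: "nat \<Rightarrow> 'a::field_char_0 mlaurent \<Rightarrow> (nat \<Rightarrow> int) \<Rightarrow> 'a" where
  "op_fun N K c = ml_constant_term (K * (\<Prod>r = 1..N. ml_of_fls r (fls_Y powi c r)))"

lemma op_fun_rename: "op_fun N (ml_rename Suc K) c = kernel_fun N K (c \<circ> Suc)"
proof -
  have "(\<Prod>r = 1..N. ml_of_fls r (fls_Y powi c r)) = (\<Prod>r<N. ml_of_fls (Suc r) (fls_Y powi c (Suc r)) :: 'a mlaurent)"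
    by (rule prod.reindex_bij_witness[of _ Suc "\<lambda>r. r - 1"]) auto
  also have "\<dots> = ml_rename Suc (ml_monom N (c \<circ> Suc))"
    by (simp add: ml_monom_def ml_rename_prod ml_rename_of_fls)
  finally show ?thesis
    unfolding op_fun_def kernel_fun_def
    by (simp only: ml_rename_mult[symmetric] constant_term_rename inj_Suc)
qed

lemma op_fun_add: "op_fun N (K + L) c = op_fun N K c + op_fun N L c"
  by (simp add: op_fun_def distrib_right constant_term_add)

lemma op_fun_diff: "op_fun N (K - L) c = op_fun N K c - op_fun N L c"
  by (simp add: op_fun_def left_diff_distrib constant_term_diff)

lemma op_fun_uminus: "op_fun N (- K) c = - op_fun N K c"
  by (simp add: op_fun_def constant_term_uminus)

lemma op_fun_const: "op_fun N (ml_const a * K) c = a * op_fun N K c"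
  by (simp add: op_fun_def mult.assoc constant_term_const_mult)

lemma op_fun_upd:
  assumes "r \<in> {1..N}"
  shows "op_fun N K (c(r := c r + d)) = op_fun N (ml_of_fls r (fls_Y powi d) * K) c"
proof -
  have "(\<Prod>i = 1..N. ml_of_fls i (fls_Y powi (c(r := c r + d)) i)) = ml_of_fls r (fls_Y powi (c r + d)) *
      (\<Prod>i\<in>{1..N} - {r}. ml_of_fls i (fls_Y powi c i) :: 'a mlaurent)"
    using assms by (subst prod.remove[of _ r]) auto
  also have "\<dots> = ml_of_fls r (fls_Y powi d) * (\<Prod>i = 1..N. ml_of_fls i (fls_Y powi c i))"
    using assms by (subst (2) prod.remove[of _ r]) (auto simp: power_int_add ml_of_fls_mult mult_ac)
  finally show ?thesis by (simp add: op_fun_def mult_ac)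
qed

lemma shift_op_fun: "r \<in> {1..N} \<Longrightarrow> shift_op r (op_fun N K) = op_fun N (ml_Y r * K)"
  using op_fun_upd[of r N K _ 1] by (auto simp: shift_op_def fun_eq_iff)

lemma shift_inv_op_fun: "r \<in> {1..N} \<Longrightarrow> shift_inv_op r (op_fun N K) = op_fun N (ml_of_fls r (fls_Y powi (- 1)) * K)"
  using op_fun_upd[of r N K _ "- 1"] by (simp only: shift_inv_op_def fun_eq_iff) simp

lemma diff_op_fun: "r \<in> {1..N} \<Longrightarrow> diff_op r (op_fun N K) = op_fun N (ml_X r * K)"
proof -
  assume r: "r \<in> {1..N}"
  have X: "ml_X r * K = ml_Y r * K - K" by (simp add: ml_Y_conv algebra_simps)
  show ?thesis unfolding X using shift_op_fun[OF r, of K] by (auto simp: diff_op_def op_fun_diff)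
qed

lemma diff_op_power_fun: "r \<in> {1..N} \<Longrightarrow> (diff_op r ^^ i) (op_fun N K) = op_fun N (ml_X r ^ i * K)"
  by (induction i) (simp_all add: diff_op_fun mult.assoc)

lemma ml_X_power_regular: "\<exists>B. \<forall>i\<ge>B. ml_regular r (ml_X r ^ i * (F :: 'a::field_char_0 mlaurent))"
proof -
  obtain V b where V: "ml_bounded V b (ml_coeff F)" using ml_coeff[of F] by blast
  have "ml_regular r (ml_X r ^ i * F)" if "i \<ge> nat (- b)" for i
    unfolding ml_regular_def ml_coeff_mult
  proof (intro allI impI)
    fix m assume "ml_conv (ml_coeff (ml_X r ^ i)) (ml_coeff F) m \<noteq> 0"
    then obtain k where k: "ml_coeff (ml_X r ^ i) k \<noteq> (0::'a)" "ml_coeff F (m - k) \<noteq> 0"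
      by (rule ml_conv_nonzero)
    have "ml_X r ^ i = ml_of_fls r (fls_X ^ i :: 'a fls)" by (simp add: ml_X_def ml_of_fls_power)
    then have "fls_nth (fls_X ^ i :: 'a fls) (Poly_Mapping.lookup k r) \<noteq> 0"
      using k(1) by (auto simp: ml_coeff_of_fls split: if_splits)
    then have "Poly_Mapping.lookup k r = int i" by (simp add: fls_X_power_nth split: if_splits)
    moreover have "b \<le> Poly_Mapping.lookup (m - k) r" using V k(2) unfolding ml_bounded_def by blast
    ultimately show "Poly_Mapping.lookup m r \<ge> 0" using that by (simp add: lookup_minus)
  qed
  then show ?thesis by blast
qed

text \<open>Exponents are bounded below, so a high power of x_r removes the pole and one more kills
  the constant term. At each point only finitely many iterated differences are nonzero, which makes
  the sum in \<open>diff_op_Q\<close> finite.\<close>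

lemma op_fun_X_power_eq_0: "\<exists>B. \<forall>i\<ge>B. op_fun N (ml_X r ^ i * K) c = 0"
proof -
  let ?F = "K * (\<Prod>r = 1..N. ml_of_fls r (fls_Y powi c r))"
  obtain B where B: "\<forall>i\<ge>B. ml_regular r (ml_X r ^ i * ?F)" using ml_X_power_regular[of r ?F] by blast
  have "op_fun N (ml_X r ^ i * K) c = 0" if "i \<ge> Suc B" for i
  proof -
    obtain j where j: "i = Suc j" "j \<ge> B" using \<open>i \<ge> Suc B\<close> by (cases i) auto
    have "op_fun N (ml_X r ^ i * K) c = ml_constant_term (ml_X r * (ml_X r ^ j * ?F))"
      by (simp add: op_fun_def j mult_ac)
    also have "\<dots> = 0" using B j by (intro constant_term_X_mult_regular) auto
    finally show ?thesis .
  qed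
  then show ?thesis by blast
qed

text \<open>Q - (1 - Q) x is Q times 1 - (Q^(-1) - 1) x, so this is the truncated geometric series
  of \<open>fls_kappa Q\<close> together with its remainder.\<close>

lemma geometric_kappa:
  assumes "Q \<noteq> 0"
  shows "fls_const (inverse Q) * (\<Sum>i<B. fls_const (inverse Q - 1) ^ i * fls_X ^ Suc i) =
    fls_kappa Q - fls_const (inverse Q - 1) ^ B * fls_X ^ B * fls_kappa Q"
proof (induction B)
  case 0
  then show ?case by simp
next
  case (Suc B)
  let ?\<rho> = "fls_const (inverse Q - 1)"
  have "fls_const Q * (1 - ?\<rho> * fls_X) = fls_lower Q"
    using assms by (simp add: fls_lower_def algebra_simps fls_const_mult_const[symmetric] del: fls_const_mult_const)
      (simp add: fls_minus_const[symmetric] algebra_simps)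
  then have "fls_const (inverse Q) * fls_lower Q = (fls_const (inverse Q) * fls_const Q) * (1 - ?\<rho> * fls_X)"
    by (simp only: mult.assoc)
  also have "fls_const (inverse Q) * fls_const Q = 1" using assms by simp
  finally have lower: "fls_const (inverse Q) * fls_lower Q = 1 - ?\<rho> * fls_X" by simp
  have "fls_lower Q * fls_kappa Q = fls_X" by (simp add: fls_kappa_def)
  then have step: "fls_const (inverse Q) * fls_X = (1 - ?\<rho> * fls_X) * fls_kappa Q"
    by (simp only: lower[symmetric] mult.assoc)
  have "fls_const (inverse Q) * (?\<rho> ^ B * fls_X ^ Suc B) =
      ?\<rho> ^ B * fls_X ^ B * ((1 - ?\<rho> * fls_X) * fls_kappa Q)"
    unfolding step[symmetric] by (simp only: power_Suc mult_ac)
  then show ?case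
    by (simp only: sum.lessThan_Suc distrib_left Suc) (simp add: algebra_simps)
qed

lemma diff_op_Q_fun:
  assumes Q: "Q \<noteq> 0" and r: "r \<in> {1..N}"
  shows "diff_op_Q Q r (op_fun N K) = op_fun N (ml_of_fls r (fls_kappa Q) * K)"
proof
  fix c
  let ?\<rho> = "inverse Q - 1" and ?k = "ml_of_fls r (fls_kappa Q)"
  obtain B1 B2 where B1: "\<forall>i\<ge>B1. op_fun N (ml_X r ^ i * K) c = 0"
    and B2: "\<forall>i\<ge>B2. op_fun N (ml_X r ^ i * (?k * K)) c = 0"
    using op_fun_X_power_eq_0 by metis
  \<comment> \<open>\<open>B1\<close> makes the terms of the infinite sum vanish and
    \<open>B2\<close> the remainder of the geometric series, both at the fixed point
    \<open>c\<close>.\<close>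
  define B where "B = max B1 B2"
  have "Sum_any (\<lambda>i. ?\<rho> ^ i * (diff_op r ^^ (i + 1)) (op_fun N K) c) =
      (\<Sum>i<B. ?\<rho> ^ i * (diff_op r ^^ (i + 1)) (op_fun N K) c)"
  proof (rule Sum_any.expand_superset)
    show "{i. ?\<rho> ^ i * (diff_op r ^^ (i + 1)) (op_fun N K) c \<noteq> 0} \<subseteq> {..<B}"
    proof
      fix i assume "i \<in> {i. ?\<rho> ^ i * (diff_op r ^^ (i + 1)) (op_fun N K) c \<noteq> 0}"
      then have "op_fun N (ml_X r ^ (i + 1) * K) c \<noteq> 0"
        unfolding diff_op_power_fun[OF r] by auto
      then have "i + 1 < B1" using B1 by (meson not_less)
      then show "i \<in> {..<B}" by (simp add: B_def)
    qed
  qed simp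
  also have "\<dots> = (\<Sum>i<B. op_fun N (ml_of_fls r (fls_const ?\<rho> ^ i * fls_X ^ Suc i) * K) c)"
  proof (rule sum.cong[OF refl])
    fix i
    have "ml_of_fls r (fls_const ?\<rho> ^ i * fls_X ^ Suc i) * K = ml_const (?\<rho> ^ i) * (ml_X r ^ Suc i * K)"
      by (simp only: ml_of_fls_mult ml_of_fls_power ml_X_def mult.assoc ml_of_fls_const fls_const_power[symmetric])
    then show "?\<rho> ^ i * (diff_op r ^^ (i + 1)) (op_fun N K) c =
        op_fun N (ml_of_fls r (fls_const ?\<rho> ^ i * fls_X ^ Suc i) * K) c"
      by (simp only: diff_op_power_fun[OF r] op_fun_const Suc_eq_plus1)
  qed
  also have "\<dots> = op_fun N (ml_of_fls r (\<Sum>i<B. fls_const ?\<rho> ^ i * fls_X ^ Suc i) * K) c"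
    by (induction B) (simp_all add: ml_of_fls_add distrib_right op_fun_add del: power_Suc,
        simp add: op_fun_def)
  finally have "diff_op_Q Q r (op_fun N K) c =
      op_fun N (ml_of_fls r (fls_const (inverse Q) * (\<Sum>i<B. fls_const ?\<rho> ^ i * fls_X ^ Suc i)) * K) c"
    by (simp only: diff_op_Q_def ml_of_fls_mult ml_of_fls_const mult.assoc op_fun_const)
  also have "\<dots> = op_fun N (?k * K - ml_const (?\<rho> ^ B) * (ml_X r ^ B * (?k * K))) c"
    unfolding geometric_kappa[OF Q]
    by (simp only: ml_of_fls_diff ml_of_fls_mult ml_of_fls_power ml_X_def mult.assoc left_diff_distrib
        ml_of_fls_const fls_const_power[symmetric])
  also have "\<dots> = op_fun N (?k * K) c"
    using B2 by (simp add: op_fun_diff op_fun_const B_def)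
  finally show "diff_op_Q Q r (op_fun N K) c = op_fun N (?k * K) c" .
qed

lemma neg_diff_op_Q_fun:
  assumes "Q \<noteq> 0" "r \<in> {1..N}"
  shows "neg_diff_op_Q Q r (op_fun N K) = op_fun N (ml_of_fls r (- fls_kappa Q) * K)"
  by (simp add: neg_diff_op_Q_def diff_op_Q_fun[OF assms] ml_of_fls_uminus op_fun_uminus fun_eq_iff)

lemma neg_diff_op_Q_power_fun:
  assumes "Q \<noteq> 0" "r \<in> {1..N}"
  shows "(neg_diff_op_Q Q r ^^ k) (op_fun N K) = op_fun N (ml_of_fls r ((- fls_kappa Q) ^ k) * K)"
proof (induction k)
  case (Suc k)
  then show ?case
    by (simp only: funpow.simps o_apply neg_diff_op_Q_fun[OF assms] power_Suc ml_of_fls_mult mult.assoc)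
qed simp

lemma P_op_fun:
  assumes "Q \<noteq> 0" "r \<in> {1..N}"
  shows "P_op P Q r (op_fun N K) = op_fun N (ml_of_fls r (fls_pi P Q) * K)"
proof
  fix c
  have "ml_of_fls r (fls_pi P Q) * K = K - ml_const (P - 1) * (ml_of_fls r (fls_kappa Q) * K)"
    by (simp add: fls_pi_def ml_of_fls_diff ml_of_fls_mult ml_of_fls_const algebra_simps)
  then show "P_op P Q r (op_fun N K) c = op_fun N (ml_of_fls r (fls_pi P Q) * K) c"
    by (simp add: P_op_def diff_op_Q_fun[OF assms] op_fun_diff op_fun_const)
qed

lemma single_ops_fun:
  assumes "Q \<noteq> 0" "set rs \<subseteq> {1..N}"
  shows "foldr (\<lambda>r. P_op P Q r \<circ> (neg_diff_op_Q Q r ^^ nat (- c r - 1))) rs (op_fun N K) =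
    op_fun N (prod_list (map (\<lambda>r. ml_of_fls r (frozen_series P Q (- c r - 1))) rs) * K)"
  using assms(2)
proof (induction rs)
  case (Cons r rs)
  then show ?case
    by (simp add: neg_diff_op_Q_power_fun[OF assms(1)] P_op_fun[OF assms(1)] frozen_series_def
        ml_of_fls_mult mult.assoc)
qed simp

lemma pair_ops_fun:
  assumes st: "s \<in> {1..N}" "t \<in> {1..N}"
  shows "pair_op_minus Q s t (pair_op_plus Q s t (op_fun N K)) =
    op_fun N (ml_of_fls t (fls_Y powi (- 1)) * (pair_A Q s t * pair_B Q s t) * K)"
proof -
  let ?q = "ml_const (2 - Q)" and ?Yi = "ml_of_fls t (fls_Y powi (- 1))"
  have q: "?q = 2 - ml_const Q" using ml_const_add[of 1 "1::'a"] by (simp add: ml_const_diff)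
  have plus: "pair_op_plus Q s t (op_fun N K) = op_fun N (pair_B Q s t * K)" for K
  proof
    fix c
    have "pair_B Q s t * K = ml_Y s * K + ml_Y t * K - ?q * (ml_Y s * (ml_Y t * K))"
      by (simp add: pair_B_def q algebra_simps)
    then show "pair_op_plus Q s t (op_fun N K) c = op_fun N (pair_B Q s t * K) c"
      by (simp add: pair_op_plus_def shift_op_fun[OF st(1)] shift_op_fun[OF st(2)] op_fun_add op_fun_diff op_fun_const)
  qed
  have minus: "pair_op_minus Q s t (op_fun N K) = op_fun N (?Yi * pair_A Q s t * K)" for K
  proof
    fix c
    have Yi: "?Yi * ml_Y t = (1 :: 'a mlaurent)"
      by (simp add: ml_of_fls_mult[symmetric] power_int_minus)
    have "?Yi * pair_A Q s t * K = (?Yi * ml_Y t) * (ml_Y s * K) + ?Yi * K - ?q * (ml_Y s * (?Yi * K))"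
      by (simp add: pair_A_def q algebra_simps)
    then have "?Yi * pair_A Q s t * K = ml_Y s * K + ?Yi * K - ?q * (ml_Y s * (?Yi * K))"
      unfolding Yi by simp
    then show "pair_op_minus Q s t (op_fun N K) c = op_fun N (?Yi * pair_A Q s t * K) c"
      by (simp only: pair_op_minus_def shift_op_fun[OF st(1)] shift_inv_op_fun[OF st(2)] op_fun_add op_fun_diff op_fun_const)
  qed
  show ?thesis unfolding plus minus by (simp only: mult.assoc)
qed

lemma pair_ops_list_fun:
  assumes "\<And>s t. (s, t) \<in> set ps \<Longrightarrow> s \<in> {1..N} \<and> t \<in> {1..N}"
  shows "foldr (\<lambda>(s, t). pair_op_minus Q s t \<circ> pair_op_plus Q s t) ps (op_fun N K) =
    op_fun N (prod_list (map (\<lambda>(s, t). ml_of_fls t (fls_Y powi (- 1)) * (pair_A Q s t * pair_B Q s t)) ps) * K)"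
  using assms
proof (induction ps)
  case (Cons p ps)
  obtain s t where p: "p = (s, t)" by (cases p)
  have st: "s \<in> {1..N}" "t \<in> {1..N}" using Cons.prems[of s t] p by auto
  have IH: "foldr (\<lambda>(s, t). pair_op_minus Q s t \<circ> pair_op_plus Q s t) ps (op_fun N K) =
    op_fun N (prod_list (map (\<lambda>(s, t). ml_of_fls t (fls_Y powi (- 1)) * (pair_A Q s t * pair_B Q s t)) ps) * K)"
    by (rule Cons.IH) (use Cons.prems in auto)
  let ?F = "\<lambda>(s, t). pair_op_minus Q s t \<circ> pair_op_plus Q s t"
  have "foldr ?F (p # ps) (op_fun N K) = pair_op_minus Q s t (pair_op_plus Q s t (foldr ?F ps (op_fun N K)))"
    by (simp add: p)
  also note IH
  also note pair_ops_fun[OF st]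
  finally show ?case by (simp only: p list.map prod.case prod_list.Cons mult.assoc)
qed simp

lemma prod_list_upt: "prod_list (map f [a..<b]) = (\<Prod>i = a..<b. f i :: 'a::comm_monoid_mult)"
  by (metis atLeastLessThan_upt distinct_upt prod.distinct_set_conv_list)

lemma prod_list_pairs:
  "prod_list (map f [(s, t). s \<leftarrow> [1..<N + 1], t \<leftarrow> [s + 1..<N + 1]]) =
    (\<Prod>(s, t)\<in>index_pairs N. f (Suc s, Suc t) :: 'a::comm_monoid_mult)"
proof -
  have "prod_list (map f [(s, t). s \<leftarrow> xs, t \<leftarrow> [s + 1..<N + 1]]) =
      prod_list (map (\<lambda>s. prod_list (map (\<lambda>t. f (s, t)) [s + 1..<N + 1])) xs)" for xs
    by (induction xs) (simp_all add: o_def)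
  then have "prod_list (map f [(s, t). s \<leftarrow> [1..<N + 1], t \<leftarrow> [s + 1..<N + 1]]) =
      (\<Prod>s = 1..<N + 1. \<Prod>t = s + 1..<N + 1. f (s, t))"
    by (simp only: prod_list_upt)
  also have "\<dots> = (\<Prod>s<N. \<Prod>t = Suc s..<N. f (Suc s, Suc t))"
  proof -
    have "(\<Prod>s = 1..<N + 1. \<Prod>t = s + 1..<N + 1. f (s, t)) = (\<Prod>s<N. \<Prod>t = Suc s + 1..<N + 1. f (Suc s, t))"
      by (rule prod.reindex_bij_witness[of _ Suc "\<lambda>s. s - 1"]) auto
    also have "\<dots> = (\<Prod>s<N. \<Prod>t = Suc s..<N. f (Suc s, Suc t))"
    proof (rule prod.cong[OF refl])
      fix s
      show "(\<Prod>t = Suc s + 1..<N + 1. f (Suc s, t)) = (\<Prod>t = Suc s..<N. f (Suc s, Suc t))"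
        using prod.shift_bounds_Suc_ivl[of "\<lambda>t. f (Suc s, t)" "Suc s" N] by (simp only: Suc_eq_plus1)
    qed
    finally show ?thesis .
  qed
  also have "\<dots> = (\<Prod>(s, t)\<in>index_pairs N. f (Suc s, Suc t))"
    by (rule prod_index_pairs_rows[symmetric])
  finally show ?thesis .
qed


subsection \<open>The base polynomial\<close>

lemma prod_fold_ends:
  fixes f :: "nat \<Rightarrow> 'a::comm_monoid_mult"
  shows "(\<Prod>i<2 * m. f i) = (\<Prod>i<m. f i * f (2 * m - 1 - i))"
proof -
  have "(\<Prod>i<2 * m. f i) = (\<Prod>i<m. f i) * (\<Prod>i\<in>{m..<2 * m}. f i)"
  proof -
    have "(\<Prod>i<2 * m. f i) = prod f ({..<m} \<union> {m..<2 * m})" by (rule prod.cong) auto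
    also have "\<dots> = (\<Prod>i<m. f i) * (\<Prod>i\<in>{m..<2 * m}. f i)" by (rule prod.union_disjoint) auto
    finally show ?thesis .
  qed
  also have "(\<Prod>i\<in>{m..<2 * m}. f i) = (\<Prod>i<m. f (2 * m - 1 - i))"
    by (rule prod.reindex_bij_witness[of _ "\<lambda>i. 2 * m - 1 - i" "\<lambda>i. 2 * m - 1 - i"]) auto
  finally show ?thesis by (simp add: prod.distrib)
qed

text \<open>The factors t - s run through 1, ..., t and the factors s + t + 1 through t + 1, ...,
  2t.\<close>

lemma fact_double_prod: "(\<Prod>s<t. (int t - int s) * (int s + int t + 1)) = fact (2 * t)"
proof -
  have "(fact (2 * t) :: int) = (\<Prod>i<2 * t. int (Suc i))"
    by (simp add: fact_prod_Suc atLeast0LessThan)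
  also have "\<dots> = (\<Prod>i<t. int (Suc i)) * (\<Prod>i\<in>{t..<2 * t}. int (Suc i))"
  proof -
    have "(\<Prod>i<2 * t. int (Suc i)) = (\<Prod>i\<in>{..<t} \<union> {t..<2 * t}. int (Suc i))" by (rule prod.cong) auto
    also have "\<dots> = (\<Prod>i<t. int (Suc i)) * (\<Prod>i\<in>{t..<2 * t}. int (Suc i))" by (rule prod.union_disjoint) auto
    finally show ?thesis .
  qed
  also have "(\<Prod>i<t. int (Suc i)) = (\<Prod>s<t. int t - int s)"
    by (rule prod.reindex_bij_witness[of _ "\<lambda>s. t - 1 - s" "\<lambda>s. t - 1 - s"]) (auto simp: of_nat_diff)
  also have "(\<Prod>i\<in>{t..<2 * t}. int (Suc i)) = (\<Prod>s<t. int s + int t + 1)"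
    by (rule prod.reindex_bij_witness[of _ "\<lambda>s. s + t" "\<lambda>i. i - t"]) auto
  finally show ?thesis by (simp add: prod.distrib)
qed

text \<open>For m = N - 1 - j the factors k and 2m - 1 - k of the falling factorial are symmetric
  about a centre that does not depend on j. Their product is \<xi>_i = v_i (v_i - (2N - 3)) plus a
  constant, so every entry is a polynomial of degree m in \<xi>_i with leading coefficient 1 /
  (2m)!, and a Vandermonde determinant in \<xi> remains.\<close>

lemma det_gbinomial:
  fixes v :: "nat \<Rightarrow> int"
  shows "det (mat N N (\<lambda>(i, j). of_int (v i - int j) gchoose (2 * (N - 1 - j)))) =
    (\<Prod>(s, t)\<in>index_pairs N. of_int ((v t - v s) * (2 * int N - 3 - v s - v t)) /
       of_int ((int t - int s) * (int s + int t + 1)) :: 'a::field_char_0)"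
proof -
  define \<xi> :: "nat \<Rightarrow> 'a" where "\<xi> i = of_int (v i * (v i - (2 * int N - 3)))" for i
  \<comment> \<open>(v - d)(v - (2N - 3 - d)) equals v (v - (2N - 3)) + \<open>g d\<close>.\<close>
  define g :: "int \<Rightarrow> 'a" where "g d = of_int (d * (2 * int N - 3 - d))" for d
  define p where "p m = Polynomial.smult (1 / fact (2 * m)) (\<Prod>i<m. [:g (int N - 1 - int m + int i), 1:])" for m
  have monic: "degree (\<Prod>i\<in>I. [:h i, 1:]) = card I \<and> lead_coeff (\<Prod>i\<in>I. [:h i, 1 :: 'a:]) = 1" if "finite I" for I :: "nat set" and h
  proof -
    have "degree (\<Prod>i\<in>I. [:h i, 1:]) = (\<Sum>i\<in>I. degree [:h i, 1 :: 'a:])"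
      by (rule degree_prod_eq_sum_degree) auto
    moreover have "lead_coeff (\<Prod>i\<in>I. [:h i, 1 :: 'a:]) = 1"
      by (simp only: lead_coeff_prod) simp
    ultimately show ?thesis by simp
  qed
  have deg: "degree (p m) \<le> m" and lead: "coeff (p m) m = 1 / fact (2 * m)" for m
    using monic[of "{..<m}" "\<lambda>i. g (int N - 1 - int m + int i)"] by (auto simp: p_def)
  have entry: "of_int (v i - int j) gchoose (2 * (N - 1 - j)) = poly (p (N - 1 - j)) (\<xi> i)" if "j < N" for i j
  proof -
    define m where "m = N - 1 - j"
    have jm: "int j = int N - 1 - int m" using that by (simp add: m_def)
    have "(of_int (v i - int j) gchoose (2 * m) :: 'a) = (\<Prod>k<2 * m. of_int (v i - int j) - of_nat k) / fact (2 * m)"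
      by (simp add: gbinomial_prod_rev atLeast0LessThan)
    also have "(\<Prod>k<2 * m. of_int (v i - int j) - of_nat k) =
        (\<Prod>k<m. (of_int (v i - int j) - of_nat k) * (of_int (v i - int j) - of_nat (2 * m - 1 - k)) :: 'a)"
      by (rule prod_fold_ends)
    also have "\<dots> = (\<Prod>k<m. g (int N - 1 - int m + int k) + \<xi> i)"
    proof (rule prod.cong[OF refl])
      fix k assume "k \<in> {..<m}"
      then have k: "int (2 * m - 1 - k) = 2 * int m - 1 - int k" by auto
      have "(of_int (v i - int j) - of_nat k) * (of_int (v i - int j) - of_nat (2 * m - 1 - k)) =
          (of_int ((v i - int j - int k) * (v i - int j - int (2 * m - 1 - k))) :: 'a)"
        by simp
      also have "(v i - int j - int k) * (v i - int j - int (2 * m - 1 - k)) =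
          (int N - 1 - int m + int k) * (2 * int N - 3 - (int N - 1 - int m + int k)) + v i * (v i - (2 * int N - 3))"
        unfolding k jm by (simp add: algebra_simps)
      finally show "(of_int (v i - int j) - of_nat k) * (of_int (v i - int j) - of_nat (2 * m - 1 - k)) =
          g (int N - 1 - int m + int k) + \<xi> i"
        by (simp only: g_def \<xi>_def of_int_add)
    qed
    finally show ?thesis unfolding m_def[symmetric] by (simp add: p_def poly_prod)
  qed
  have "mat N N (\<lambda>(i, j). of_int (v i - int j) gchoose (2 * (N - 1 - j))) = mat N N (\<lambda>(i, j). poly (p (N - 1 - j)) (\<xi> i))"
    by (rule eq_matI) (auto simp: entry[simplified])
  then have "det (mat N N (\<lambda>(i, j). of_int (v i - int j) gchoose (2 * (N - 1 - j)))) =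
      (\<Prod>j<N. 1 / fact (2 * j)) * (\<Prod>(s, t)\<in>index_pairs N. \<xi> s - \<xi> t)"
    by (simp only: det_polys[OF deg] lead det_vandermonde)
  also have "(\<Prod>j<N. 1 / fact (2 * j)) = (\<Prod>(s, t)\<in>index_pairs N. 1 / of_int ((int t - int s) * (int s + int t + 1)) :: 'a)"
  proof -
    have "(\<Prod>s<t. 1 / of_int ((int t - int s) * (int s + int t + 1)) :: 'a) = 1 / fact (2 * t)" for t
    proof -
      have "(\<Prod>s<t. 1 / of_int ((int t - int s) * (int s + int t + 1)) :: 'a) =
          1 / of_int (\<Prod>s<t. (int t - int s) * (int s + int t + 1))"
        unfolding of_int_prod by (simp only: prod_dividef prod.neutral_const)
      then show ?thesis unfolding fact_double_prod by simp
    qed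
    then show ?thesis by (simp only: prod_index_pairs)
  qed
  also have "\<dots> * (\<Prod>(s, t)\<in>index_pairs N. \<xi> s - \<xi> t) =
    (\<Prod>(s, t)\<in>index_pairs N. of_int ((v t - v s) * (2 * int N - 3 - v s - v t)) /
       of_int ((int t - int s) * (int s + int t + 1)))"
  proof -
    have e: "\<xi> s - \<xi> t = of_int ((v t - v s) * (2 * int N - 3 - v s - v t))" for s t
      unfolding \<xi>_def of_int_diff[symmetric] by (rule arg_cong[of _ _ of_int]) (simp add: algebra_simps)
    show ?thesis unfolding e prod.distrib[symmetric] by (rule prod.cong) auto
  qed
  finally show ?thesis .
qed

text \<open>The Leibniz expansion separates the variables. The entry in place (i, j) is the constant
  term of Y^(v_i + 1 - N) V^(N - 1 - j), that is, the coefficient of x^(2(N - 1 - j)) in Y^(v_i -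
  j).\<close>

lemma constant_term_vandermonde:
  "ml_constant_term (ml_monom N (\<lambda>r. 1 - int N) * (\<Prod>(s, t)\<in>index_pairs N. ml_V s - ml_V t) * ml_monom N v) =
    (det (mat N N (\<lambda>(i, j). of_int (v i - int j) gchoose (2 * (N - 1 - j)))) :: 'a::field_char_0)"
proof -
  let ?w = "\<lambda>i. v i + 1 - int N"
  let ?e = "\<lambda>i j. fls_nth (fls_Y powi ?w i * fls_V ^ (N - 1 - j)) 0 :: 'a"
  have entry: "?e i j = of_int (v i - int j) gchoose (2 * (N - 1 - j))" if "j < N" for i j
  proof -
    define m where "m = N - 1 - j"
    have "fls_V ^ m = fls_Y powi int m * (fls_X powi (- int (2 * m)) :: 'a fls)"
      unfolding fls_V_def power_divide power_int_of_nat
      by (simp only: power_int_minus power_int_of_nat power_mult divide_inverse)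
    then have "fls_Y powi ?w i * fls_V ^ m = fls_Y powi (v i - int j) * (fls_X powi (- int (2 * m)) :: 'a fls)"
      using that by (simp add: mult.assoc[symmetric] power_int_add[symmetric] m_def del: power_int_of_nat)
    also have "fls_nth \<dots> 0 = of_int (v i - int j) gchoose (2 * m)"
      unfolding fls_X_power_int fls_X_intpow_times_conv_shift by (simp add: fls_nth_Y_powi nat_mult_distrib)
    finally show ?thesis by (simp add: m_def)
  qed
  have sgn: "ml_constant_term (of_int (sign p) * f) = of_int (sign p) * ml_constant_term f" for p :: "nat \<Rightarrow> nat" and f :: "'a mlaurent"
    by (cases "evenperm p") (auto simp: sign_def constant_term_uminus)
  have "ml_monom N (\<lambda>r. 1 - int N) * (\<Prod>(s, t)\<in>index_pairs N. ml_V s - ml_V t) * ml_monom N v =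
      (\<Prod>i<N. ml_of_fls i (fls_Y powi ?w i)) * det (mat N N (\<lambda>(i, j). ml_V i ^ (N - 1 - j) :: 'a mlaurent))"
  proof -
    have "ml_monom N (\<lambda>r. 1 - int N) * ml_monom N v = (\<Prod>i<N. ml_of_fls i (fls_Y powi ?w i) :: 'a mlaurent)"
      unfolding ml_monom_add by (simp add: ml_monom_def algebra_simps)
    moreover have "ml_monom N (\<lambda>r. 1 - int N) * (\<Prod>(s, t)\<in>index_pairs N. ml_V s - ml_V t) * ml_monom N v =
      (ml_monom N (\<lambda>r. 1 - int N) * ml_monom N v) * (\<Prod>(s, t)\<in>index_pairs N. ml_V s - ml_V t :: 'a mlaurent)"
      by (simp only: mult_ac)
    ultimately show ?thesis unfolding det_vandermonde by simp
  qed
  also have "\<dots> = (\<Sum>p | p permutes {0..<N}. of_int (sign p) * (\<Prod>i<N. ml_of_fls i (fls_Y powi ?w i * fls_V ^ (N - 1 - p i))))"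
    unfolding det_def
    by (auto simp: sum_distrib_left atLeast0LessThan prod.distrib ml_of_fls_mult ml_of_fls_power permutes_in_image mult_ac
        intro!: sum.cong prod.cong)
  finally have expand: "ml_monom N (\<lambda>r. 1 - int N) * (\<Prod>(s, t)\<in>index_pairs N. ml_V s - ml_V t) * ml_monom N v =
    (\<Sum>p | p permutes {0..<N}. of_int (sign p) * (\<Prod>i<N. ml_of_fls i (fls_Y powi ?w i * fls_V ^ (N - 1 - p i) :: 'a fls)))" .
  have "ml_constant_term (ml_monom N (\<lambda>r. 1 - int N) * (\<Prod>(s, t)\<in>index_pairs N. ml_V s - ml_V t) * ml_monom N v) =
    (\<Sum>p | p permutes {0..<N}. of_int (sign p) * (\<Prod>i<N. ?e i (p i)))"
    unfolding expand by (simp only: constant_term_sum sgn constant_term_prod_of_fls finite_lessThan)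
  also have "\<dots> = (\<Sum>p | p permutes {0..<N}. of_int (sign p) * (\<Prod>i<N. of_int (v i - int (p i)) gchoose (2 * (N - 1 - p i))))"
  proof (rule sum.cong[OF refl])
    fix p assume p: "p \<in> {p. p permutes {0..<N}}"
    have "(\<Prod>i<N. ?e i (p i)) = (\<Prod>i<N. of_int (v i - int (p i)) gchoose (2 * (N - 1 - p i)))"
    proof (rule prod.cong[OF refl], rule entry)
      fix i assume "i \<in> {..<N}"
      then show "p i < N" using p permutes_in_image[of p "{0..<N}" i] by simp
    qed
    then show "of_int (sign p) * (\<Prod>i<N. ?e i (p i)) =
      of_int (sign p) * (\<Prod>i<N. of_int (v i - int (p i)) gchoose (2 * (N - 1 - p i)))" by (simp only:)
  qed
  also have "\<dots> = det (mat N N (\<lambda>(i, j). of_int (v i - int j) gchoose (2 * (N - 1 - j))))"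
    unfolding det_def
    by (auto simp: atLeast0LessThan permutes_in_image intro!: sum.cong prod.cong)
  finally show ?thesis .
qed

lemma prod_pairs_Suc:
  "(\<Prod>j = 1..N. \<Prod>i = 1..<j. g i j) = (\<Prod>(s, t)\<in>index_pairs N. g (Suc s) (Suc t) :: 'a::comm_monoid_mult)"
proof -
  have "(\<Prod>j = 1..N. \<Prod>i = 1..<j. g i j) = (\<Prod>t<N. \<Prod>i = 1..<Suc t. g i (Suc t))"
    by (rule prod.reindex_bij_witness[of _ Suc "\<lambda>t. t - 1"]) auto
  also have "\<dots> = (\<Prod>t<N. \<Prod>s<t. g (Suc s) (Suc t))"
  proof (rule prod.cong[OF refl])
    fix t
    show "(\<Prod>i = 1..<Suc t. g i (Suc t)) = (\<Prod>s<t. g (Suc s) (Suc t))"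
      by (rule prod.reindex_bij_witness[of _ Suc "\<lambda>t. t - 1"]) auto
  qed
  finally show ?thesis by (simp only: prod_index_pairs)
qed

lemma kernel_fun_monom: "kernel_fun N (K * ml_monom N u) v = kernel_fun N K (\<lambda>r. u r + v r)"
  unfolding kernel_fun_def by (simp only: mult.assoc ml_monom_add)

text \<open>The product in \<open>det_gbinomial\<close> is the base polynomial for v_r = c_{r+1} + r
  - b - 1. The summand r in this exponent is compensated only by the inverse shifts in
  \<open>F_poly\<close>.\<close>

lemma base_poly_fun:
  assumes "n = 2 * N"
  shows "base_poly n b = op_fun N (ml_rename Suc (ml_monom N (\<lambda>_. 1 - int N) *
    (\<Prod>(s, t)\<in>index_pairs N. ml_V s - ml_V t) * ml_monom N (\<lambda>r. int r - b - 1)) :: 'a::field_char_0 mlaurent)"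
proof
  fix c
  let ?v = "\<lambda>r. int r - b - 1 + c (Suc r)"
  have "op_fun N (ml_rename Suc (ml_monom N (\<lambda>_. 1 - int N) *
    (\<Prod>(s, t)\<in>index_pairs N. ml_V s - ml_V t) * ml_monom N (\<lambda>r. int r - b - 1)) :: 'a mlaurent) c =
    ml_constant_term (ml_monom N (\<lambda>_. 1 - int N) * (\<Prod>(s, t)\<in>index_pairs N. ml_V s - ml_V t) * ml_monom N ?v)"
    unfolding op_fun_rename kernel_fun_monom by (simp add: kernel_fun_def)
  also have "\<dots> = (\<Prod>(s, t)\<in>index_pairs N. of_int ((?v t - ?v s) * (2 * int N - 3 - ?v s - ?v t)) /
       of_int ((int t - int s) * (int s + int t + 1)))"
    unfolding constant_term_vandermonde by (rule det_gbinomial)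
  also have "\<dots> = base_poly n b c"
    unfolding base_poly_def assms nonzero_mult_div_cancel_left[OF numeral_neq_zero] prod_pairs_Suc
    by (rule prod.cong[OF refl]) (auto simp: algebra_simps)
  finally show "base_poly n b c = op_fun N (ml_rename Suc (ml_monom N (\<lambda>_. 1 - int N) *
    (\<Prod>(s, t)\<in>index_pairs N. ml_V s - ml_V t) * ml_monom N (\<lambda>r. int r - b - 1)) :: 'a mlaurent) c" by simp
qed

text \<open>Variable t, numbered from 0, is the second one in t pairs, and each of them contributes
  a factor Y_t^(-1). Together they lower the exponent t - b - 1 of Y_t to - b - 1.\<close>

lemma F_poly_fun:
  assumes "n = 2 * N"
  shows "F_poly Q n b = op_fun N (ml_rename Suc (kernel Q N * ml_monom N (\<lambda>_. - b - 1)))"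
proof -
  let ?AB = "\<Prod>(s, t)\<in>index_pairs N. pair_A Q s t * pair_B Q s t"
  let ?V = "\<Prod>(s, t)\<in>index_pairs N. ml_V s - ml_V t :: 'a mlaurent"
  let ?K = "ml_monom N (\<lambda>_. 1 - int N) * ?V * ml_monom N (\<lambda>r. int r - b - 1)"
  let ?ps = "[(s, t). s \<leftarrow> [1..<N + 1], t \<leftarrow> [s + 1..<N + 1]]"
  have half: "n div 2 = N" using assms by simp
  have inj: "inj Suc" by simp
  have Y: "(\<Prod>(s, t)\<in>index_pairs N. ml_of_fls t (fls_Y powi (- 1))) = (ml_monom N (\<lambda>t. - int t) :: 'a mlaurent)"
    unfolding prod_index_pairs ml_monom_def
  proof (rule prod.cong[OF refl])
    fix t
    have "(fls_Y powi (- 1)) ^ t = (fls_Y powi (- int t) :: 'a fls)"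
      by (simp add: power_int_minus power_inverse)
    then show "(\<Prod>s<t. ml_of_fls t (fls_Y powi (- 1))) = (ml_of_fls t (fls_Y powi (- int t)) :: 'a mlaurent)"
      by (simp only: prod_constant card_lessThan ml_of_fls_power[symmetric])
  qed
  have "F_poly Q n b = foldr (\<lambda>(s, t). pair_op_minus Q s t \<circ> pair_op_plus Q s t) ?ps (op_fun N (ml_rename Suc ?K))"
    unfolding F_poly_def half base_poly_fun[OF assms] ..
  also have "\<dots> = op_fun N (prod_list (map (\<lambda>(s, t). ml_of_fls t (fls_Y powi (- 1)) * (pair_A Q s t * pair_B Q s t)) ?ps) * ml_rename Suc ?K)"
    by (rule pair_ops_list_fun) auto
  also have "prod_list (map (\<lambda>(s, t). ml_of_fls t (fls_Y powi (- 1)) * (pair_A Q s t * pair_B Q s t)) ?ps) =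
      (\<Prod>(s, t)\<in>index_pairs N. ml_of_fls (Suc t) (fls_Y powi (- 1)) * (pair_A Q (Suc s) (Suc t) * pair_B Q (Suc s) (Suc t)))"
    unfolding prod_list_pairs by (simp only: prod.case)
  also have "\<dots> = ml_rename Suc (\<Prod>(s, t)\<in>index_pairs N. ml_of_fls t (fls_Y powi (- 1)) * (pair_A Q s t * pair_B Q s t))"
    by (simp only: ml_rename_prod[OF inj] case_prod_unfold ml_rename_mult[OF inj] ml_rename_of_fls[OF inj]
        pair_A_rename[OF inj] pair_B_rename[OF inj])
  also have "(\<Prod>(s, t)\<in>index_pairs N. ml_of_fls t (fls_Y powi (- 1)) * (pair_A Q s t * pair_B Q s t)) =
      ml_monom N (\<lambda>t. - int t) * ?AB"
    unfolding Y[symmetric] by (simp only: case_prod_unfold prod.distrib)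
  also have "ml_rename Suc (ml_monom N (\<lambda>t. - int t) * ?AB) * ml_rename Suc ?K =
      ml_rename Suc (kernel Q N * ml_monom N (\<lambda>_. - b - 1))"
  proof -
    have "ml_monom N (\<lambda>_. - b - 1) = (ml_monom N (\<lambda>t. - int t) * ml_monom N (\<lambda>r. int r - b - 1) :: 'a mlaurent)"
      by (simp add: ml_monom_add)
    then have "kernel Q N * ml_monom N (\<lambda>_. - b - 1) = (ml_monom N (\<lambda>t. - int t) * ?AB) * ?K"
      unfolding kernel_monom by (simp only: mult_ac)
    then show ?thesis by (simp only: ml_rename_mult[OF inj])
  qed
  finally show ?thesis .
qed

section \<open>Comparison of the weighted sum, the operator formula and the constant-term
  expression\<close>

lemma operator_formula_eq:
  assumes Q: "Q \<noteq> 0" and n: "n = 2 * N"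
  shows "operator_formula P Q n b c =
    kernel_fun N (kernel Q N * (\<Prod>r<N. ml_of_fls r (frozen_series P Q (- c (Suc r) - 1)))) (\<lambda>r. c (Suc r) - b - 1)"
proof -
  let ?Z = "\<Prod>r<N. ml_of_fls r (frozen_series P Q (- c (Suc r) - 1))"
  have half: "n div 2 = N" using n by simp
  have inj: "inj Suc" by simp
  have "prod_list (map (\<lambda>r. ml_of_fls r (frozen_series P Q (- c r - 1))) [1..<N + 1]) = ml_rename Suc ?Z"
  proof -
    have "(\<Prod>r = 1..<N + 1. ml_of_fls r (frozen_series P Q (- c r - 1))) = (\<Prod>r<N. ml_of_fls (Suc r) (frozen_series P Q (- c (Suc r) - 1)))"
      by (rule prod.reindex_bij_witness[of _ Suc "\<lambda>r. r - 1"]) auto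
    then show ?thesis by (simp only: prod_list_upt ml_rename_prod[OF inj] ml_rename_of_fls[OF inj])
  qed
  moreover have "set [1..<N + 1] \<subseteq> {1..N}" by auto
  ultimately have "operator_formula P Q n b c = op_fun N (ml_rename Suc ?Z * ml_rename Suc (kernel Q N * ml_monom N (\<lambda>_. - b - 1))) c"
    unfolding operator_formula_def half F_poly_fun[OF n] by (simp only: single_ops_fun[OF Q])
  also have "\<dots> = kernel_fun N (kernel Q N * ?Z * ml_monom N (\<lambda>_. - b - 1)) (c \<circ> Suc)"
    by (simp only: ml_rename_mult[OF inj, symmetric] op_fun_rename mult_ac)
  also have "\<dots> = kernel_fun N (kernel Q N * ?Z) (\<lambda>r. c (Suc r) - b - 1)"
    unfolding kernel_fun_monom by (rule kernel_fun_cong) simp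
  finally show ?thesis .
qed

lemma ct_pair_eq:
  "ct_pair Q s t = (ml_of_fls s (fls_X\<^sup>2) * ml_of_fls t (fls_X\<^sup>2)) * ((ml_V s - ml_V t) * (pair_A Q s t * pair_B Q s t))"
proof -
  have XV: "ml_of_fls r (fls_X\<^sup>2) * ml_V r = (ml_Y r :: 'a mlaurent)" for r
    unfolding fls_V_def ml_of_fls_mult[symmetric] by (simp only: nonzero_mult_div_cancel_left times_divide_eq_right
        power_not_zero fls_X_nonzero not_False_eq_True)
  have X2: "ml_of_fls r (fls_X\<^sup>2) = (ml_X r * ml_X r :: 'a mlaurent)" for r
    by (simp add: ml_X_def ml_of_fls_mult power2_eq_square)
  have 1: "(ml_of_fls s (fls_X\<^sup>2) * ml_of_fls t (fls_X\<^sup>2)) * (ml_V s - ml_V t) =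
      (ml_X t - ml_X s) * (ml_X s + ml_X t + ml_X s * ml_X t :: 'a mlaurent)"
  proof -
    have "(ml_of_fls s (fls_X\<^sup>2) * ml_of_fls t (fls_X\<^sup>2)) * (ml_V s - ml_V t) =
        ml_of_fls t (fls_X\<^sup>2) * (ml_of_fls s (fls_X\<^sup>2) * ml_V s) - ml_of_fls s (fls_X\<^sup>2) * (ml_of_fls t (fls_X\<^sup>2) * ml_V t :: 'a mlaurent)"
      by (simp only: right_diff_distrib mult_ac)
    also have "\<dots> = (ml_X t - ml_X s) * (ml_X s + ml_X t + ml_X s * ml_X t)"
      unfolding XV unfolding X2 ml_Y_conv by (simp add: algebra_simps)
    finally show ?thesis .
  qed
  have 2: "pair_A Q s t = ml_const Q + ml_const (Q - 1) * ml_X s + ml_X t + ml_X s * ml_X t"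
    by (simp add: pair_A_def ml_Y_conv ml_const_diff algebra_simps)
  have 3: "pair_B Q s t = ml_const Q + ml_const (Q - 1) * ml_X s + ml_const (Q - 1) * ml_X t + ml_const (Q - 2) * ml_X s * ml_X t"
    using ml_const_add[of 1 "1::'a"] by (simp add: pair_B_def ml_Y_conv ml_const_diff algebra_simps)
  show ?thesis unfolding mult.assoc[symmetric] 1 unfolding 2 3 ct_pair_def ..
qed

lemma prod_index_pairs_sym:
  "(\<Prod>(s, t)\<in>index_pairs N. g s * g t) = (\<Prod>r<N. g r ^ (N - 1) :: 'a::comm_monoid_mult)"
proof (induction N)
  case 0
  then show ?case by (simp add: index_pairs_def)
next
  case (Suc N)
  have "(\<Prod>r<N. g r ^ (N - 1)) * (\<Prod>r<N. g r) = (\<Prod>r<N. g r ^ N)"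
    unfolding prod.distrib[symmetric] by (rule prod.cong) (auto simp: power_Suc2[symmetric] simp del: power_Suc2)
  then show ?case
    by (simp add: prod_index_pairs_Suc Suc prod.distrib mult.assoc[symmetric])
qed

text \<open>Each variable lies in N - 1 pairs and receives x^2 from each of them by
  \<open>ct_pair_eq\<close>, which cancels x^(2 - n). The exponent of 1 + x_r splits into 1 - N,
  which belongs to the kernel, and c_r - b - 1, the position of the column.\<close>

lemma ct_single_eq:
  assumes "c r \<le> - 1" and n: "n = 2 * N" "N \<ge> 1"
  shows "ct_single P Q n l c r * (fls_X\<^sup>2) ^ (N - 1) =
    fls_Y powi (1 - int N) * frozen_series P Q (- c r - 1) * fls_Y powi (c r - (int l - 5) div 2 - 1)"
proof -
  define b where "b = (int l - 5) div 2"
  have half: "n div 2 = N" using n by simp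
  have X: "fls_X powi (2 - int n) * (fls_X\<^sup>2) ^ (N - 1) = (1 :: 'a fls)"
  proof -
    have gen: "x powi (- int (2 * k)) * (x\<^sup>2) ^ k = 1" if "x \<noteq> 0" for x :: "'a fls" and k
      using that unfolding power_int_minus power_int_of_nat power_mult by simp
    have "2 - int n = - int (2 * (N - 1))" using n by simp
    then show ?thesis using gen[OF fls_X_nonzero, of "N - 1"] by (simp only:)
  qed
  have pi: "(fls_const Q - fls_const (P - Q) * fls_X) / fls_lower Q = fls_pi P Q"
  proof -
    have "fls_const Q - fls_const (P - Q) * fls_X = fls_lower Q - fls_const (P - 1) * fls_X"
      by (simp add: fls_lower_def fls_minus_const[symmetric] algebra_simps)
    then show ?thesis
      by (simp only: fls_pi_def fls_kappa_def diff_divide_distrib times_divide_eq_right) simp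
  qed
  have kap: "(- (fls_X / fls_lower Q)) powi (- c r - 1) = (- fls_kappa Q) ^ nat (- c r - 1)"
    using assms(1) by (simp only: fls_kappa_def power_int_def) simp
  have Y: "fls_Y powi (c r - b - int N) = fls_Y powi (1 - int N) * (fls_Y powi (c r - b - 1) :: 'a fls)"
    by (simp add: power_int_add[symmetric] algebra_simps)
  have "ct_single P Q n l c r * (fls_X\<^sup>2) ^ (N - 1) = (fls_X powi (2 - int n) * (fls_X\<^sup>2) ^ (N - 1)) *
      (fls_Y powi (c r - b - int N) * fls_pi P Q * (- fls_kappa Q) ^ nat (- c r - 1))"
    unfolding ct_single_def fls_Y_def[symmetric] fls_lower_def[symmetric] pi kap half b_def[symmetric]
    by (simp only: mult_ac)
  then show ?thesis unfolding X Y frozen_series_def b_def[symmetric] by (simp only: mult_1_left mult_ac)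
qed

lemma ct_series_eq:
  assumes c: "\<And>r. r \<in> {1..N} \<Longrightarrow> c r \<le> - 1" and n: "n = 2 * N" "N \<ge> 1"
  shows "ml_constant_term (ct_series P Q n l c) =
    kernel_fun N (kernel Q N * (\<Prod>r<N. ml_of_fls r (frozen_series P Q (- c (Suc r) - 1)))) (\<lambda>r. c (Suc r) - (int l - 5) div 2 - 1)"
proof -
  let ?b = "(int l - 5) div 2"
  let ?Z = "\<Prod>r<N. ml_of_fls r (frozen_series P Q (- c (Suc r) - 1))"
  let ?W = "\<Prod>(s, t)\<in>index_pairs N. (ml_V s - ml_V t) * (pair_A Q s t * pair_B Q s t)"
  let ?X = "\<lambda>r. ml_of_fls r (fls_X\<^sup>2) :: 'a mlaurent"
  have half: "n div 2 = N" using n by simp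
  have inj: "inj Suc" by simp
  have pair: "ct_pair Q (Suc s) (Suc t) = ml_rename Suc (ct_pair Q s t)" for s t
    unfolding ct_pair_eq
    by (simp only: ml_rename_mult[OF inj] ml_rename_diff[OF inj] ml_rename_of_fls[OF inj] pair_A_rename[OF inj] pair_B_rename[OF inj])
  have "(\<Prod>r = 1..N. ml_of_fls r (ct_single P Q n l c r)) = ml_rename Suc (\<Prod>r<N. ml_of_fls r (ct_single P Q n l c (Suc r)))"
  proof -
    have "(\<Prod>r = 1..N. ml_of_fls r (ct_single P Q n l c r)) = (\<Prod>r<N. ml_of_fls (Suc r) (ct_single P Q n l c (Suc r)))"
      by (rule prod.reindex_bij_witness[of _ Suc "\<lambda>r. r - 1"]) auto
    then show ?thesis by (simp only: ml_rename_prod[OF inj] ml_rename_of_fls[OF inj])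
  qed
  moreover have "(\<Prod>t = 1..N. \<Prod>s = 1..<t. ct_pair Q s t) = ml_rename Suc (\<Prod>(s, t)\<in>index_pairs N. ct_pair Q s t)"
    unfolding prod_pairs_Suc by (simp only: ml_rename_prod[OF inj] case_prod_unfold pair)
  ultimately have "ct_series P Q n l c = ml_rename Suc ((\<Prod>r<N. ml_of_fls r (ct_single P Q n l c (Suc r))) * (\<Prod>(s, t)\<in>index_pairs N. ct_pair Q s t))"
    unfolding ct_series_def half by (simp only: ml_rename_mult[OF inj])
  then have ct: "ml_constant_term (ct_series P Q n l c) =
      ml_constant_term ((\<Prod>r<N. ml_of_fls r (ct_single P Q n l c (Suc r))) * (\<Prod>(s, t)\<in>index_pairs N. ct_pair Q s t))"
    by (simp only: constant_term_rename[OF inj])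
  have "(\<Prod>(s, t)\<in>index_pairs N. ct_pair Q s t) = (\<Prod>(s, t)\<in>index_pairs N. ?X s * ?X t) * ?W"
    unfolding ct_pair_eq by (simp only: case_prod_unfold prod.distrib)
  also have "(\<Prod>(s, t)\<in>index_pairs N. ?X s * ?X t) = (\<Prod>r<N. ?X r ^ (N - 1))"
    by (rule prod_index_pairs_sym)
  finally have "(\<Prod>r<N. ml_of_fls r (ct_single P Q n l c (Suc r))) * (\<Prod>(s, t)\<in>index_pairs N. ct_pair Q s t) =
      (\<Prod>r<N. ml_of_fls r (ct_single P Q n l c (Suc r) * (fls_X\<^sup>2) ^ (N - 1))) * ?W"
    by (simp only: ml_of_fls_mult ml_of_fls_power prod.distrib mult.assoc)
  also have "(\<Prod>r<N. ml_of_fls r (ct_single P Q n l c (Suc r) * (fls_X\<^sup>2) ^ (N - 1))) =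
      (\<Prod>r<N. ml_of_fls r (fls_Y powi (1 - int N) * frozen_series P Q (- c (Suc r) - 1) * fls_Y powi (c (Suc r) - ?b - 1)))"
  proof (rule prod.cong[OF refl])
    fix r assume "r \<in> {..<N}"
    then have "c (Suc r) \<le> - 1" by (intro c) auto
    from ct_single_eq[where r = "Suc r" and c = c and P = P and Q = Q and l = l, OF this n]
    show "ml_of_fls r (ct_single P Q n l c (Suc r) * (fls_X\<^sup>2) ^ (N - 1)) =
      ml_of_fls r (fls_Y powi (1 - int N) * frozen_series P Q (- c (Suc r) - 1) * fls_Y powi (c (Suc r) - ?b - 1))"
      by (simp only:)
  qed
  also have "\<dots> * ?W = kernel Q N * ?Z * ml_monom N (\<lambda>r. c (Suc r) - ?b - 1)"
    unfolding kernel_def ml_monom_def by (simp only: ml_of_fls_mult prod.distrib mult_ac)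
  finally show ?thesis unfolding ct kernel_fun_def by (simp only:)
qed

theorem theorem4p2:
  fixes n l :: nat and c :: "nat \<Rightarrow> int" and P Q :: "'a::field_char_0"
  assumes "n \<ge> 2" and "even n" and "l \<ge> 3" and "odd l"
    and "\<And>r. r \<in> {1..n div 2} \<Longrightarrow> - int n \<le> c r \<and> c r \<le> - 1"
    and "strict_mono_on {1..n div 2} c"
    and "Q \<noteq> 0"
  shows "(\<Sum>a | alternating_sign_trapezoid n l a \<and> vertically_symmetric n l a \<and>
              one_column_vector n l a = map c [1..<n div 2 + 1].
            P_weight P n l a * Q_weight Q n l a)
          = operator_formula P Q n ((int l - 5) div 2) c
         \<and> operator_formula P Q n ((int l - 5) div 2) c = ml_constant_term (ct_series P Q n l c)"
proof -
  define N where "N = n div 2"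
  define M where "M = n - 1 + (l - 1) div 2"
  define b where "b = (int l - 5) div 2"
  \<comment> \<open>The position of the column numbered \<open>c (Suc r)\<close>: since M = n + b +
    1, the shift n - M from numbers to positions is - b - 1.\<close>
  define t where "t r = c (Suc r) - b - 1" for r
  let ?cs = "map c [1..<n div 2 + 1]"
  have nN: "n = 2 * N" "N \<ge> 1" using assms(1,2) by (auto simp: N_def)
  interpret trapezoid n l M
    using assms(1-4) by unfold_locales (auto simp: M_def)
  have M_eq: "int M = int n + b + 1"
    using assms(1,3,4) by (auto simp: M_def b_def elim!: oddE)
  have c_range: "- int n \<le> c r \<and> c r \<le> - 1" if "r \<in> {1..N}" for r
    using assms(5)[of r] that by (simp add: N_def)
  have c_less: "c i < c j" if "i \<in> {1..N}" "j \<in> {1..N}" "i < j" for i j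
    using strict_mono_onD[OF assms(6), of i j] that by (simp add: N_def)
  have t_strict: "strict_mono_on {..<N} t"
    by (rule strict_mono_onI) (auto simp: t_def intro!: c_less)
  \<comment> \<open>After row n all 1-columns of the left half have ended. The column numbered c has
    its lowest entry -c - 1 rows before the last, which is the exponent in the operator
    formula.\<close>
  have t_less: "t r \<le> row_pos M n" "t r < 0" "row_pos M n - t r = - c (Suc r) - 1" if "r < N" for r
    using c_range[of "Suc r"] that M_eq n_le_M by (auto simp: t_def row_pos_def)
  have "sorted_wrt (<) ?cs"
    unfolding sorted_wrt_map
    by (rule sorted_wrt_mono_rel[OF _ sorted_wrt_upt]) (auto simp: N_def[symmetric] intro!: c_less)
  moreover have "set ?cs \<subseteq> {- int n.. - 1}"
    using c_range by (auto simp: N_def)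
  ultimately have "(\<Sum>a | alternating_sign_trapezoid n l a \<and> vertically_symmetric n l a \<and> one_column_vector n l a = ?cs.
      P_weight P n l a * Q_weight Q n l a) = state_weight P Q M n ((\<lambda>x. x + int n - int M) ` set ?cs)"
    by (rule sum_trapezoids)
  also have "(\<lambda>x. x + int n - int M) ` set ?cs = t ` {..<n div 2}"
  proof -
    have "set [1..<n div 2 + 1] = Suc ` {..<n div 2}" 
      unfolding set_upt lessThan_atLeast0 image_Suc_atLeastLessThan by (simp only: Suc_eq_plus1 add_0)
    moreover have "t = (\<lambda>r. c (Suc r) + int n - int M)" by (auto simp: t_def M_eq)
    ultimately show ?thesis by (simp only: set_map image_image)
  qed
  also have "state_weight P Q M n (t ` {..<n div 2}) = kernel_fun N (kernel Q N *
      (\<Prod>r<card {y \<in> t ` {..<N}. y \<le> row_pos M n}. ml_of_fls r (frozen_series P Q (row_pos M n - t r)))) t"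
    using state_weight_eq[OF \<open>Q \<noteq> 0\<close>, of n t P M] t_strict t_less(2) assms(2)
    by (simp add: N_def row_kernel_def)
  also have "card {y \<in> t ` {..<N}. y \<le> row_pos M n} = N"
  proof -
    have "{y \<in> t ` {..<N}. y \<le> row_pos M n} = t ` {..<N}" using t_less(1) by auto
    then show ?thesis using t_strict by (simp add: card_image strict_mono_on_imp_inj_on)
  qed
  also have "(\<Prod>r<N. ml_of_fls r (frozen_series P Q (row_pos M n - t r))) =
      (\<Prod>r<N. ml_of_fls r (frozen_series P Q (- c (Suc r) - 1)))"
    by (rule prod.cong) (auto simp: t_less(3))
  also have "t = (\<lambda>r. c (Suc r) - (int l - 5) div 2 - 1)" by (auto simp: t_def b_def)
  finally show ?thesis
    using operator_formula_eq[OF \<open>Q \<noteq> 0\<close> nN(1), of P "(int l - 5) div 2" c] ct_series_eq[of N c n P Q l] c_range nN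
    by simp
qed

end
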